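(* Let $\mathbb{H}^N$ be the Heisenberg group with homogeneous dimension $Q=2N+2$, let $\lambda\in\big(0,\big(\tfrac{Q-2}{2}\big)^2\big)$, $\gamma\in(0,1)$, $\alpha\in(-1,\infty)$, and let $0\le u_0,f\in L^\infty(\mathbb{H}^N)$. Then, for any $p>\frac{\mu(\lambda)+2}{\mu(\lambda)}$, the problem $$\partial_tu-\Delta_{H}u=\lambda \frac{\psi u}{\|\cdot\|_{H}^{2}}+\frac{1}{\Gamma(\gamma)}\int_0^t(t-\tau)^{\gamma-1}|u(\tau)|^{p}\,d\tau+t^\alpha f \ \text{ in } \mathbb{H}^N\times(0,T),\qquad u(\cdot,0)=u_0 \ \text{ in } \mathbb{H}^N,$$ does not admit (for any $T>0$) a local-in-time weak solution $u$ satisfying the following condition: there exist constants $\delta>0$ and $\theta\in(0,1]$ such that for each $t\in(0,T)$ and each $s\in[t-\delta,t]$ with $s\ge 0$, $$u(s,\xi)\ge\theta\,u(t,\xi)\quad\text{for all }\xi\in\mathbb{H}^N .$$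
   Context: **Heisenberg group.** $\mathbb{H}^N$ is $\mathbb{R}^{2N+1}$ with points $\xi=(x,y,w)$, $x,y\in\mathbb{R}^N$, $w\in\mathbb{R}$, and group law $(x,y,w)\circ(x',y',w')=(x+x',y+y',w+w'+2\langle y,x'\rangle-2\langle x,y'\rangle)$. $Q=2N+2$. $d\xi$ is Lebesgue measure on $\mathbb{R}^{2N+1}$. Let $X_i=\partial_{x_i}+2y_i\partial_w$, $Y_i=\partial_{y_i}-2x_i\partial_w$ ($1\le i\le N$); $\nabla_H u=(X_1u,\dots,X_Nu,Y_1u,\dots,Y_Nu)$; $\Delta_H=\sum_{i=1}^N(X_i^2+Y_i^2)$; $\nabla_H\cdot$ denotes the corresponding horizontal divergence. The Korányi norm is $\|\xi\|_H=\big[\big(\sum_{i=1}^N(x_i^2+y_i^2)\big)^2+w^2\big]^{1/4}$, and $\psi=\big|\nabla_H\|\cdot\|_H\big|^2$. **Constant $\mu(\lambda)$.** For $\lambda\in(0,(\frac{Q-2}{2})^2)$, $\mu(\lambda)=\frac{Q-2}{2}-\sqrt{\big(\frac{Q-2}{2}\big)^2-\lambda}$. **Fractional integral.** For $\gamma\in(0,1)$, $I_{T^-}^\gamma\phi(t)=\frac{1}{\Gamma(\gamma)}\int_t^T(\tau-t)^{\gamma-1}\phi(\tau)\,d\tau$. **Notation.** $u(t,\xi)$ denotes the value of $u$ at time $t$ and point $\xi$ (also written $u(\xi,t)$). **Weak solution.** Put $v(\xi,t)=\|\xi\|_H^{\mu(\lambda)}u(\xi,t)$, $v(0,\xi)=\|\xi\|_H^{\mu(\lambda)}u_0(\xi)$,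 and $L_H\phi=-\nabla_H\cdot\big(\|\cdot\|_H^{-2\mu(\lambda)}\nabla_H\phi\big)$. Let $v(0,\cdot)\in L^1_{\rm loc}(\mathbb{H}^N,\|\xi\|_H^{-2\mu(\lambda)}d\xi)$ and $f\in L^1_{\rm loc}(\mathbb{H}^N,\|\xi\|_H^{-\mu(\lambda)}d\xi)$. The function $v\in L^p_{\rm loc}((0,T),L^p_{\rm loc}(\mathbb{H}^N,\|\xi\|_H^{-(p+1)\mu(\lambda)}d\xi))\cap L^1_{\rm loc}((0,T),L^1_{\rm loc}(\mathbb{H}^N,\|\xi\|_H^{-2\mu(\lambda)}d\xi))$ (equivalently $u$) is a local-in-time weak solution of the problem on $(0,T)$ if $$-\int_0^T\!\!\int_{\mathbb{H}^N}v\big(\|\xi\|_H^{-2\mu(\lambda)}\partial_t\phi-L_H\phi\big)d\xi dt=\int_0^T\!\!\int_{\mathbb{H}^N}\|\xi\|_H^{-(p+1)\mu(\lambda)}|v|^pI^\gamma_{T^-}\phi\,d\xi dt+\int_{\mathbb{H}^N}\|\xi\|_H^{-2\mu(\lambda)}v(0,\xi)\phi(0,\xi)d\xi+\int_0^T\!\!\int_{\mathbb{H}^N}\|\xi\|_H^{-\mu(\lambda)}t^\alpha f\phi\,d\xi dt$$ for every non-negative test function $\phi\in C_c^1([0,T),C_c^2(\mathbb{H}^N))$.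
   Formalization: The formal statement excepts the trivial case where u_0 = 0, f = 0 and u = 0 almost everywhere, since with zero data the zero function is a weak solution satisfying the condition; for zero data it still excludes every nonzero solution. *)

theory Defs
  imports "HOL-Analysis.Analysis"
begin

text \<open>Points of the Heisenberg group of dimension \<open>2N+1\<close>, \<open>N = CARD('n)\<close>, written \<open>(x, y, w)\<close>.
  The group law enters below only through the left-invariant fields \<open>heis_X\<close> and \<open>heis_Y\<close>.\<close>

type_synonym 'n heis = "(real ^ 'n) \<times> (real ^ 'n) \<times> real"

definition hom_dim :: "'n::finite itself \<Rightarrow> real" where
  "hom_dim _ = 2 * real CARD('n) + 2"

definition knorm :: "'n::finite heis \<Rightarrow> real" where
  "knorm = (\<lambda>(x, y, w). ((\<Sum>i\<in>UNIV. (x $ i)\<^sup>2 + (y $ i)\<^sup>2)\<^sup>2 + w\<^sup>2) powr (1 / 4))"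

definition hardy_mu :: "'n::finite itself \<Rightarrow> real \<Rightarrow> real" where
  "hardy_mu N lam = (hom_dim N - 2) / 2 - sqrt (((hom_dim N - 2) / 2)\<^sup>2 - lam)"


subsection \<open>Differential operators\<close>

definition pderiv_dir :: "'a::real_normed_vector \<Rightarrow> ('a \<Rightarrow> real) \<Rightarrow> 'a \<Rightarrow> real" where
  "pderiv_dir b g \<xi> = deriv (\<lambda>h. g (\<xi> + h *\<^sub>R b)) 0"

definition heis_X :: "'n::finite \<Rightarrow> ('n heis \<Rightarrow> real) \<Rightarrow> 'n heis \<Rightarrow> real" where
  "heis_X i g = (\<lambda>(x, y, w). pderiv_dir (axis i 1, 0, 0) g (x, y, w)
                           + 2 * (y $ i) * pderiv_dir (0, 0, 1) g (x, y, w))"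

definition heis_Y :: "'n::finite \<Rightarrow> ('n heis \<Rightarrow> real) \<Rightarrow> 'n heis \<Rightarrow> real" where
  "heis_Y i g = (\<lambda>(x, y, w). pderiv_dir (0, axis i 1, 0) g (x, y, w)
                           - 2 * (x $ i) * pderiv_dir (0, 0, 1) g (x, y, w))"

text \<open>\<open>L_H \<phi> = - div_H (knorm powr (-2\<mu>) \<nabla>_H \<phi>)\<close>. The value at the origin, where the weight is
  singular, is immaterial, because the operator only occurs under integrals.\<close>

definition heis_L :: "real \<Rightarrow> ('n::finite heis \<Rightarrow> real) \<Rightarrow> 'n heis \<Rightarrow> real" where
  "heis_L \<mu> g \<xi> = - (\<Sum>i\<in>UNIV. heis_X i (\<lambda>\<eta>. knorm \<eta> powr (- 2 * \<mu>) * heis_X i g \<eta>) \<xi>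
                            + heis_Y i (\<lambda>\<eta>. knorm \<eta> powr (- 2 * \<mu>) * heis_Y i g \<eta>) \<xi>)"


subsection \<open>Test functions\<close>

text \<open>\<open>C^k\<close> in the usual (Euclidean) sense: all partial derivatives up to order \<open>k\<close> exist and are
  continuous.\<close>

primrec Ck :: "nat \<Rightarrow> ('a::euclidean_space \<Rightarrow> real) \<Rightarrow> bool" where
  "Ck 0 g \<longleftrightarrow> continuous_on UNIV g"
| "Ck (Suc k) g \<longleftrightarrow> continuous_on UNIV g \<and>
     (\<forall>b\<in>Basis. (\<forall>\<xi>. (\<lambda>h. g (\<xi> + h *\<^sub>R b)) differentiable (at 0)) \<and> Ck k (pderiv_dir b g))"

definition C2_norm :: "('a::euclidean_space \<Rightarrow> real) \<Rightarrow> real" where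
  "C2_norm g = (SUP \<xi>. \<bar>g \<xi>\<bar>) + (\<Sum>b\<in>Basis. SUP \<xi>. \<bar>pderiv_dir b g \<xi>\<bar>)
     + (\<Sum>b\<in>Basis. \<Sum>c\<in>Basis. SUP \<xi>. \<bar>pderiv_dir c (pderiv_dir b g) \<xi>\<bar>)"

definition time_deriv :: "real \<Rightarrow> (real \<Rightarrow> 'a \<Rightarrow> real) \<Rightarrow> real \<Rightarrow> 'a \<Rightarrow> real" where
  "time_deriv T \<phi> t \<xi> = vector_derivative (\<lambda>s. \<phi> s \<xi>) (at t within {0..<T})"

text \<open>The space \<open>C_c^1([0,T), C_c^2)\<close>: the map \<open>t \<mapsto> \<phi>(t,\<cdot>)\<close> is compactly supported in \<open>[0,T)\<close> and
  continuously differentiable into \<open>C_c^2\<close>. A compact subset of the inductive limit \<open>C_c^2\<close>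
  consists of functions supported in one fixed compact \<open>K\<close>, on which the topology is given by
  the \<open>C^2\<close> norm; hence the common \<open>K\<close>. Values \<open>\<phi> t\<close> with \<open>t\<close> outside \<open>[0,T)\<close> are irrelevant.\<close>

definition test_function :: "real \<Rightarrow> (real \<Rightarrow> 'a::euclidean_space \<Rightarrow> real) \<Rightarrow> bool" where
  "test_function T \<phi> \<longleftrightarrow>
     (\<exists>K T'. compact K \<and> T' < T \<and> (\<forall>t\<in>{0..<T}. \<forall>\<xi>. \<phi> t \<xi> \<noteq> 0 \<longrightarrow> t \<le> T' \<and> \<xi> \<in> K)) \<and>
     (\<forall>t\<in>{0..<T}. Ck 2 (\<phi> t) \<and> Ck 2 (time_deriv T \<phi> t)) \<and>
     (\<forall>t\<in>{0..<T}. ((\<lambda>s. C2_norm (\<lambda>\<xi>. (\<phi> s \<xi> - \<phi> t \<xi>) / (s - t) - time_deriv T \<phi> t \<xi>)) \<longlongrightarrow> 0)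
                     (at t within {0..<T})) \<and>
     (\<forall>t\<in>{0..<T}. ((\<lambda>s. C2_norm (\<lambda>\<xi>. time_deriv T \<phi> s \<xi> - time_deriv T \<phi> t \<xi>)) \<longlongrightarrow> 0)
                     (at t within {0..<T}))"

definition frac_int :: "real \<Rightarrow> real \<Rightarrow> (real \<Rightarrow> real) \<Rightarrow> real \<Rightarrow> real" where
  "frac_int T \<gamma> g t = 1 / Gamma \<gamma> * (LINT \<tau>:{t<..<T}|lebesgue. (\<tau> - t) powr (\<gamma> - 1) * g \<tau>)"


subsection \<open>Function spaces\<close>

definition Linf :: "('a::euclidean_space \<Rightarrow> real) \<Rightarrow> bool" where
  "Linf g \<longleftrightarrow> g \<in> borel_measurable lebesgue \<and> (\<exists>C. AE \<xi> in lebesgue. \<bar>g \<xi>\<bar> \<le> C)"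

definition L1_loc :: "('a::euclidean_space \<Rightarrow> real) \<Rightarrow> ('a \<Rightarrow> real) \<Rightarrow> bool" where
  "L1_loc \<omega> g \<longleftrightarrow> g \<in> borel_measurable lebesgue \<and>
     (\<forall>K. compact K \<longrightarrow> (\<lambda>\<xi>. \<omega> \<xi> * g \<xi>) absolutely_integrable_on K)"

text \<open>\<open>L^p_loc((0,T), L^p_loc(\<omega> d\<xi>))\<close>, with \<open>L^p(J, L^p(K))\<close> identified with \<open>L^p(J \<times> K)\<close>.\<close>

definition Lp_loc :: "real \<Rightarrow> real \<Rightarrow> ('a::euclidean_space \<Rightarrow> real) \<Rightarrow> (real \<Rightarrow> 'a \<Rightarrow> real) \<Rightarrow> bool" where
  "Lp_loc T p \<omega> v \<longleftrightarrow>
     (\<lambda>(t, \<xi>). v t \<xi>) \<in> borel_measurable (lebesgue_on ({0<..<T} \<times> UNIV)) \<and>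
     (\<forall>J K. compact J \<and> J \<subseteq> {0<..<T} \<and> compact K \<longrightarrow>
        (\<lambda>(t, \<xi>). \<omega> \<xi> * \<bar>v t \<xi>\<bar> powr p) absolutely_integrable_on (J \<times> K))"


subsection \<open>Weak solutions\<close>

text \<open>The weak identity for \<open>v = knorm powr \<mu> * u\<close>; the Hardy potential \<open>\<lambda> \<psi> / knorm^2\<close> is absorbed
  into the weights. Since Bochner integrals of non-integrable functions are \<open>0\<close> by
  convention, the existence of each integral is required explicitly.\<close>

definition weak_identity ::
  "real \<Rightarrow> real \<Rightarrow> real \<Rightarrow> real \<Rightarrow> real \<Rightarrow> ('n::finite heis \<Rightarrow> real) \<Rightarrow> ('n heis \<Rightarrow> real) \<Rightarrow>
   (real \<Rightarrow> 'n heis \<Rightarrow> real) \<Rightarrow> (real \<Rightarrow> 'n heis \<Rightarrow> real) \<Rightarrow> bool" where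
  "weak_identity \<mu> p \<gamma> \<alpha> T f v0 v \<phi> \<longleftrightarrow>
     (let D = {0<..<T} \<times> (UNIV :: 'n heis set);
          A = (\<lambda>(t, \<xi>). v t \<xi> * (knorm \<xi> powr (- 2 * \<mu>) * time_deriv T \<phi> t \<xi> - heis_L \<mu> (\<phi> t) \<xi>));
          B = (\<lambda>(t, \<xi>). knorm \<xi> powr (- (p + 1) * \<mu>) * \<bar>v t \<xi>\<bar> powr p
                          * frac_int T \<gamma> (\<lambda>\<tau>. \<phi> \<tau> \<xi>) t);
          C = (\<lambda>\<xi>. knorm \<xi> powr (- 2 * \<mu>) * v0 \<xi> * \<phi> 0 \<xi>);
          F = (\<lambda>(t, \<xi>). knorm \<xi> powr (- \<mu>) * t powr \<alpha> * f \<xi> * \<phi> t \<xi>)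
      in A absolutely_integrable_on D \<and> B absolutely_integrable_on D \<and>
         C absolutely_integrable_on UNIV \<and> F absolutely_integrable_on D \<and>
         - (LINT z:D|lebesgue. A z)
           = (LINT z:D|lebesgue. B z) + (LINT \<xi>|lebesgue. C \<xi>) + (LINT z:D|lebesgue. F z))"

text \<open>The function \<open>u\<close> is defined on \<open>[0,T)\<close>, and \<open>u 0\<close> is the initial datum (as an element of
  \<open>L^\<infinity>\<close>, hence up to a null set).\<close>

definition weak_solution ::
  "real \<Rightarrow> real \<Rightarrow> real \<Rightarrow> real \<Rightarrow> real \<Rightarrow> ('n::finite heis \<Rightarrow> real) \<Rightarrow> ('n heis \<Rightarrow> real) \<Rightarrow>
   (real \<Rightarrow> 'n heis \<Rightarrow> real) \<Rightarrow> bool" where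
  "weak_solution lam p \<gamma> \<alpha> T u0 f u \<longleftrightarrow>
     (let \<mu> = hardy_mu TYPE('n) lam;
          v = (\<lambda>t \<xi>. knorm \<xi> powr \<mu> * u t \<xi>);
          v0 = (\<lambda>\<xi>. knorm \<xi> powr \<mu> * u0 \<xi>)
      in (AE \<xi> in lebesgue. u 0 \<xi> = u0 \<xi>) \<and>
         L1_loc (\<lambda>\<xi>. knorm \<xi> powr (- 2 * \<mu>)) v0 \<and>
         L1_loc (\<lambda>\<xi>. knorm \<xi> powr (- \<mu>)) f \<and>
         Lp_loc T p (\<lambda>\<xi>. knorm \<xi> powr (- (p + 1) * \<mu>)) v \<and>
         Lp_loc T 1 (\<lambda>\<xi>. knorm \<xi> powr (- 2 * \<mu>)) v \<and>
         (\<forall>\<phi>. test_function T \<phi> \<and> (\<forall>t\<in>{0..<T}. \<forall>\<xi>. 0 \<le> \<phi> t \<xi>) \<longrightarrow>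
            weak_identity \<mu> p \<gamma> \<alpha> T f v0 v \<phi>))"

text \<open>With zero data the zero function is a weak solution, so a nonexistence result has to except this
  case.\<close>

definition trivial_case ::
  "real \<Rightarrow> ('a::euclidean_space \<Rightarrow> real) \<Rightarrow> ('a \<Rightarrow> real) \<Rightarrow> (real \<Rightarrow> 'a \<Rightarrow> real) \<Rightarrow> bool" where
  "trivial_case T u0 f u \<longleftrightarrow>
     (AE \<xi> in lebesgue. u0 \<xi> = 0) \<and> (AE \<xi> in lebesgue. f \<xi> = 0) \<and>
     (AE z in lebesgue_on ({0<..<T} \<times> UNIV). (case z of (t, \<xi>) \<Rightarrow> u t \<xi> = 0))"

end

theory Submission
  imports Defs
begin

text \<open>Write \<rho> for the Koranyi norm, w = \<rho>^(-2\<mu>) and v = \<rho>^\<mu> u. Two bounds for v near the origin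
  contradict each other unless v = 0.

  The upper bound comes from the monotonicity condition. Chaining it over time steps of length
  \<delta> gives \<Theta> u(t) \<le> u(s) for all 0 \<le> s \<le> t with one constant \<Theta> > 0
  (\<open>almost_monotone_chain\<close>). At s = 0 the bounded datum u0 bounds u from above, so v \<le> C \<rho>^\<mu>.

  The lower bound comes from the equation. The nonlinear term, the datum and f enter the weak
  identity with one sign, so v is a supersolution of w v_t + L v = 0. Almost-monotonicity in time
  absorbs the time derivative of a cutoff into a term k w v, which makes v a supersolution of
  L + k w after integration in time. A nonnegative supersolution of L + k w that is not zero is
  bounded away from zero near the origin, that is, u \<ge> c \<rho>^(-\<mu>) there. Instead of a weak Harnack
  inequality, the proof uses explicit compactly supported subsolutions as test functions
  (\<open>weighted_supersolution_vanishes\<close>). They depend on \<xi> only through s = |x|^2 + |y|^2 and the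
  vertical coordinate; on such functions L is an operator in two variables
  (\<open>heis_L_profile\<close>) and the subsolution property is an inequality between elementary functions.
  One barrier, slightly more singular at the origin than the fundamental solution of L, bounds the
  mass of v at unit scale by its mass in a shrinking ball; the upper bound on v then gives v = 0
  near the origin (\<open>singular_barrier\<close>). A second one carries the vanishing over to the whole group
  (\<open>spreading_barrier\<close>). With v = 0 the weak identity only contains the data, and u0 = f = 0.

  This needs v \<ge> 0. For \<theta> < 1 the condition with s = t gives u \<ge> 0. For \<theta> = 1 the function u is
  nonincreasing in time but may change sign. Letting t tend to 0 shows that v(0) is itself a
  supersolution of L, hence v(0) = 0 by the argument above (\<open>initial_datum_vanishes\<close>) and u \<le> 0.
  For g = -v \<ge> 0 the nonlinear term is an absorption term, and testing with the cutoffs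
  (1 - \<rho>^4/R)_+^m for a large power m forces g = 0 as R tends to infinity
  (\<open>nonpos_solution_vanishes\<close>).\<close>

section \<open>The weighted sub-Laplacian in cylindrical coordinates\<close>

text \<open>The test functions below are functions of these two coordinates. The half-plane of values carries
  the whole analysis: the dimension survives only as a coefficient.\<close>

definition cyl :: "'n::finite heis \<Rightarrow> real \<times> real" where
  "cyl \<xi> = (fst \<xi> \<bullet> fst \<xi> + fst (snd \<xi>) \<bullet> fst (snd \<xi>), snd (snd \<xi>))"

text \<open>Fourth power of the Koranyi norm; it is a polynomial, so it is smooth where the norm is not.\<close>

definition knorm4 :: "real \<times> real \<Rightarrow> real" where
  "knorm4 q = (fst q)\<^sup>2 + (snd q)\<^sup>2"

lemma knorm4_nonneg [simp]: "0 \<le> knorm4 q"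
  by (simp add: knorm4_def)

lemma knorm4_pos_iff: "0 < knorm4 q \<longleftrightarrow> q \<noteq> 0"
  by (cases q) (simp add: knorm4_def sum_power2_gt_zero_iff zero_prod_def)

lemma cyl_fst_nonneg [simp]: "0 \<le> fst (cyl \<xi>)"
  by (simp add: cyl_def)

lemma cyl_eq_0_iff: "cyl \<xi> = 0 \<longleftrightarrow> \<xi> = 0"
proof
  assume "cyl \<xi> = 0"
  then have "fst \<xi> \<bullet> fst \<xi> + fst (snd \<xi>) \<bullet> fst (snd \<xi>) = 0" "snd (snd \<xi>) = 0"
    by (auto simp: cyl_def zero_prod_def)
  then have "fst \<xi> = 0" "fst (snd \<xi>) = 0" "snd (snd \<xi>) = 0"
    by (auto simp: add_nonneg_eq_0_iff)
  then show "\<xi> = 0" by (simp add: prod_eq_iff)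
qed (simp add: cyl_def zero_prod_def)

lemma knorm4_cyl_pos: "\<xi> \<noteq> 0 \<Longrightarrow> 0 < knorm4 (cyl \<xi>)"
  by (simp add: knorm4_pos_iff cyl_eq_0_iff)

lemma knorm_knorm4: "knorm \<xi> = knorm4 (cyl \<xi>) powr (1/4)"
  by (simp add: knorm_def knorm4_def cyl_def split_beta inner_vec_def sum.distrib power2_eq_square)

lemma knorm_powr: "knorm \<xi> powr a = knorm4 (cyl \<xi>) powr (a/4)"
  by (simp add: knorm_knorm4 powr_powr)

lemma continuous_on_cyl [continuous_intros]: "continuous_on S cyl"
  unfolding cyl_def by (intro continuous_intros)

lemma continuous_on_knorm4 [continuous_intros]: "continuous_on S knorm4"
  unfolding knorm4_def by (intro continuous_intros)

lemma cyl_has_derivative: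
  "(cyl has_derivative (\<lambda>\<eta>. (2 * (fst \<xi> \<bullet> fst \<eta> + fst (snd \<xi>) \<bullet> fst (snd \<eta>)), snd (snd \<eta>)))) (at \<xi>)"
  unfolding cyl_def
  by (auto intro!: derivative_eq_intros simp: inner_commute algebra_simps)

text \<open>The numbers a and b are the two partial derivatives of F at q.\<close>

definition jet1 :: "(real \<times> real \<Rightarrow> real) \<Rightarrow> real \<Rightarrow> real \<Rightarrow> real \<times> real \<Rightarrow> bool" where
  "jet1 F a b q \<longleftrightarrow> (F has_derivative (\<lambda>v. a * fst v + b * snd v)) (at q)"

lemma profile_has_derivative:
  assumes "jet1 F a b (cyl \<xi>)"
  shows "((\<lambda>\<xi>. F (cyl \<xi>)) has_derivative
    (\<lambda>\<eta>. a * (2 * (fst \<xi> \<bullet> fst \<eta> + fst (snd \<xi>) \<bullet> fst (snd \<eta>))) + b * snd (snd \<eta>))) (at \<xi>)"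
  using has_derivative_compose[OF cyl_has_derivative[of \<xi>] assms[unfolded jet1_def]] by simp

lemma line_has_real_derivative:
  assumes "(g has_derivative g') (at \<xi>)"
  shows "((\<lambda>h. g (\<xi> + h *\<^sub>R b)) has_real_derivative g' b) (at 0)"
proof -
  have lin: "linear g'" using assms has_derivative_linear by blast
  have "((\<lambda>h::real. \<xi> + h *\<^sub>R b) has_derivative (\<lambda>h. h *\<^sub>R b)) (at 0)"
    by (auto intro!: derivative_eq_intros)
  moreover have "(g has_derivative g') (at (\<xi> + (0::real) *\<^sub>R b))" using assms by simp
  ultimately have "((\<lambda>h. g (\<xi> + h *\<^sub>R b)) has_derivative (\<lambda>h. g' (h *\<^sub>R b))) (at 0)"
    by (rule has_derivative_compose)
  then show ?thesis
    by (simp add: has_field_derivative_def linear_cmul[OF lin] mult.commute[of _ "g' b"])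
qed

lemma pderiv_dir_eq: "(g has_derivative g') (at \<xi>) \<Longrightarrow> pderiv_dir b g \<xi> = g' b"
  unfolding pderiv_dir_def by (rule DERIV_imp_deriv[OF line_has_real_derivative])

lemma heis_X_eq:
  assumes "(g has_derivative g') (at \<xi>)"
  shows "heis_X i g \<xi> = g' (axis i 1, 0, 2 * (fst (snd \<xi>) $ i))"
proof -
  have lin: "linear g'" using assms has_derivative_linear by blast
  have "g' (axis i 1, 0, 0) + 2 * (fst (snd \<xi>) $ i) * g' (0, 0, 1)
     = g' ((axis i 1, 0, 0) + (2 * (fst (snd \<xi>) $ i)) *\<^sub>R (0, 0, 1))"
    by (simp only: linear_add[OF lin] linear_cmul[OF lin] real_scaleR_def)
  then show ?thesis
    by (simp add: heis_X_def split_beta pderiv_dir_eq[OF assms])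
qed

lemma heis_Y_eq:
  assumes "(g has_derivative g') (at \<xi>)"
  shows "heis_Y i g \<xi> = g' (0, axis i 1, - 2 * (fst \<xi> $ i))"
proof -
  have lin: "linear g'" using assms has_derivative_linear by blast
  have "g' (0, axis i 1, 0) - 2 * (fst \<xi> $ i) * g' (0, 0, 1)
     = g' ((0, axis i 1, 0) - (2 * (fst \<xi> $ i)) *\<^sub>R (0, 0, 1))"
    by (simp only: linear_diff[OF lin] linear_cmul[OF lin] real_scaleR_def)
  then show ?thesis
    by (simp add: heis_Y_def split_beta pderiv_dir_eq[OF assms])
qed

lemma heis_X_profile:
  assumes "jet1 F a b (cyl \<xi>)"
  shows "heis_X i (\<lambda>\<xi>. F (cyl \<xi>)) \<xi> = 2 * (a * (fst \<xi> $ i) + b * (fst (snd \<xi>) $ i))"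
  by (simp add: heis_X_eq[OF profile_has_derivative[OF assms]] inner_axis)

lemma heis_Y_profile:
  assumes "jet1 F a b (cyl \<xi>)"
  shows "heis_Y i (\<lambda>\<xi>. F (cyl \<xi>)) \<xi> = 2 * (a * (fst (snd \<xi>) $ i) - b * (fst \<xi> $ i))"
  by (simp add: heis_Y_eq[OF profile_has_derivative[OF assms]] inner_axis)

text \<open>The operator -\<rho>^(2\<mu>) L on a function of the cylindrical coordinates with first derivatives a, b and
  pure second derivatives aa, bb. The first two terms are the sub-Laplacian; the last one is the
  drift caused by the weight. Since fst q \<ge> 0 on the group, the second-order part is elliptic off
  the axis and degenerates on it, where the first-order term 4 N a remains.\<close>

definition cyl_op :: "real \<Rightarrow> real \<Rightarrow> real \<times> real \<Rightarrow> real \<Rightarrow> real \<Rightarrow> real \<Rightarrow> real \<Rightarrow> real" where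
  "cyl_op N \<mu> q a b aa bb = 4 * fst q * (aa + bb) + 4 * N * a
      - 4 * \<mu> * fst q * (fst q * a + snd q * b) / knorm4 q"

lemma jet1_knorm4_powr:
  assumes "q \<noteq> 0"
  shows "jet1 (\<lambda>q. knorm4 q powr c) (2 * c * fst q * knorm4 q powr c / knorm4 q)
                                   (2 * c * snd q * knorm4 q powr c / knorm4 q) q"
proof -
  have "0 < knorm4 q" using assms by (simp add: knorm4_pos_iff)
  moreover have "(knorm4 has_derivative (\<lambda>v. 2 * fst q * fst v + 2 * snd q * snd v)) (at q)"
    unfolding knorm4_def by (auto intro!: derivative_eq_intros simp: fun_eq_iff)
  ultimately show ?thesis
    unfolding jet1_def by (auto intro!: derivative_eq_intros simp: fun_eq_iff field_simps)
qed

lemma jet1_mult: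
  assumes "jet1 F a b q" "jet1 G c d q"
  shows "jet1 (\<lambda>q. F q * G q) (a * G q + F q * c) (b * G q + F q * d) q"
  using has_derivative_mult[OF assms[unfolded jet1_def]]
  unfolding jet1_def by (rule has_derivative_eq_rhs) (simp add: fun_eq_iff algebra_simps)

text \<open>In the sum over i the products x_i y_i coming from X_i and from Y_i cancel, and with them the
  mixed second derivatives. The remaining terms contain x_i and y_i only through x_i^2 + y_i^2.\<close>

lemma heis_L_profile:
  fixes \<xi> :: "'n::finite heis"
  assumes F: "\<And>q. jet1 F (Fs q) (Ft q) q"
    and Fs: "jet1 Fs ss st (cyl \<xi>)" and Ft: "jet1 Ft ts tt (cyl \<xi>)" and "\<xi> \<noteq> 0"
  shows "heis_L \<mu> (\<lambda>\<xi>. F (cyl \<xi>)) \<xi> = - (knorm \<xi> powr (- 2 * \<mu>)) *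
     cyl_op (real CARD('n)) \<mu> (cyl \<xi>) (Fs (cyl \<xi>)) (Ft (cyl \<xi>)) ss tt"
proof -
  let ?q = "cyl \<xi>"
  define \<omega> where "\<omega> = (\<lambda>q. knorm4 q powr (- \<mu> / 2))"
  have q: "?q \<noteq> 0" using assms by (simp add: cyl_eq_0_iff)
  then have gp: "0 < knorm4 ?q" by (simp add: knorm4_pos_iff)
  have kw: "knorm \<eta> powr (- 2 * \<mu>) = \<omega> (cyl \<eta>)" for \<eta> :: "'n heis"
    by (simp add: knorm_powr \<omega>_def)
  define A where "A = (\<lambda>q. \<omega> q * Fs q)"
  define B where "B = (\<lambda>q. \<omega> q * Ft q)"
  have J: "jet1 \<omega> (2 * (- \<mu> / 2) * fst ?q * \<omega> ?q / knorm4 ?q)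
                    (2 * (- \<mu> / 2) * snd ?q * \<omega> ?q / knorm4 ?q) ?q"
    using jet1_knorm4_powr[OF q, of "-\<mu>/2"] unfolding \<omega>_def .
  define As where "As = \<omega> ?q * (ss - \<mu> * fst ?q * Fs ?q / knorm4 ?q)"
  define Bt where "Bt = \<omega> ?q * (tt - \<mu> * snd ?q * Ft ?q / knorm4 ?q)"
  obtain At where jA: "jet1 A As At ?q"
  proof -
    have eq: "As = 2 * (- \<mu> / 2) * fst ?q * \<omega> ?q / knorm4 ?q * Fs ?q + \<omega> ?q * ss"
      using gp by (simp add: As_def field_simps)
    show thesis by (rule that) (rule jet1_mult[OF J Fs, folded A_def eq])
  qed
  obtain Bs where jB: "jet1 B Bs Bt ?q"
  proof -
    have eq: "Bt = 2 * (- \<mu> / 2) * snd ?q * \<omega> ?q / knorm4 ?q * Ft ?q + \<omega> ?q * tt"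
      using gp by (simp add: Bt_def field_simps)
    show thesis by (rule that) (rule jet1_mult[OF J Ft, folded B_def eq])
  qed
  let ?x = "fst \<xi>" and ?y = "fst (snd \<xi>)"
  have X: "heis_X i (\<lambda>\<eta>. knorm \<eta> powr (- 2 * \<mu>) * heis_X i (\<lambda>\<xi>. F (cyl \<xi>)) \<eta>) \<xi>
     = 2 * ((As * (2 * ?x $ i) + At * (2 * ?y $ i)) * ?x $ i + A ?q
          + (Bs * (2 * ?x $ i) + Bt * (2 * ?y $ i)) * ?y $ i)" for i
  proof -
    have "(\<lambda>\<eta>. knorm \<eta> powr (- 2 * \<mu>) * heis_X i (\<lambda>\<xi>. F (cyl \<xi>)) \<eta>)
      = (\<lambda>\<eta>. 2 * (A (cyl \<eta>) * (fst \<eta> $ i) + B (cyl \<eta>) * (fst (snd \<eta>) $ i)))"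
      unfolding kw heis_X_profile[OF F] A_def B_def by (simp add: fun_eq_iff algebra_simps)
    moreover have "((\<lambda>\<eta>. 2 * (A (cyl \<eta>) * (fst \<eta> $ i) + B (cyl \<eta>) * (fst (snd \<eta>) $ i)))
       has_derivative (\<lambda>\<eta>. 2 * ((As * (2 * (?x \<bullet> fst \<eta> + ?y \<bullet> fst (snd \<eta>))) + At * snd (snd \<eta>)) * ?x $ i
          + A ?q * fst \<eta> $ i
          + (Bs * (2 * (?x \<bullet> fst \<eta> + ?y \<bullet> fst (snd \<eta>))) + Bt * snd (snd \<eta>)) * ?y $ i
          + B ?q * fst (snd \<eta>) $ i))) (at \<xi>)"
      by (auto intro!: derivative_eq_intros profile_has_derivative[OF jA] profile_has_derivative[OF jB]
          bounded_linear.has_derivative[OF bounded_linear_vec_nth] simp: fun_eq_iff algebra_simps)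
    ultimately show ?thesis
      by (simp add: heis_X_eq inner_axis)
  qed
  have Y: "heis_Y i (\<lambda>\<eta>. knorm \<eta> powr (- 2 * \<mu>) * heis_Y i (\<lambda>\<xi>. F (cyl \<xi>)) \<eta>) \<xi>
     = 2 * ((As * (2 * ?y $ i) - At * (2 * ?x $ i)) * ?y $ i + A ?q
          - (Bs * (2 * ?y $ i) - Bt * (2 * ?x $ i)) * ?x $ i)" for i
  proof -
    have "(\<lambda>\<eta>. knorm \<eta> powr (- 2 * \<mu>) * heis_Y i (\<lambda>\<xi>. F (cyl \<xi>)) \<eta>)
      = (\<lambda>\<eta>. 2 * (A (cyl \<eta>) * (fst (snd \<eta>) $ i) - B (cyl \<eta>) * (fst \<eta> $ i)))"
      unfolding kw heis_Y_profile[OF F] A_def B_def by (simp add: fun_eq_iff algebra_simps)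
    moreover have "((\<lambda>\<eta>. 2 * (A (cyl \<eta>) * (fst (snd \<eta>) $ i) - B (cyl \<eta>) * (fst \<eta> $ i)))
       has_derivative (\<lambda>\<eta>. 2 * ((As * (2 * (?x \<bullet> fst \<eta> + ?y \<bullet> fst (snd \<eta>))) + At * snd (snd \<eta>)) * ?y $ i
          + A ?q * fst (snd \<eta>) $ i
          - (Bs * (2 * (?x \<bullet> fst \<eta> + ?y \<bullet> fst (snd \<eta>))) + Bt * snd (snd \<eta>)) * ?x $ i
          - B ?q * fst \<eta> $ i))) (at \<xi>)"
      by (auto intro!: derivative_eq_intros profile_has_derivative[OF jA] profile_has_derivative[OF jB]
          bounded_linear.has_derivative[OF bounded_linear_vec_nth] simp: fun_eq_iff algebra_simps)
    ultimately show ?thesis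
      by (simp add: heis_Y_eq inner_axis)
  qed
  have fq: "fst ?q = (\<Sum>i\<in>UNIV. (?x $ i)\<^sup>2 + (?y $ i)\<^sup>2)"
    by (simp add: cyl_def inner_vec_def sum.distrib power2_eq_square)
  have "heis_L \<mu> (\<lambda>\<xi>. F (cyl \<xi>)) \<xi> = - (\<Sum>i\<in>UNIV. 4 * (As + Bt) * ((?x $ i)\<^sup>2 + (?y $ i)\<^sup>2) + 4 * A ?q)"
    unfolding heis_L_def X Y
    by (intro arg_cong[where f=uminus] sum.cong) (auto simp: algebra_simps power2_eq_square)
  also have "\<dots> = - (4 * (As + Bt) * fst ?q + 4 * real CARD('n) * A ?q)"
    by (simp add: sum.distrib fq sum_distrib_left algebra_simps)
  also have "\<dots> = - \<omega> ?q * cyl_op (real CARD('n)) \<mu> ?q (Fs ?q) (Ft ?q) ss tt"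
    using gp by (simp add: cyl_op_def As_def Bt_def A_def field_simps)
  finally show ?thesis by (simp only: kw)
qed

definition C2_profile where
  "C2_profile F Fs Ft Fss Fst Ftt \<longleftrightarrow>
     (\<forall>q. jet1 F (Fs q) (Ft q) q \<and> jet1 Fs (Fss q) (Fst q) q \<and> jet1 Ft (Fst q) (Ftt q) q) \<and>
     continuous_on UNIV Fss \<and> continuous_on UNIV Fst \<and> continuous_on UNIV Ftt"

lemma C2_profileD:
  assumes "C2_profile F Fs Ft Fss Fst Ftt"
  shows "jet1 F (Fs q) (Ft q) q" "jet1 Fs (Fss q) (Fst q) q" "jet1 Ft (Fst q) (Ftt q) q"
    "continuous_on UNIV Fss" "continuous_on UNIV Fst" "continuous_on UNIV Ftt"
  using assms unfolding C2_profile_def by blast+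

lemma jet1_continuous: "(\<And>q. jet1 F (Fs q) (Ft q) q) \<Longrightarrow> continuous_on UNIV F"
  by (metis jet1_def has_derivative_continuous continuous_at_imp_continuous_on)

lemma C2_profile_continuous:
  assumes "C2_profile F Fs Ft Fss Fst Ftt"
  shows "continuous_on UNIV F" "continuous_on UNIV Fs" "continuous_on UNIV Ft"
  using assms jet1_continuous[of F Fs Ft] jet1_continuous[of Fs Fss Fst] jet1_continuous[of Ft Fst Ftt]
  by (auto simp: C2_profile_def)

lemma continuous_on_profile:
  "continuous_on UNIV F \<Longrightarrow> continuous_on S (\<lambda>\<xi>. F (cyl \<xi>))"
  by (rule continuous_on_compose2[OF _ continuous_on_cyl]) auto

text \<open>A Frechet derivative that is continuous in every basis direction gives the partial derivatives
  required by the definition of the class.\<close>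

lemma Ck_1I:
  assumes "\<And>\<xi>. (g has_derivative g' \<xi>) (at \<xi>)" "\<And>b. b \<in> Basis \<Longrightarrow> continuous_on UNIV (\<lambda>\<xi>. g' \<xi> b)"
  shows "Ck (Suc 0) g"
proof -
  have "continuous_on UNIV g"
    by (intro continuous_at_imp_continuous_on ballI has_derivative_continuous[OF assms(1)])
  moreover have "(\<lambda>h. g (\<xi> + h *\<^sub>R b)) differentiable (at 0)" for \<xi> b
    using line_has_real_derivative[OF assms(1)] real_differentiable_def by blast
  moreover have "pderiv_dir b g = (\<lambda>\<xi>. g' \<xi> b)" for b
    using pderiv_dir_eq[OF assms(1)] by blast
  ultimately show ?thesis using assms(2) by simp
qed

lemma Ck_2I:
  assumes "\<And>\<xi>. (g has_derivative g' \<xi>) (at \<xi>)" "\<And>b. b \<in> Basis \<Longrightarrow> Ck (Suc 0) (\<lambda>\<xi>. g' \<xi> b)"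
  shows "Ck 2 g"
proof -
  have "continuous_on UNIV g"
    by (intro continuous_at_imp_continuous_on ballI has_derivative_continuous[OF assms(1)])
  moreover have "(\<lambda>h. g (\<xi> + h *\<^sub>R b)) differentiable (at 0)" for \<xi> b
    using line_has_real_derivative[OF assms(1)] real_differentiable_def by blast
  moreover have "pderiv_dir b g = (\<lambda>\<xi>. g' \<xi> b)" for b
    using pderiv_dir_eq[OF assms(1)] by blast
  ultimately show ?thesis using assms(2) unfolding numeral_2_eq_2 Ck.simps(2)[of "Suc 0"] by simp
qed

lemma Ck_2_profile:
  assumes C2: "C2_profile F Fs Ft Fss Fst Ftt"
  shows "Ck 2 (\<lambda>\<xi>::'n::finite heis. F (cyl \<xi>))"
proof (rule Ck_2I[OF profile_has_derivative[OF C2_profileD(1)[OF C2]]])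
  note C2_profile_continuous[OF C2, THEN continuous_on_profile, continuous_intros]
  note C2_profileD(4-6)[OF C2, THEN continuous_on_profile, continuous_intros]
  fix b :: "'n heis"
  show "Ck (Suc 0) (\<lambda>\<xi>. Fs (cyl \<xi>) * (2 * (fst \<xi> \<bullet> fst b + fst (snd \<xi>) \<bullet> fst (snd b)))
                       + Ft (cyl \<xi>) * snd (snd b))"
    by (rule Ck_1I, (rule derivative_eq_intros profile_has_derivative[OF C2_profileD(2)[OF C2]]
            profile_has_derivative[OF C2_profileD(3)[OF C2]] refl)+)
       (intro continuous_intros)
qed

lemma heis_L_C2_profile:
  fixes \<xi> :: "'n::finite heis"
  assumes "C2_profile F Fs Ft Fss Fst Ftt" "\<xi> \<noteq> 0"
  shows "heis_L \<mu> (\<lambda>\<xi>. F (cyl \<xi>)) \<xi> = - (knorm \<xi> powr (- 2 * \<mu>)) *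
     cyl_op (real CARD('n)) \<mu> (cyl \<xi>) (Fs (cyl \<xi>)) (Ft (cyl \<xi>)) (Fss (cyl \<xi>)) (Ftt (cyl \<xi>))"
  by (rule heis_L_profile[OF C2_profileD(1,2,3)[OF assms(1)] assms(2)])

lemma jet1_unique:
  assumes "jet1 F a b q" "jet1 F c d q"
  shows "a = c" "b = d"
proof -
  have "(\<lambda>v. a * fst v + b * snd v) = (\<lambda>v. c * fst v + d * snd v)"
    using assms unfolding jet1_def by (rule has_derivative_unique)
  from fun_cong[OF this, of "(1,0)"] fun_cong[OF this, of "(0,1)"] show "a = c" "b = d" by auto
qed

lemma jet1_vanish:
  assumes "jet1 F a b q" "open S" "q \<in> S" "\<And>q. q \<in> S \<Longrightarrow> F q = 0"
  shows "a = 0" "b = 0"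
proof -
  have "((\<lambda>_. 0) has_derivative (\<lambda>v. a * fst v + b * snd v)) (at q)"
    using assms unfolding jet1_def
    by (metis (mono_tags, lifting) has_derivative_transform_within_open)
  then have "jet1 (\<lambda>_. 0) a b q" by (simp add: jet1_def)
  moreover have "jet1 (\<lambda>_. 0) 0 0 q" by (simp add: jet1_def)
  ultimately show "a = 0" "b = 0" by (auto dest: jet1_unique)
qed

lemma C2_profile_vanish:
  assumes C2: "C2_profile F Fs Ft Fss Fst Ftt" and F0: "\<And>q. R < knorm4 q \<Longrightarrow> F q = 0" and q: "R < knorm4 q"
  shows "Fs q = 0" "Ft q = 0" "Fss q = 0" "Fst q = 0" "Ftt q = 0"
proof -
  have op: "open {q. R < knorm4 q}"
    by (intro open_Collect_less continuous_intros)
  have s0: "Fs q = 0" "Ft q = 0" if "R < knorm4 q" for q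
    using jet1_vanish[OF C2_profileD(1)[OF C2] op, of q] that F0 by auto
  show "Fs q = 0" "Ft q = 0" "Fss q = 0" "Fst q = 0" "Ftt q = 0"
    using s0 q jet1_vanish[OF C2_profileD(2)[OF C2] op, of q] jet1_vanish[OF C2_profileD(3)[OF C2] op, of q]
    by auto
qed

lemma knorm4_bounds: "(fst q)\<^sup>2 \<le> knorm4 q" "(snd q)\<^sup>2 \<le> knorm4 q"
  by (auto simp: knorm4_def)

lemma abs_le_one_plus: "\<bar>x::real\<bar> \<le> 1 + y" if "x\<^sup>2 \<le> y"
proof -
  have "0 \<le> (\<bar>x\<bar> - 1)\<^sup>2" by simp
  then have "2 * \<bar>x\<bar> \<le> x\<^sup>2 + 1" by (simp add: power2_diff)
  then show ?thesis using that abs_ge_zero[of x] by linarith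
qed

lemma compact_knorm4_le: "compact {q. knorm4 q \<le> R}"
proof -
  have "norm q \<le> 2 * (1 + R)" if "knorm4 q \<le> R" for q :: "real \<times> real"
  proof -
    have "\<bar>fst q\<bar> \<le> 1 + R" "\<bar>snd q\<bar> \<le> 1 + R"
      using that knorm4_bounds[of q] by (auto intro!: abs_le_one_plus)
    then show ?thesis using norm_Pair_le[of "fst q" "snd q"] by simp
  qed
  then have "bounded {q. knorm4 q \<le> R}" by (intro boundedI[of _ "2 * (1 + R)"]) auto
  moreover have "closed {q. knorm4 q \<le> R}" by (intro closed_Collect_le continuous_intros)
  ultimately show ?thesis by (simp add: compact_eq_bounded_closed)
qed

lemma compact_koranyi_ball: "compact {\<xi>::'n::finite heis. knorm4 (cyl \<xi>) \<le> R}"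
proof -
  have "norm \<xi> \<le> 4 * (3 + R)" if "knorm4 (cyl \<xi>) \<le> R" for \<xi> :: "'n heis"
  proof -
    have b: "\<bar>fst (cyl \<xi>)\<bar> \<le> 1 + R" "\<bar>snd (cyl \<xi>)\<bar> \<le> 1 + R"
      using that knorm4_bounds[of "cyl \<xi>"] by (intro abs_le_one_plus order_trans[OF _ that]; simp)+
    have "fst (cyl \<xi>) = (norm (fst \<xi>))\<^sup>2 + (norm (fst (snd \<xi>)))\<^sup>2"
      by (simp add: cyl_def power2_norm_eq_inner)
    then have "(norm (fst \<xi>))\<^sup>2 \<le> 1 + R" "(norm (fst (snd \<xi>)))\<^sup>2 \<le> 1 + R"
      using b by (smt (verit) zero_le_power2)+
    then have "norm (fst \<xi>) \<le> 2 + R" "norm (fst (snd \<xi>)) \<le> 2 + R"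
      by (metis (no_types, lifting) abs_le_one_plus abs_norm_cancel add.assoc one_add_one)+
    moreover have "norm (snd (snd \<xi>)) \<le> 1 + R" using b by (simp add: cyl_def)
    moreover have "norm \<xi> \<le> norm (fst \<xi>) + (norm (fst (snd \<xi>)) + norm (snd (snd \<xi>)))"
      using norm_Pair_le[of "fst \<xi>" "snd \<xi>"] norm_Pair_le[of "fst (snd \<xi>)" "snd (snd \<xi>)"] by simp
    ultimately show ?thesis by simp
  qed
  then have "bounded {\<xi>::'n heis. knorm4 (cyl \<xi>) \<le> R}" by (intro boundedI[of _ "4 * (3 + R)"]) auto
  moreover have "closed {\<xi>::'n heis. knorm4 (cyl \<xi>) \<le> R}"
    by (intro closed_Collect_le continuous_intros continuous_on_compose2[OF continuous_on_knorm4 continuous_on_cyl]) auto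
  ultimately show ?thesis by (simp add: compact_eq_bounded_closed)
qed

lemma continuous_compact_support_bounded:
  assumes "continuous_on UNIV g" "compact K" "\<And>\<xi>. \<xi> \<notin> K \<Longrightarrow> g \<xi> = 0"
  shows "\<exists>B. \<forall>\<xi>. \<bar>g \<xi> :: real\<bar> \<le> B"
proof -
  have "compact (g ` K)" using assms by (intro compact_continuous_image) (auto intro: continuous_on_subset)
  then obtain B where "\<And>x. x \<in> g ` K \<Longrightarrow> norm x \<le> B" using compact_imp_bounded bounded_iff by metis
  then have "\<bar>g \<xi>\<bar> \<le> max B 0" for \<xi> using assms(3)[of \<xi>] by (cases "\<xi> \<in> K") (auto simp: le_max_iff_disj)
  then show ?thesis by blast
qed

lemma abs_mult_div_knorm4_le: "\<bar>fst q * snd q / knorm4 q\<bar> \<le> 1"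
proof -
  have "0 \<le> (\<bar>fst q\<bar> - \<bar>snd q\<bar>)\<^sup>2" by simp
  then have "2 * \<bar>fst q * snd q\<bar> \<le> knorm4 q" by (simp add: power2_diff abs_mult knorm4_def)
  then have "\<bar>fst q * snd q\<bar> \<le> knorm4 q" by (smt (verit) abs_ge_zero)
  then show ?thesis
    using knorm4_nonneg[of q] by (cases "knorm4 q = 0") (auto simp: abs_divide divide_le_eq_1)
qed

text \<open>In coordinates (s, t) the drift coefficients s^2/(s^2+t^2) and s t/(s^2+t^2) have no limit at the origin but are bounded,
  so the singular weight does not spoil the bound.\<close>

lemma cyl_op_bounded:
  assumes C2: "C2_profile F Fs Ft Fss Fst Ftt" and F0: "\<And>q. R < knorm4 q \<Longrightarrow> F q = 0"
    and "0 \<le> N" "0 \<le> \<mu>"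
  obtains C where "0 \<le> C" "\<And>q. \<bar>cyl_op N \<mu> q (Fs q) (Ft q) (Fss q) (Ftt q)\<bar> \<le> C"
proof -
  note v = C2_profile_vanish[OF C2 F0]
  have b: "\<exists>C\<ge>0. \<forall>q. \<bar>g q\<bar> \<le> C" if g: "continuous_on UNIV g" "\<And>q. R < knorm4 q \<Longrightarrow> g q = 0" for g :: "real \<times> real \<Rightarrow> real"
  proof -
    obtain C where "\<And>q. \<bar>g q\<bar> \<le> C"
      using continuous_compact_support_bounded[OF g(1) compact_knorm4_le[of R]] g(2) by force
    then show ?thesis by (metis abs_ge_zero order_trans)
  qed
  obtain c1 where c1: "0 \<le> c1" "\<And>q. \<bar>Fs q\<bar> \<le> c1"
    using b[of Fs] v C2_profile_continuous[OF C2] by metis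
  obtain c2 where c2: "0 \<le> c2" "\<And>q. \<bar>Ft q\<bar> \<le> c2"
    using b[of Ft] v C2_profile_continuous[OF C2] by metis
  have cont3: "continuous_on UNIV (\<lambda>q. 4 * fst q * (Fss q + Ftt q))"
    using C2_profileD(4-6)[OF C2] by (intro continuous_intros)
  obtain c3 where c3: "0 \<le> c3" "\<And>q. \<bar>4 * fst q * (Fss q + Ftt q)\<bar> \<le> c3"
    using b[OF cont3] v by (metis add.right_neutral mult_zero_right)
  have "\<bar>cyl_op N \<mu> q (Fs q) (Ft q) (Fss q) (Ftt q)\<bar> \<le> c3 + 4 * N * c1 + 4 * \<mu> * (c1 + c2)" for q
  proof -
    note e = abs_mult_div_knorm4_le[of q]
    have e': "\<bar>fst q * fst q / knorm4 q\<bar> \<le> 1"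
      using knorm4_bounds[of q] by (auto simp: abs_divide divide_le_eq_1 power2_eq_square)
        (smt (verit) zero_le_square)
    have "cyl_op N \<mu> q (Fs q) (Ft q) (Fss q) (Ftt q) = 4 * fst q * (Fss q + Ftt q) + 4 * N * Fs q
       - 4 * \<mu> * (fst q * fst q / knorm4 q * Fs q + fst q * snd q / knorm4 q * Ft q)"
      by (simp add: cyl_op_def algebra_simps add_divide_distrib)
    moreover have "\<bar>fst q * fst q / knorm4 q * Fs q\<bar> \<le> 1 * c1"
      unfolding abs_mult[of _ "Fs q"] by (intro mult_mono e' c1) auto
    moreover have "\<bar>fst q * snd q / knorm4 q * Ft q\<bar> \<le> 1 * c2"
      unfolding abs_mult[of _ "Ft q"] by (intro mult_mono e c2) auto
    moreover have "\<bar>4 * N * Fs q\<bar> \<le> 4 * N * c1"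
      using c1(2)[of q] assms(3) by (simp add: abs_mult mult_left_mono)
    ultimately have "\<bar>cyl_op N \<mu> q (Fs q) (Ft q) (Fss q) (Ftt q)\<bar> \<le> c3 + 4 * N * c1 +
       \<bar>4 * \<mu> * (fst q * fst q / knorm4 q * Fs q + fst q * snd q / knorm4 q * Ft q)\<bar>"
      "\<bar>fst q * fst q / knorm4 q * Fs q + fst q * snd q / knorm4 q * Ft q\<bar> \<le> c1 + c2"
      using c3(2)[of q] by linarith+
    moreover from this(2) have "\<bar>4 * \<mu> * (fst q * fst q / knorm4 q * Fs q + fst q * snd q / knorm4 q * Ft q)\<bar>
      \<le> 4 * \<mu> * (c1 + c2)" using assms(4) by (simp add: abs_mult mult_left_mono)
    ultimately show ?thesis by linarith
  qed
  then show thesis using that c1 c2 c3 assms by (metis add_nonneg_nonneg mult_nonneg_nonneg zero_le_numeral)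
qed

section \<open>Product test functions\<close>

lemma pderiv_dir_cmult:
  assumes "(\<lambda>h. g (\<xi> + h *\<^sub>R b)) differentiable (at (0::real))"
  shows "pderiv_dir b (\<lambda>\<xi>. c * g \<xi>) \<xi> = c * pderiv_dir b g \<xi>"
proof -
  obtain D where D: "((\<lambda>h. g (\<xi> + h *\<^sub>R b)) has_real_derivative D) (at 0)"
    using assms real_differentiable_def by blast
  have "((\<lambda>h. c * g (\<xi> + h *\<^sub>R b)) has_real_derivative c * D) (at 0)"
    by (rule DERIV_cmult[OF D])
  then show ?thesis unfolding pderiv_dir_def using DERIV_imp_deriv[OF D] DERIV_imp_deriv by blast
qed

lemma Ck_cmult: "Ck k g \<Longrightarrow> Ck k (\<lambda>\<xi>. c * g \<xi>)"
proof (induction k arbitrary: g)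
  case 0 then show ?case by (auto intro: continuous_intros)
next
  case (Suc k)
  have "pderiv_dir b (\<lambda>\<xi>. c * g \<xi>) = (\<lambda>\<xi>. c * pderiv_dir b g \<xi>)" if "b \<in> Basis" for b
    using pderiv_dir_cmult Suc.prems that by fastforce
  moreover have "(\<lambda>h. c * g (\<xi> + h *\<^sub>R b)) differentiable (at 0)" if "b \<in> Basis" for b \<xi>
  proof -
    have "(\<lambda>h. g (\<xi> + h *\<^sub>R b)) differentiable (at 0)" using Suc.prems that by simp
    then show ?thesis by (intro differentiable_mult) auto
  qed
  ultimately show ?case using Suc by (auto intro: continuous_intros)
qed

lemma pderiv_dir_vanish:
  assumes "open S" "\<xi> \<in> S" "\<And>\<xi>. \<xi> \<in> S \<Longrightarrow> g \<xi> = 0"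
  shows "pderiv_dir b g \<xi> = 0"
proof -
  have "((\<lambda>h::real. \<xi> + h *\<^sub>R b) \<longlongrightarrow> \<xi> + 0 *\<^sub>R b) (at 0)" by (intro tendsto_intros)
  then have "\<forall>\<^sub>F h in at (0::real). \<xi> + h *\<^sub>R b \<in> S"
    using assms(1,2) by (auto dest: topological_tendstoD)
  then have "\<forall>\<^sub>F h in nhds (0::real). \<xi> + h *\<^sub>R b \<in> S"
    using assms(2) by (simp add: eventually_nhds_conv_at)
  then have "\<forall>\<^sub>F h in nhds (0::real). g (\<xi> + h *\<^sub>R b) = 0"
    by eventually_elim (use assms(3) in auto)
  then have "deriv (\<lambda>h. g (\<xi> + h *\<^sub>R b)) 0 = deriv (\<lambda>_. 0) 0"
    by (rule deriv_cong_ev) simp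
  then show ?thesis by (simp add: pderiv_dir_def)
qed

text \<open>The difference quotients in time of a product test function are scalar multiples of its spatial
  factor, so this bound reduces their convergence in the norm to convergence of the scalar factor.\<close>

lemma C2_norm_cmult_bound:
  fixes g :: "'a::euclidean_space \<Rightarrow> real"
  assumes g: "Ck 2 g" and K: "compact K" "\<And>\<xi>. \<xi> \<notin> K \<Longrightarrow> g \<xi> = 0"
  obtains B where "\<And>c. 0 \<le> C2_norm (\<lambda>\<xi>. c * g \<xi>)" "\<And>c. C2_norm (\<lambda>\<xi>. c * g \<xi>) \<le> \<bar>c\<bar> * B"
proof -
  have op: "open (- K)" using K(1) by (simp add: compact_imp_closed open_Compl)
  have v1: "pderiv_dir b g \<xi> = 0" if "\<xi> \<notin> K" for b \<xi>
    by (rule pderiv_dir_vanish[OF op]) (use that K in auto)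
  have v2: "pderiv_dir c (pderiv_dir b g) \<xi> = 0" if "\<xi> \<notin> K" for b c \<xi>
    by (rule pderiv_dir_vanish[OF op]) (use that v1 in auto)
  have g': "continuous_on UNIV g" "\<And>b. b \<in> Basis \<Longrightarrow> continuous_on UNIV (pderiv_dir b g)"
    "\<And>b c. b \<in> Basis \<Longrightarrow> c \<in> Basis \<Longrightarrow> continuous_on UNIV (pderiv_dir c (pderiv_dir b g))"
    "\<And>b \<xi>. b \<in> Basis \<Longrightarrow> (\<lambda>h. g (\<xi> + h *\<^sub>R b)) differentiable (at 0)"
    "\<And>b c \<xi>. b \<in> Basis \<Longrightarrow> c \<in> Basis \<Longrightarrow> (\<lambda>h. pderiv_dir b g (\<xi> + h *\<^sub>R c)) differentiable (at 0)"
    using g by (auto simp: numeral_2_eq_2)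
  obtain B0 where B0: "\<And>\<xi>. \<bar>g \<xi>\<bar> \<le> B0"
    using continuous_compact_support_bounded[OF g'(1) K] by blast
  have "\<exists>B. \<forall>b\<in>Basis. \<forall>\<xi>. \<bar>pderiv_dir b g \<xi>\<bar> \<le> B b"
    using continuous_compact_support_bounded[OF g'(2) K(1) v1] by (intro bchoice) blast
  then obtain B1 where B1: "\<And>b \<xi>. b \<in> Basis \<Longrightarrow> \<bar>pderiv_dir b g \<xi>\<bar> \<le> B1 b" by blast
  have "\<exists>B. \<forall>b\<in>Basis. \<forall>c\<in>Basis. \<forall>\<xi>. \<bar>pderiv_dir c (pderiv_dir b g) \<xi>\<bar> \<le> B b c"
    using continuous_compact_support_bounded[OF g'(3) K(1) v2] by (intro bchoice ballI) blast
  then obtain B2 where B2: "\<And>b c \<xi>. b \<in> Basis \<Longrightarrow> c \<in> Basis \<Longrightarrow> \<bar>pderiv_dir c (pderiv_dir b g) \<xi>\<bar> \<le> B2 b c" by blast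
  have d1: "pderiv_dir b (\<lambda>\<xi>. c * g \<xi>) = (\<lambda>\<xi>. c * pderiv_dir b g \<xi>)" if "b \<in> Basis" for b c
    using pderiv_dir_cmult[OF g'(4)[OF that]] by blast
  have d2: "pderiv_dir a (\<lambda>\<xi>. c * pderiv_dir b g \<xi>) = (\<lambda>\<xi>. c * pderiv_dir a (pderiv_dir b g) \<xi>)"
    if "a \<in> Basis" "b \<in> Basis" for a b c
    using pderiv_dir_cmult[OF g'(5)[OF that(2,1)]] by blast
  have SUPb: "0 \<le> (SUP \<xi>. \<bar>c * f \<xi>\<bar>) \<and> (SUP \<xi>. \<bar>c * f \<xi>\<bar>) \<le> \<bar>c\<bar> * M"
    if "\<And>\<xi>. \<bar>f \<xi>\<bar> \<le> M" for f :: "'a \<Rightarrow> real" and c M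
  proof
    have le: "\<bar>c * f \<xi>\<bar> \<le> \<bar>c\<bar> * M" for \<xi> using that by (simp add: abs_mult mult_left_mono)
    then have "bdd_above (range (\<lambda>\<xi>. \<bar>c * f \<xi>\<bar>))"
      by (intro bdd_aboveI[of _ "\<bar>c\<bar> * M"]) auto
    then have "\<bar>c * f 0\<bar> \<le> (SUP \<xi>. \<bar>c * f \<xi>\<bar>)" by (intro cSUP_upper) auto
    then show "0 \<le> (SUP \<xi>. \<bar>c * f \<xi>\<bar>)" by linarith
    show "(SUP \<xi>. \<bar>c * f \<xi>\<bar>) \<le> \<bar>c\<bar> * M" using le by (intro cSUP_least) auto
  qed
  show thesis
  proof
    fix c
    show "0 \<le> C2_norm (\<lambda>\<xi>. c * g \<xi>)"
      unfolding C2_norm_def using SUPb[OF B0] SUPb[OF B1] SUPb[OF B2]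
      by (intro add_nonneg_nonneg sum_nonneg) (auto simp: d1 d2)
    have "C2_norm (\<lambda>\<xi>. c * g \<xi>) \<le> \<bar>c\<bar> * B0 + (\<Sum>b\<in>Basis. \<bar>c\<bar> * B1 b) + (\<Sum>b\<in>Basis. \<Sum>a\<in>Basis. \<bar>c\<bar> * B2 b a)"
      unfolding C2_norm_def using SUPb[OF B0] SUPb[OF B1] SUPb[OF B2]
      by (intro add_mono sum_mono) (auto simp: d1 d2)
    also have "\<dots> = \<bar>c\<bar> * (B0 + (\<Sum>b\<in>Basis. B1 b) + (\<Sum>b\<in>Basis. \<Sum>a\<in>Basis. B2 b a))"
      by (simp add: sum_distrib_left distrib_left)
    finally show "C2_norm (\<lambda>\<xi>. c * g \<xi>) \<le> \<bar>c\<bar> * (B0 + (\<Sum>b\<in>Basis. B1 b) + (\<Sum>b\<in>Basis. \<Sum>a\<in>Basis. B2 b a))" .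
  qed
qed

lemma time_deriv_product:
  assumes "\<And>t. (\<eta> has_real_derivative \<eta>' t) (at t)" "t \<in> {0..<T}"
  shows "time_deriv T (\<lambda>t \<xi>. \<eta> t * h \<xi>) t \<xi> = \<eta>' t * h \<xi>"
proof -
  have "t islimpt {t<..<T}" using assms(2) by (intro islimpt_greaterThanLessThan1) auto
  then have "t islimpt {0..<T}" using assms(2) by (auto elim: islimpt_subset)
  then have "at t within {0..<T} \<noteq> bot" by (simp add: trivial_limit_within)
  moreover have "((\<lambda>s. \<eta> s * h \<xi>) has_vector_derivative \<eta>' t * h \<xi>) (at t within {0..<T})"
    using DERIV_cmult_right[OF assms(1)] has_real_derivative_iff_has_vector_derivative
      has_vector_derivative_at_within by blast
  ultimately show ?thesis unfolding time_deriv_def by (rule vector_derivative_within)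
qed

lemma test_function_product:
  fixes h :: "'a::euclidean_space \<Rightarrow> real"
  assumes \<eta>: "\<And>t. (\<eta> has_real_derivative \<eta>' t) (at t)" "continuous_on UNIV \<eta>'" "\<And>t. T' < t \<Longrightarrow> \<eta> t = 0" "T' < T"
    and h: "Ck 2 h" "compact K" "\<And>\<xi>. \<xi> \<notin> K \<Longrightarrow> h \<xi> = 0"
  shows "test_function T (\<lambda>t \<xi>. \<eta> t * h \<xi>)"
proof -
  obtain B where B: "\<And>c. 0 \<le> C2_norm (\<lambda>\<xi>. c * h \<xi>)" "\<And>c. C2_norm (\<lambda>\<xi>. c * h \<xi>) \<le> \<bar>c\<bar> * B"
    using C2_norm_cmult_bound[OF h] by metis
  note td = time_deriv_product[OF \<eta>(1)]
  have lim: "((\<lambda>s. C2_norm (\<lambda>\<xi>. c s * h \<xi>)) \<longlongrightarrow> 0) F" if "(c \<longlongrightarrow> 0) F" for c :: "real \<Rightarrow> real" and F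
  proof (rule tendsto_sandwich[of "\<lambda>_. 0"])
    have "((\<lambda>s. \<bar>c s\<bar> * B) \<longlongrightarrow> \<bar>0\<bar> * B) F" by (intro tendsto_intros that)
    then show "((\<lambda>s. \<bar>c s\<bar> * B) \<longlongrightarrow> 0) F" by simp
  qed (use B in auto)
  show ?thesis
    unfolding test_function_def
  proof (intro conjI ballI)
    show "\<exists>K T'. compact K \<and> T' < T \<and> (\<forall>t\<in>{0..<T}. \<forall>\<xi>. \<eta> t * h \<xi> \<noteq> 0 \<longrightarrow> t \<le> T' \<and> \<xi> \<in> K)"
      using h(2,3) \<eta>(3,4) by (intro exI[of _ K] exI[of _ T']) (auto simp: not_less[symmetric])
  next
    fix t assume t: "t \<in> {0..<T}"
    show "Ck 2 (\<lambda>\<xi>. \<eta> t * h \<xi>)" by (rule Ck_cmult[OF h(1)])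
    have "time_deriv T (\<lambda>t \<xi>. \<eta> t * h \<xi>) t = (\<lambda>\<xi>. \<eta>' t * h \<xi>)" by (rule ext) (rule td[OF t])
    then show "Ck 2 (time_deriv T (\<lambda>t \<xi>. \<eta> t * h \<xi>) t)" using Ck_cmult[OF h(1)] by simp
  next
    fix t assume t: "t \<in> {0..<T}"
    have "((\<lambda>s. (\<eta> s - \<eta> t) / (s - t)) \<longlongrightarrow> \<eta>' t) (at t within {0..<T})"
      using has_field_derivative_at_within[OF \<eta>(1)] has_field_derivative_iff by blast
    then have l: "((\<lambda>s. (\<eta> s - \<eta> t) / (s - t) - \<eta>' t) \<longlongrightarrow> 0) (at t within {0..<T})"
      using LIM_zero by blast
    have "(\<lambda>s. C2_norm (\<lambda>\<xi>. (\<eta> s * h \<xi> - \<eta> t * h \<xi>) / (s - t) - time_deriv T (\<lambda>t \<xi>. \<eta> t * h \<xi>) t \<xi>))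
      = (\<lambda>s. C2_norm (\<lambda>\<xi>. ((\<eta> s - \<eta> t) / (s - t) - \<eta>' t) * h \<xi>))"
      by (simp add: td[OF t] left_diff_distrib diff_divide_distrib)
    then show "((\<lambda>s. C2_norm (\<lambda>\<xi>. (\<eta> s * h \<xi> - \<eta> t * h \<xi>) / (s - t) - time_deriv T (\<lambda>t \<xi>. \<eta> t * h \<xi>) t \<xi>)) \<longlongrightarrow> 0)
       (at t within {0..<T})" using lim[OF l] by simp
  next
    fix t assume t: "t \<in> {0..<T}"
    have "(\<eta>' \<longlongrightarrow> \<eta>' t) (at t within {0..<T})"
      using \<eta>(2) by (metis continuous_on_def UNIV_I tendsto_within_subset subset_UNIV)
    then have l: "((\<lambda>s. \<eta>' s - \<eta>' t) \<longlongrightarrow> 0) (at t within {0..<T})" using LIM_zero by blast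
    have "\<forall>\<^sub>F s in at t within {0..<T}. C2_norm (\<lambda>\<xi>. (\<eta>' s - \<eta>' t) * h \<xi>)
       = C2_norm (\<lambda>\<xi>. time_deriv T (\<lambda>t \<xi>. \<eta> t * h \<xi>) s \<xi> - time_deriv T (\<lambda>t \<xi>. \<eta> t * h \<xi>) t \<xi>)"
      by (simp add: eventually_at_filter td[OF t] td left_diff_distrib)
    then show "((\<lambda>s. C2_norm (\<lambda>\<xi>. time_deriv T (\<lambda>t \<xi>. \<eta> t * h \<xi>) s \<xi> - time_deriv T (\<lambda>t \<xi>. \<eta> t * h \<xi>) t \<xi>)) \<longlongrightarrow> 0)
       (at t within {0..<T})" using lim[OF l] by (rule Lim_transform_eventually[rotated])
  qed
qed

section \<open>Truncated profiles\<close>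

lemma jet1_comp:
  assumes "(g has_real_derivative g') (at (F q))" "jet1 F a b q"
  shows "jet1 (\<lambda>q. g (F q)) (g' * a) (g' * b) q"
  using has_derivative_compose[OF assms(2)[unfolded jet1_def] assms(1)[unfolded has_field_derivative_def]]
  unfolding jet1_def by (rule has_derivative_eq_rhs) (simp add: fun_eq_iff algebra_simps)

lemma jet1_add:
  assumes "jet1 F a b q" "jet1 G c d q"
  shows "jet1 (\<lambda>q. F q + G q) (a + c) (b + d) q"
  using has_derivative_add[OF assms[unfolded jet1_def]]
  unfolding jet1_def by (rule has_derivative_eq_rhs) (simp add: fun_eq_iff algebra_simps)

lemma jet1_cong: "jet1 F a b q \<Longrightarrow> a = a' \<Longrightarrow> b = b' \<Longrightarrow> jet1 F a' b' q"
  by simp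

lemma C2_profile_comp:
  assumes C2: "C2_profile F Fs Ft Fss Fst Ftt" and S: "\<And>q. F q \<in> S"
    and g: "\<And>x. x \<in> S \<Longrightarrow> (g has_real_derivative g' x) (at x)"
    and g': "\<And>x. x \<in> S \<Longrightarrow> (g' has_real_derivative g'' x) (at x)"
    and g'': "continuous_on S g''"
  shows "C2_profile (\<lambda>q. g (F q)) (\<lambda>q. g' (F q) * Fs q) (\<lambda>q. g' (F q) * Ft q)
     (\<lambda>q. g'' (F q) * (Fs q)\<^sup>2 + g' (F q) * Fss q) (\<lambda>q. g'' (F q) * Fs q * Ft q + g' (F q) * Fst q)
     (\<lambda>q. g'' (F q) * (Ft q)\<^sup>2 + g' (F q) * Ftt q)"
proof -
  note c = C2_profile_continuous[OF C2] C2_profileD(4-6)[OF C2]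
  have cg': "continuous_on UNIV (\<lambda>q. g' (F q))"
    by (rule jet1_continuous[OF jet1_comp[OF g'[OF S] C2_profileD(1)[OF C2]]])
  have cg'': "continuous_on UNIV (\<lambda>q. g'' (F q))"
    by (rule continuous_on_compose2[OF g'' c(1)]) (use S in auto)
  show ?thesis
    unfolding C2_profile_def
  proof (intro conjI allI)
    fix q
    note j' = jet1_comp[OF g'[OF S] C2_profileD(1)[OF C2], of q]
    show "jet1 (\<lambda>q. g (F q)) (g' (F q) * Fs q) (g' (F q) * Ft q) q"
      by (rule jet1_comp[OF g[OF S] C2_profileD(1)[OF C2]])
    show "jet1 (\<lambda>q. g' (F q) * Fs q) (g'' (F q) * (Fs q)\<^sup>2 + g' (F q) * Fss q) (g'' (F q) * Fs q * Ft q + g' (F q) * Fst q) q"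
      by (rule jet1_cong[OF jet1_mult[OF j' C2_profileD(2)[OF C2]]]) (auto simp: power2_eq_square)
    show "jet1 (\<lambda>q. g' (F q) * Ft q) (g'' (F q) * Fs q * Ft q + g' (F q) * Fst q) (g'' (F q) * (Ft q)\<^sup>2 + g' (F q) * Ftt q) q"
      by (rule jet1_cong[OF jet1_mult[OF j' C2_profileD(3)[OF C2]]]) (auto simp: power2_eq_square)
  qed (intro continuous_intros c cg' cg'')+
qed

lemma C2_profile_add:
  assumes "C2_profile F Fs Ft Fss Fst Ftt" "C2_profile G Gs Gt Gss Gst Gtt"
  shows "C2_profile (\<lambda>q. F q + G q) (\<lambda>q. Fs q + Gs q) (\<lambda>q. Ft q + Gt q) (\<lambda>q. Fss q + Gss q)
     (\<lambda>q. Fst q + Gst q) (\<lambda>q. Ftt q + Gtt q)"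
  using assms by (auto simp: C2_profile_def intro!: jet1_add continuous_intros)

lemma C2_profile_mult:
  assumes F: "C2_profile F Fs Ft Fss Fst Ftt" and G: "C2_profile G Gs Gt Gss Gst Gtt"
  shows "C2_profile (\<lambda>q. F q * G q) (\<lambda>q. Fs q * G q + F q * Gs q) (\<lambda>q. Ft q * G q + F q * Gt q)
     (\<lambda>q. Fss q * G q + 2 * Fs q * Gs q + F q * Gss q)
     (\<lambda>q. Fst q * G q + Fs q * Gt q + Ft q * Gs q + F q * Gst q)
     (\<lambda>q. Ftt q * G q + 2 * Ft q * Gt q + F q * Gtt q)"
  unfolding C2_profile_def
proof (intro conjI allI)
  fix q
  show "jet1 (\<lambda>q. F q * G q) (Fs q * G q + F q * Gs q) (Ft q * G q + F q * Gt q) q"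
    by (rule jet1_mult[OF C2_profileD(1)[OF F] C2_profileD(1)[OF G]])
  show "jet1 (\<lambda>q. Fs q * G q + F q * Gs q) (Fss q * G q + 2 * Fs q * Gs q + F q * Gss q)
     (Fst q * G q + Fs q * Gt q + Ft q * Gs q + F q * Gst q) q"
    by (rule jet1_cong[OF jet1_add[OF jet1_mult[OF C2_profileD(2)[OF F] C2_profileD(1)[OF G]]
           jet1_mult[OF C2_profileD(1)[OF F] C2_profileD(2)[OF G]]]]) auto
  show "jet1 (\<lambda>q. Ft q * G q + F q * Gt q) (Fst q * G q + Fs q * Gt q + Ft q * Gs q + F q * Gst q)
     (Ftt q * G q + 2 * Ft q * Gt q + F q * Gtt q) q"
    by (rule jet1_cong[OF jet1_add[OF jet1_mult[OF C2_profileD(3)[OF F] C2_profileD(1)[OF G]]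
           jet1_mult[OF C2_profileD(1)[OF F] C2_profileD(3)[OF G]]]]) auto
qed (intro continuous_intros C2_profile_continuous[OF F] C2_profileD(4-6)[OF F]
      C2_profile_continuous[OF G] C2_profileD(4-6)[OF G])+

lemma C2_profile_const: "C2_profile (\<lambda>_. c) (\<lambda>_. 0) (\<lambda>_. 0) (\<lambda>_. 0) (\<lambda>_. 0) (\<lambda>_. 0)"
  by (auto simp: C2_profile_def jet1_def)

lemma C2_profile_fst: "C2_profile fst (\<lambda>_. 1) (\<lambda>_. 0) (\<lambda>_. 0) (\<lambda>_. 0) (\<lambda>_. 0)"
  by (auto simp: C2_profile_def jet1_def intro!: derivative_eq_intros)

lemma C2_profile_sq_dist:
  "C2_profile (\<lambda>q. (fst q - c)\<^sup>2 + (snd q)\<^sup>2 + e) (\<lambda>q. 2 * (fst q - c)) (\<lambda>q. 2 * snd q)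
     (\<lambda>_. 2) (\<lambda>_. 0) (\<lambda>_. 2)"
  by (auto simp: C2_profile_def jet1_def fun_eq_iff intro!: derivative_eq_intros)

lemma C2_profile_knorm4:
  "C2_profile (\<lambda>q. knorm4 q + e) (\<lambda>q. 2 * fst q) (\<lambda>q. 2 * snd q) (\<lambda>_. 2) (\<lambda>_. 0) (\<lambda>_. 2)"
  using C2_profile_sq_dist[of 0 e] by (simp add: knorm4_def[abs_def])

text \<open>The chain rule: the first-order part is linear in the derivative of the outer function, and the
  second derivative of the outer function multiplies the squared horizontal gradient, which is
  4 s (a^2 + b^2).\<close>

lemma cyl_op_comp:
  "cyl_op N \<mu> q (g1 * a) (g1 * b) (g2 * a\<^sup>2 + g1 * aa) (g2 * b\<^sup>2 + g1 * bb)
   = g1 * cyl_op N \<mu> q a b aa bb + g2 * (4 * fst q * (a\<^sup>2 + b\<^sup>2))"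
  by (simp add: cyl_op_def algebra_simps add_divide_distrib)

lemma cyl_op_mult:
  "cyl_op N \<mu> q (fs * g + f * gs) (ft * g + f * gt) (fss * g + 2 * fs * gs + f * gss) (ftt * g + 2 * ft * gt + f * gtt)
   = g * cyl_op N \<mu> q fs ft fss ftt + f * cyl_op N \<mu> q gs gt gss gtt + 8 * fst q * (fs * gs + ft * gt)"
  by (simp add: cyl_op_def algebra_simps add_divide_distrib)

lemma cyl_op_add:
  "cyl_op N \<mu> q (a + a') (b + b') (aa + aa') (bb + bb') = cyl_op N \<mu> q a b aa bb + cyl_op N \<mu> q a' b' aa' bb'"
  by (simp add: cyl_op_def algebra_simps add_divide_distrib)

text \<open>The profiles of the spatial factors of test functions. The value MF of the operator is carried along
  so that a test function can be used without reference to the derivatives of F.\<close>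

definition radial_test where
  "radial_test N \<mu> F MF \<longleftrightarrow> (\<exists>Fs Ft Fss Fst Ftt. C2_profile F Fs Ft Fss Fst Ftt \<and>
      MF = (\<lambda>q. cyl_op N \<mu> q (Fs q) (Ft q) (Fss q) (Ftt q))) \<and>
     (\<forall>q. 0 \<le> F q) \<and> (\<exists>R. \<forall>q. R \<le> knorm4 q \<longrightarrow> F q = 0)"

lemma radial_testD:
  assumes "radial_test N \<mu> F MF"
  obtains Fs Ft Fss Fst Ftt R where "C2_profile F Fs Ft Fss Fst Ftt"
    "\<And>q. MF q = cyl_op N \<mu> q (Fs q) (Ft q) (Fss q) (Ftt q)" "\<And>q. R \<le> knorm4 q \<Longrightarrow> F q = 0"
  using assms unfolding radial_test_def by (elim conjE exE) (rule that, assumption, simp, blast)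

lemma radial_test_nonneg: "radial_test N \<mu> F MF \<Longrightarrow> 0 \<le> F q"
  unfolding radial_test_def by blast

text \<open>Cutting off at a double zero keeps differentiability; both one-sided derivatives are 0 there.\<close>

lemma DERIV_pos_part:
  assumes f: "\<And>x. 0 \<le> x \<Longrightarrow> (f has_real_derivative f' x) (at x)" and "f 0 = 0" "f' 0 = 0"
  shows "((\<lambda>x. if x \<le> 0 then 0 else f x) has_real_derivative (if x \<le> 0 then 0 else f' x)) (at x)"
proof -
  consider "x < 0" | "x > 0" | "x = 0" by linarith
  then show ?thesis
  proof cases
    case 1
    then have "((\<lambda>x. if x \<le> 0 then 0 else f x) has_real_derivative 0) (at x)"
      by (intro has_field_derivative_transform_within_open[OF DERIV_const, of "{..<0}"]) auto
    then show ?thesis using 1 by simp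
  next
    case 2
    then have "((\<lambda>x. if x \<le> 0 then 0 else f x) has_real_derivative f' x) (at x)"
      by (intro has_field_derivative_transform_within_open[OF f, of x "{0<..}"]) auto
    then show ?thesis using 2 by simp
  next
    case 3
    have "((\<lambda>h. (f (0 + h) - f 0) / h) \<longlongrightarrow> 0) (at 0)"
      using f[of 0] assms(3) unfolding DERIV_def by simp
    then have l: "((\<lambda>h. norm (f h / h)) \<longlongrightarrow> 0) (at 0)"
      using assms(2) tendsto_norm_zero by fastforce
    have "((\<lambda>h. (if h \<le> 0 then 0 else f h) / h) \<longlongrightarrow> 0) (at 0)"
    proof (rule Lim_null_comparison[OF _ l])
      have "norm ((if h \<le> 0 then 0 else f h) / h) \<le> norm (f h / h)" for h by (auto simp: divide_nonneg_nonpos)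
      then show "\<forall>\<^sub>F h in at 0. norm ((if h \<le> 0 then 0 else f h) / h) \<le> norm (f h / h)" by simp
    qed
    then show ?thesis using 3 by (simp add: DERIV_def cong: if_cong)
  qed
qed

text \<open>A convex C^2 function that vanishes on the negative half-line and grows linearly. The linear growth
  matters: composition with (max 0 x)^3 would triple the order of the singularity of a barrier.\<close>

definition ramp :: "real \<Rightarrow> real" where "ramp x = (if x \<le> 0 then 0 else x ^ 3 / (1 + x)\<^sup>2)"
definition ramp' :: "real \<Rightarrow> real" where "ramp' x = (if x \<le> 0 then 0 else x\<^sup>2 * (x + 3) / (1 + x) ^ 3)"
definition ramp'' :: "real \<Rightarrow> real" where "ramp'' x = (if x \<le> 0 then 0 else 6 * x / (1 + x) ^ 4)"

lemma DERIV_ramp: "(ramp has_real_derivative ramp' x) (at x)"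
  unfolding ramp_def[abs_def] ramp'_def
proof (rule DERIV_pos_part)
  fix x :: real assume x: "0 \<le> x"
  then have "1 + x \<noteq> 0" by simp
  have "((\<lambda>x. x ^ 3 / (1 + x)\<^sup>2) has_real_derivative (3 * x\<^sup>2 * (1 + x)\<^sup>2 - x ^ 3 * (2 * (1 + x))) / ((1 + x)\<^sup>2 * (1 + x)\<^sup>2)) (at x)"
    using x by (auto intro!: derivative_eq_intros simp: power2_eq_square)
  also have "(3 * x\<^sup>2 * (1 + x)\<^sup>2 - x ^ 3 * (2 * (1 + x))) / ((1 + x)\<^sup>2 * (1 + x)\<^sup>2) = x\<^sup>2 * (x + 3) / (1 + x) ^ 3"
    using \<open>1 + x \<noteq> 0\<close> by (simp add: divide_eq_eq eq_divide_eq) algebra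
  finally show "((\<lambda>x. x ^ 3 / (1 + x)\<^sup>2) has_real_derivative x\<^sup>2 * (x + 3) / (1 + x) ^ 3) (at x)" .
qed auto

lemma DERIV_ramp': "(ramp' has_real_derivative ramp'' x) (at x)"
  unfolding ramp'_def[abs_def] ramp''_def
proof (rule DERIV_pos_part)
  fix x :: real assume x: "0 \<le> x"
  then have "1 + x \<noteq> 0" by simp
  have "((\<lambda>x. x\<^sup>2 * (x + 3) / (1 + x) ^ 3) has_real_derivative
     ((2 * x * (x + 3) + x\<^sup>2) * (1 + x) ^ 3 - x\<^sup>2 * (x + 3) * (3 * (1 + x)\<^sup>2)) / ((1 + x) ^ 3 * (1 + x) ^ 3)) (at x)"
    using x by (auto intro!: derivative_eq_intros simp: power2_eq_square)
  also have "((2 * x * (x + 3) + x\<^sup>2) * (1 + x) ^ 3 - x\<^sup>2 * (x + 3) * (3 * (1 + x)\<^sup>2)) / ((1 + x) ^ 3 * (1 + x) ^ 3)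
      = 6 * x / (1 + x) ^ 4"
    using \<open>1 + x \<noteq> 0\<close> by (simp add: divide_eq_eq eq_divide_eq) algebra
  finally show "((\<lambda>x. x\<^sup>2 * (x + 3) / (1 + x) ^ 3) has_real_derivative 6 * x / (1 + x) ^ 4) (at x)" .
qed auto

lemma continuous_ramp'': "continuous_on S ramp''"
proof -
  have eq: "ramp'' = (\<lambda>x. 6 * max 0 x / (1 + max 0 x) ^ 4)"
    by (auto simp: ramp''_def fun_eq_iff max_def)
  show ?thesis unfolding eq by (intro continuous_intros) (auto simp: add_nonneg_eq_0_iff)
qed

lemma ramp_nonneg: "0 \<le> ramp x" "0 \<le> ramp' x" "0 \<le> ramp'' x"
  by (auto simp: ramp_def ramp'_def ramp''_def)

lemma ramp_pos: "0 < x \<Longrightarrow> 0 < ramp x"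
  by (auto simp: ramp_def)

lemma ramp'_le_1: "ramp' x \<le> 1"
proof (cases "x \<le> 0")
  case False
  then have "x\<^sup>2 * (x + 3) \<le> (1 + x) ^ 3" by (simp add: power2_eq_square power3_eq_cube algebra_simps)
  then show ?thesis using False by (simp add: ramp'_def divide_le_eq_1)
qed (simp add: ramp'_def)

text \<open>The tangent of a convex function that vanishes at 0 lies below it at 0. This is what keeps the
  zero-order term of L + k w under control when a subsolution is truncated.\<close>

lemma ramp_le_ramp':
  assumes "0 \<le> m" shows "ramp (x - m) \<le> ramp' (x - m) * x"
proof (cases "x - m \<le> 0")
  case False
  define y where "y = x - m"
  have y: "0 < y" "y \<le> x" using False assms by (auto simp: y_def)
  have "y ^ 3 * (1 + y) \<le> y ^ 3 * (y + 3)" using y by (intro mult_left_mono) auto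
  then have "y ^ 3 * (1 + y) / (1 + y) ^ 3 \<le> y ^ 3 * (y + 3) / (1 + y) ^ 3"
    using y by (intro divide_right_mono) auto
  moreover have "y ^ 3 / (1 + y)\<^sup>2 = y ^ 3 * (1 + y) / (1 + y) ^ 3"
    using y by (simp add: power2_eq_square power3_eq_cube)
  moreover have "y ^ 3 * (y + 3) / (1 + y) ^ 3 = y\<^sup>2 * (y + 3) / (1 + y) ^ 3 * y"
    by (simp add: power2_eq_square power3_eq_cube)
  moreover have "y\<^sup>2 * (y + 3) / (1 + y) ^ 3 * y \<le> y\<^sup>2 * (y + 3) / (1 + y) ^ 3 * x"
    using y by (intro mult_left_mono) auto
  ultimately show ?thesis using y unfolding y_def[symmetric] by (simp add: ramp_def ramp'_def)
qed (simp add: ramp_def ramp'_def)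

lemma ramp_mono: "x \<le> y \<Longrightarrow> ramp x \<le> ramp y"
  using DERIV_nonneg_imp_nondecreasing[of x y ramp] DERIV_ramp ramp_nonneg(2) by blast

text \<open>Truncation gives compact support, and convexity makes the second-order term of the chain rule
  nonnegative, so a subsolution remains one.\<close>

lemma truncated_profile:
  assumes C2: "C2_profile F Fs Ft Fss Fst Ftt" and "0 \<le> m" and supp: "\<And>q. R \<le> knorm4 q \<Longrightarrow> F q \<le> m"
  obtains MF where "radial_test N \<mu> (\<lambda>q. ramp (F q - m)) MF"
    "\<And>q. 0 \<le> fst q \<Longrightarrow> ramp' (F q - m) * cyl_op N \<mu> q (Fs q) (Ft q) (Fss q) (Ftt q) \<le> MF q"
proof -
  let ?g = "\<lambda>x. ramp (x - m)"
  have d0: "((\<lambda>x. x - m) has_real_derivative 1) (at x)" for x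
    by (auto intro!: derivative_eq_intros)
  have d: "((\<lambda>x. ramp (x - m)) has_real_derivative ramp' (x - m)) (at x)"
    "((\<lambda>x. ramp' (x - m)) has_real_derivative ramp'' (x - m)) (at x)" for x
    using DERIV_chain2[OF DERIV_ramp d0] DERIV_chain2[OF DERIV_ramp' d0] by simp_all
  have c: "continuous_on UNIV (\<lambda>x. ramp'' (x - m))"
    by (rule continuous_on_compose2[OF continuous_ramp''[of UNIV]]) (auto intro: continuous_intros)
  note P = C2_profile_comp[OF C2 UNIV_I d c]
  show thesis
  proof
    show "radial_test N \<mu> (\<lambda>q. ramp (F q - m)) (\<lambda>q. ramp' (F q - m) * cyl_op N \<mu> q (Fs q) (Ft q) (Fss q) (Ftt q)
       + ramp'' (F q - m) * (4 * fst q * ((Fs q)\<^sup>2 + (Ft q)\<^sup>2)))"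
      unfolding radial_test_def
    proof (intro conjI allI)
      show "\<exists>R. \<forall>q. R \<le> knorm4 q \<longrightarrow> ramp (F q - m) = 0"
        using supp by (intro exI[of _ R]) (auto simp: ramp_def)
    qed (use P ramp_nonneg in \<open>force simp: cyl_op_comp\<close>)+
    show "ramp' (F q - m) * cyl_op N \<mu> q (Fs q) (Ft q) (Fss q) (Ftt q) \<le>
       ramp' (F q - m) * cyl_op N \<mu> q (Fs q) (Ft q) (Fss q) (Ftt q)
       + ramp'' (F q - m) * (4 * fst q * ((Fs q)\<^sup>2 + (Ft q)\<^sup>2))" if "0 \<le> fst q" for q
      using that ramp_nonneg(3)[of "F q - m"] by simp
  qed
qed

section \<open>Barriers\<close>

text \<open>Far from the centre (c, 0) the Gaussian exp(-K d^2) is a strict subsolution for large K, as in the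
  proof of the Hopf lemma. Away from the axis this is due to its second derivatives, of size
  s K^2 d^2. They degenerate near the axis, but there s < c and the first-order term, of size
  N K (c - s), is positive; the drift costs at most \<mu> out of N. The centre has to lie off the axis
  for this, which is why c > 0.\<close>

lemma spreading_barrier:
  assumes "0 < \<mu>" "\<mu> < N" "0 < k" "0 < c" "0 < r"
  obtains F MF where "radial_test N \<mu> F MF"
    "\<And>q. 0 \<le> fst q \<Longrightarrow> q \<noteq> 0 \<Longrightarrow> r\<^sup>2 \<le> (fst q - c)\<^sup>2 + (snd q)\<^sup>2 \<Longrightarrow> 2 * k * F q \<le> MF q"
    "\<And>q. knorm4 q \<le> R \<Longrightarrow> 0 < F q"
proof -
  \<comment> \<open>The summands are the lower bounds for K that the two regions s \<ge> c/2 and s \<le> c/2 require.\<close>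
  define K where "K = (3 + N - \<mu>) / (2 * r\<^sup>2) + 1 / r\<^sup>2 + k / (2 * c) + 2 * k / (4 * (N - \<mu>) * c)"
  have pos: "0 < (3 + N - \<mu>) / (2 * r\<^sup>2)" "0 < 1 / r\<^sup>2" "0 < k / (2 * c)" "0 < 2 * k / (4 * (N - \<mu>) * c)"
    using assms by auto
  have K: "(3 + N - \<mu>) / (2 * r\<^sup>2) \<le> K" "1 / r\<^sup>2 \<le> K" "k / (2 * c) \<le> K" "2 * k / (4 * (N - \<mu>) * c) \<le> K" "0 < K"
    using pos unfolding K_def by linarith+
  have K1: "3 + N - \<mu> \<le> 2 * (K * r\<^sup>2)" "1 \<le> K * r\<^sup>2" "k \<le> 2 * c * K" "2 * k \<le> 4 * (N - \<mu>) * c * K"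
    using K assms by (simp_all add: divide_le_eq mult_ac)
  define d where "d = (\<lambda>q::real\<times>real. (fst q - c)\<^sup>2 + (snd q)\<^sup>2 + 0)"
  define F where "F = (\<lambda>q. exp (- K * d q))"
  have dF: "((\<lambda>x. exp (- K * x)) has_real_derivative - K * exp (- K * x)) (at x)"
    "((\<lambda>x. - K * exp (- K * x)) has_real_derivative K\<^sup>2 * exp (- K * x)) (at x)" for x
    by (auto intro!: derivative_eq_intros simp: power2_eq_square)
  have cF: "continuous_on UNIV (\<lambda>x. K\<^sup>2 * exp (- K * x))" by (intro continuous_intros)
  note P = C2_profile_comp[OF C2_profile_sq_dist[of c 0, folded d_def] UNIV_I dF cF, folded F_def]
  \<comment> \<open>The truncation level m is the value of the Gaussian on a circle that encloses the ball knorm4 q \<le> R.\<close>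
  define B where "B = 2 * \<bar>R\<bar> + 2 * c\<^sup>2 + 1"
  define m where "m = exp (- K * B)"
  have dle: "d q \<le> 2 * knorm4 q + 2 * c\<^sup>2" for q
  proof -
    have "0 \<le> (fst q + c)\<^sup>2 + (snd q)\<^sup>2" by simp
    then show ?thesis by (simp add: d_def knorm4_def power2_eq_square algebra_simps)
  qed
  have dge: "knorm4 q \<le> 2 * d q + 2 * c\<^sup>2" for q
  proof -
    have "0 \<le> (fst q - 2 * c)\<^sup>2 + (snd q)\<^sup>2" by simp
    then show ?thesis by (simp add: d_def knorm4_def power2_eq_square algebra_simps)
  qed
  have supp: "F q \<le> m" if "2 * B + 2 * c\<^sup>2 \<le> knorm4 q" for q
    using dge[of q] that K by (simp add: F_def m_def)
  obtain MF where MF: "radial_test N \<mu> (\<lambda>q. ramp (F q - m)) MF"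
    and MF': "\<And>q. 0 \<le> fst q \<Longrightarrow> ramp' (F q - m) * cyl_op N \<mu> q (- K * exp (- K * d q) * (2 * (fst q - c)))
      (- K * exp (- K * d q) * (2 * snd q)) (K\<^sup>2 * exp (- K * d q) * (2 * (fst q - c))\<^sup>2 + - K * exp (- K * d q) * 2)
      (K\<^sup>2 * exp (- K * d q) * (2 * snd q)\<^sup>2 + - K * exp (- K * d q) * 2) \<le> MF q"
    by (rule truncated_profile[OF P _ supp, where N=N and \<mu>=\<mu>]) (auto simp: m_def)
  show thesis
  proof
    show "radial_test N \<mu> (\<lambda>q. ramp (F q - m)) MF" by (rule MF)
    show "0 < ramp (F q - m)" if "knorm4 q \<le> R" for q
    proof -
      have "d q < B" using dle[of q] that by (simp add: B_def)
      then show ?thesis using K by (intro ramp_pos) (simp add: F_def m_def)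
    qed
    fix q :: "real \<times> real"
    assume s0: "0 \<le> fst q" and q0: "q \<noteq> 0" and out: "r\<^sup>2 \<le> (fst q - c)\<^sup>2 + (snd q)\<^sup>2"
    define s where "s = fst q"
    have g: "0 < knorm4 q" using q0 by (simp add: knorm4_pos_iff)
    have dr: "r\<^sup>2 \<le> d q" using out by (simp add: d_def)
    have s: "0 \<le> s" using s0 s_def by simp
    let ?D = "N * (c - s) + \<mu> * s - \<mu> * c * (s\<^sup>2 / knorm4 q)"
    have M1: "cyl_op N \<mu> q (2 * (fst q - c)) (2 * snd q) 2 2 = 16 * s - 8 * ?D"
    proof -
      have e: "s * (2 * (s - c)) + snd q * (2 * snd q) = 2 * (knorm4 q - c * s)"
        by (simp add: knorm4_def s_def power2_eq_square algebra_simps)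
      have "4 * \<mu> * s * (s * (2 * (s - c)) + snd q * (2 * snd q)) / knorm4 q
        = 8 * \<mu> * s * ((knorm4 q - c * s) / knorm4 q)"
        unfolding e by simp
      also have "(knorm4 q - c * s) / knorm4 q = 1 - c * s / knorm4 q"
        using g by (simp add: diff_divide_distrib)
      finally show ?thesis
        unfolding cyl_op_def s_def[symmetric] by (simp add: power2_eq_square algebra_simps)
    qed
    have fr: "s\<^sup>2 / knorm4 q \<le> 1"
      using g knorm4_bounds(1)[of q] by (simp add: s_def)
    have D: "(N - \<mu>) * (c - s) \<le> ?D"
    proof -
      have "\<mu> * c * (s\<^sup>2 / knorm4 q) \<le> \<mu> * c * 1" using fr assms by (intro mult_left_mono) auto
      then show ?thesis by (simp add: algebra_simps)
    qed
    have E: "cyl_op N \<mu> q (- K * exp (- K * d q) * (2 * (fst q - c)))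
      (- K * exp (- K * d q) * (2 * snd q)) (K\<^sup>2 * exp (- K * d q) * (2 * (fst q - c))\<^sup>2 + - K * exp (- K * d q) * 2)
      (K\<^sup>2 * exp (- K * d q) * (2 * snd q)\<^sup>2 + - K * exp (- K * d q) * 2)
      = F q * (16 * s * K * (K * d q - 1) + 8 * K * ?D)"
      unfolding cyl_op_comp M1 by (simp add: F_def d_def s_def power2_eq_square algebra_simps)
    have "2 * k \<le> 16 * s * K * (K * d q - 1) + 8 * K * ?D"
    proof -
      have Kd: "K * r\<^sup>2 \<le> K * d q" using dr K by simp
      have a: "8 * K * ((N - \<mu>) * (c - s)) \<le> 8 * K * ?D" using D K by (intro mult_left_mono) auto
      have b: "16 * s * K * (K * r\<^sup>2 - 1) \<le> 16 * s * K * (K * d q - 1)"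
        using Kd s K by (intro mult_left_mono) auto
      show ?thesis
      proof (cases "s \<le> c / 2")
        case True
        have "0 \<le> 16 * s * K * (K * r\<^sup>2 - 1)" using s K K1 by simp
        moreover have "8 * K * ((N - \<mu>) * (c / 2)) \<le> 8 * K * ((N - \<mu>) * (c - s))"
          using True K assms by (intro mult_left_mono) auto
        moreover have "4 * (N - \<mu>) * c * K = 8 * K * ((N - \<mu>) * (c / 2))" by simp
        then have "2 * k \<le> 8 * K * ((N - \<mu>) * (c / 2))" using K1(4) by linarith
        ultimately show ?thesis using a b by linarith
      next
        case False
        have "8 * (c / 2) * K * 1 \<le> 8 * s * K * (2 * (K * r\<^sup>2) - 2 - (N - \<mu>))"
          using False K K1 assms by (intro mult_mono) auto
        also have "\<dots> \<le> 16 * s * K * (K * r\<^sup>2 - 1) + 8 * K * ((N - \<mu>) * (c - s))"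
          using K assms by (simp add: algebra_simps)
        finally have "8 * (c / 2) * K * 1 \<le> 16 * s * K * (K * r\<^sup>2 - 1) + 8 * K * ((N - \<mu>) * (c - s))" .
        moreover have "2 * k \<le> 8 * (c / 2) * K * 1" using K1(3) by (simp add: mult_ac)
        ultimately show ?thesis using a b by linarith
      qed
    qed
    then have "2 * k * F q \<le> F q * (16 * s * K * (K * d q - 1) + 8 * K * ?D)"
      using mult_right_mono[of "2*k" _ "F q"] by (simp add: F_def mult.commute)
    then have "ramp' (F q - m) * (2 * k * F q) \<le> MF q"
      using MF'[OF s0] unfolding E
      by (meson mult_left_mono order_trans ramp_nonneg(2))
    moreover have "2 * k * ramp (F q - m) \<le> 2 * k * (ramp' (F q - m) * F q)"
      using ramp_le_ramp'[of m "F q"] assms(3) by (intro mult_left_mono) (auto simp: m_def)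
    ultimately show "2 * k * ramp (F q - m) \<le> MF q" by (simp add: mult_ac)
  qed
qed

lemma C2_profile_cmult:
  assumes "C2_profile F Fs Ft Fss Fst Ftt"
  shows "C2_profile (\<lambda>q. c * F q) (\<lambda>q. c * Fs q) (\<lambda>q. c * Ft q)
     (\<lambda>q. c * Fss q) (\<lambda>q. c * Fst q) (\<lambda>q. c * Ftt q)"
  using C2_profile_mult[OF C2_profile_const[of c] assms] by simp

lemma cyl_op_cmult: "cyl_op N \<mu> q (c * a) (c * b) (c * aa) (c * bb) = c * cyl_op N \<mu> q a b aa bb"
  by (simp add: cyl_op_def algebra_simps add_divide_distrib)

text \<open>The coefficient 2q - N + \<mu> changes sign at the homogeneity of the fundamental solution of L:
  for e = 0 and larger q the power is a subsolution off the origin, though not a strict one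
  on the axis s = 0.\<close>

lemma profile_powr:
  assumes "0 < e"
  obtains Fs Ft Fss Fst Ftt where "C2_profile (\<lambda>p. (knorm4 p + e) powr - q) Fs Ft Fss Fst Ftt"
    "\<And>p. Fs p = - 2 * q * fst p * (knorm4 p + e) powr (- q - 1)"
    "\<And>p N \<mu>. p \<noteq> 0 \<Longrightarrow> cyl_op N \<mu> p (Fs p) (Ft p) (Fss p) (Ftt p) = 8 * q * fst p * (knorm4 p + e) powr (- q - 2)
        * ((2 * q - N + \<mu>) * knorm4 p - (2 + N - \<mu>) * e)"
proof -
  have in_pos: "knorm4 p + e \<in> {0<..}" for p using assms by (simp add: add_nonneg_pos)
  have d: "((\<lambda>x. x powr - q) has_real_derivative - q * x powr (- q - 1)) (at x)"
    "((\<lambda>x. - q * x powr (- q - 1)) has_real_derivative q * (q + 1) * x powr (- q - 2)) (at x)" if "x \<in> {0<..}" for x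
    using that by (auto intro!: derivative_eq_intros simp: algebra_simps)
  have c: "continuous_on {0<..} (\<lambda>x. q * (q + 1) * x powr (- q - 2))"
    by (intro continuous_intros) auto
  note P = C2_profile_comp[OF C2_profile_knorm4 in_pos d c]
  show thesis
  proof (rule that[OF P])
    fix p :: "real \<times> real"
    show "- q * (knorm4 p + e) powr (- q - 1) * (2 * fst p) = - 2 * q * fst p * (knorm4 p + e) powr (- q - 1)"
      by simp
  next
    fix p :: "real \<times> real" and N \<mu> :: real assume "p \<noteq> 0"
    then have g: "0 < knorm4 p" by (simp add: knorm4_pos_iff)
    let ?P = "knorm4 p + e"
    have e1: "fst p * (2 * fst p) + snd p * (2 * snd p) = 2 * knorm4 p"
      by (simp add: knorm4_def power2_eq_square)
    have M: "cyl_op N \<mu> p (2 * fst p) (2 * snd p) 2 2 = 8 * fst p * (2 + N - \<mu>)"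
      unfolding cyl_op_def e1 using g by (simp add: algebra_simps)
    have e2: "(2 * fst p)\<^sup>2 + (2 * snd p)\<^sup>2 = 4 * knorm4 p" by (simp add: knorm4_def)
    have e0: "- q - 1 = (- q - 2) + 1" by simp
    have e3: "?P powr (- q - 1) = ?P powr (- q - 2) * ?P"
      unfolding e0 powr_add using in_pos[of p] by simp
    show "cyl_op N \<mu> p (- q * ?P powr (- q - 1) * (2 * fst p)) (- q * ?P powr (- q - 1) * (2 * snd p))
         (q * (q + 1) * ?P powr (- q - 2) * (2 * fst p)\<^sup>2 + - q * ?P powr (- q - 1) * 2)
         (q * (q + 1) * ?P powr (- q - 2) * (2 * snd p)\<^sup>2 + - q * ?P powr (- q - 1) * 2)
       = 8 * q * fst p * ?P powr (- q - 2) * ((2 * q - N + \<mu>) * knorm4 p - (2 + N - \<mu>) * e)"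
      unfolding cyl_op_comp M e2 e3 by (simp add: algebra_simps)
  qed
qed

text \<open>The second summand has the same homogeneity as the first for e = 0. It supplies what the first one
  lacks: on the axis its derivative in s contributes 4 N a (knorm4 p + e)^(-q-1/2) > 0.\<close>

lemma singular_profile:
  assumes "0 < e"
  obtains Fs Ft Fss Fst Ftt where
    "C2_profile (\<lambda>p. (knorm4 p + e) powr - q + a * (fst p * (knorm4 p + e) powr - (q + 1/2))) Fs Ft Fss Fst Ftt"
    "\<And>p N \<mu>. p \<noteq> 0 \<Longrightarrow> cyl_op N \<mu> p (Fs p) (Ft p) (Fss p) (Ftt p) =
      8 * q * fst p * (knorm4 p + e) powr (- q - 2) * ((2 * q - N + \<mu>) * knorm4 p - (2 + N - \<mu>) * e)
      + a * ((knorm4 p + e) powr - (q + 1/2) * (4 * N - 4 * \<mu> * (fst p)\<^sup>2 / knorm4 p)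
           + 8 * (q + 1/2) * (fst p)\<^sup>2 * (knorm4 p + e) powr (- (q + 1/2) - 2) * ((2 * (q + 1/2) - N + \<mu>) * knorm4 p - (2 + N - \<mu>) * e)
           - 16 * (q + 1/2) * (fst p)\<^sup>2 * (knorm4 p + e) powr (- (q + 1/2) - 1))"
proof -
  define q' where "q' = q + 1/2"
  obtain Fs Ft Fss Fst Ftt where F: "C2_profile (\<lambda>p. (knorm4 p + e) powr - q) Fs Ft Fss Fst Ftt"
    "\<And>p. Fs p = - 2 * q * fst p * (knorm4 p + e) powr (- q - 1)"
    "\<And>p N \<mu>. p \<noteq> 0 \<Longrightarrow> cyl_op N \<mu> p (Fs p) (Ft p) (Fss p) (Ftt p) = 8 * q * fst p * (knorm4 p + e) powr (- q - 2)
        * ((2 * q - N + \<mu>) * knorm4 p - (2 + N - \<mu>) * e)"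
    by (rule profile_powr[OF assms(1), of q]) (rule that)
  obtain Gs Gt Gss Gst Gtt where G: "C2_profile (\<lambda>p. (knorm4 p + e) powr - q') Gs Gt Gss Gst Gtt"
    "\<And>p. Gs p = - 2 * q' * fst p * (knorm4 p + e) powr (- q' - 1)"
    "\<And>p N \<mu>. p \<noteq> 0 \<Longrightarrow> cyl_op N \<mu> p (Gs p) (Gt p) (Gss p) (Gtt p) = 8 * q' * fst p * (knorm4 p + e) powr (- q' - 2)
        * ((2 * q' - N + \<mu>) * knorm4 p - (2 + N - \<mu>) * e)"
    by (rule profile_powr[OF assms(1), of q']) (rule that)
  note K = C2_profile_mult[OF C2_profile_fst G(1)]
  note C = C2_profile_add[OF F(1) C2_profile_cmult[OF K, of a]]
  show thesis
  proof (rule that[OF C[unfolded q'_def]], unfold q'_def[symmetric])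
    fix p :: "real \<times> real" and N \<mu> :: real assume p: "p \<noteq> 0"
    let ?P = "knorm4 p + e"
    have M1: "cyl_op N \<mu> p 1 0 0 0 = 4 * N - 4 * \<mu> * (fst p)\<^sup>2 / knorm4 p"
      by (simp add: cyl_op_def power2_eq_square)
    have MK: "cyl_op N \<mu> p (1 * ?P powr - q' + fst p * Gs p) (0 * ?P powr - q' + fst p * Gt p)
          (0 * ?P powr - q' + 2 * 1 * Gs p + fst p * Gss p) (0 * ?P powr - q' + 2 * 0 * Gt p + fst p * Gtt p)
      = ?P powr - q' * (4 * N - 4 * \<mu> * (fst p)\<^sup>2 / knorm4 p)
           + 8 * q' * (fst p)\<^sup>2 * ?P powr (- q' - 2) * ((2 * q' - N + \<mu>) * knorm4 p - (2 + N - \<mu>) * e)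
           - 16 * q' * (fst p)\<^sup>2 * ?P powr (- q' - 1)"
      unfolding cyl_op_mult M1 G(3)[OF p] unfolding G(2) by (simp add: power2_eq_square)
    show "cyl_op N \<mu> p (Fs p + a * (1 * ?P powr - q' + fst p * Gs p))
          (Ft p + a * (0 * ?P powr - q' + fst p * Gt p))
          (Fss p + a * (0 * ?P powr - q' + 2 * 1 * Gs p + fst p * Gss p))
          (Ftt p + a * (0 * ?P powr - q' + 2 * 0 * Gt p + fst p * Gtt p))
      = 8 * q * fst p * ?P powr (- q - 2) * ((2 * q - N + \<mu>) * knorm4 p - (2 + N - \<mu>) * e)
      + a * (?P powr - q' * (4 * N - 4 * \<mu> * (fst p)\<^sup>2 / knorm4 p)
           + 8 * q' * (fst p)\<^sup>2 * ?P powr (- q' - 2) * ((2 * q' - N + \<mu>) * knorm4 p - (2 + N - \<mu>) * e)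
           - 16 * q' * (fst p)\<^sup>2 * ?P powr (- q' - 1))"
      unfolding cyl_op_add[of N \<mu> p "Fs p" _ "Ft p" _ "Fss p" _ "Ftt p"] cyl_op_cmult MK F(3)[OF p] by simp
  qed
qed

text \<open>Regularising \<rho>^4 to \<rho>^4 + e leaves a strict subsolution outside the core \<rho>^4 < C0 e and an error of
  order e^(-r) inside. Strictness needs a power of \<rho>^4 + e more singular than the fundamental solution;
  here it is so little more singular that r < (2N+2-\<mu>)/4: the integral of \<rho>^(-\<mu>) over the core is of order
  e^((2N+2-\<mu>)/4), so the total error tends to 0 with e.\<close>

lemma singular_barrier:
  assumes "0 < \<mu>" "\<mu> < N" "0 < k"
  obtains r K C0 G0 B MB where
    "0 < r" "r < (2 * N + 2 - \<mu>) / 4" "0 < K" "0 < C0" "0 < G0"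
    "\<And>e. 0 < e \<Longrightarrow> e \<le> 1 \<Longrightarrow> radial_test N \<mu> (B e) (MB e)"
    "\<And>e p. 0 < e \<Longrightarrow> e \<le> 1 \<Longrightarrow> 0 \<le> fst p \<Longrightarrow> p \<noteq> 0 \<Longrightarrow> k * B e p - MB e p \<le> K * e powr - r"
    "\<And>e p. 0 < e \<Longrightarrow> e \<le> 1 \<Longrightarrow> 0 \<le> fst p \<Longrightarrow> p \<noteq> 0 \<Longrightarrow> C0 * e \<le> knorm4 p \<Longrightarrow> 2 * k * B e p \<le> MB e p"
    "\<And>e e' p. 0 < e \<Longrightarrow> e \<le> e' \<Longrightarrow> 0 \<le> fst p \<Longrightarrow> B e' p \<le> B e p"
    "\<And>p. 0 < knorm4 p \<Longrightarrow> knorm4 p < G0 \<Longrightarrow> 0 \<le> fst p \<Longrightarrow> \<exists>e. 0 < e \<and> e \<le> 1 \<and> C0 * e \<le> knorm4 p \<and> 0 < B e p"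
proof -
  \<comment> \<open>(N - \<mu>)/2 is the exponent of the fundamental solution, and any q - (N - \<mu>)/2 in (0, \<mu>/4) would do.\<close>
  define q where "q = (N - \<mu>) / 2 + \<mu> / 8"
  define \<kappa> where "\<kappa> = \<mu> / 4"
  define c where "c = 2 + N - \<mu>"
  define r where "r = q + 1/2"
  \<comment> \<open>The losses of the second summand are then covered by the gain 2 q \<kappa> of the first one.\<close>
  define a where "a = 2 * q * \<kappa> / (8 * \<mu> + 16 * r)"
  define C0 where "C0 = 2 * c / \<kappa> + 1"
  \<comment> \<open>For \<rho>^4 + e \<le> P1 the homogeneous gain dominates 2 k; the level m confines the barrier to this range.\<close>
  define P1 where "P1 = (2 * a * N / ((1 + a) * k))\<^sup>2"
  define m where "m = (1 + a) * P1 powr - q"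
  define H where "H = (\<lambda>e p. (knorm4 p + e) powr - q + a * (fst p * (knorm4 p + e) powr - r))"
  define K where "K = 8 * q * c + a * (8 * r * c + 16 * r) + k * (1 + a)"
  have q: "0 < q" "2 * q - N + \<mu> = \<kappa>" "2 * r - N + \<mu> = \<kappa> + 1"
    using assms by (simp add: q_def add_pos_pos) (simp add: q_def \<kappa>_def r_def field_simps)+
  have pos: "0 < \<kappa>" "0 < c" "0 < r" using assms q by (auto simp: \<kappa>_def c_def r_def)
  have a: "0 < a" "a * (8 * \<mu> + 16 * r) = 2 * q * \<kappa>"
    using assms q pos by (auto simp: a_def add_pos_pos)
  have C0: "1 \<le> C0" "0 < C0" "2 * c \<le> \<kappa> * C0" using pos by (auto simp: C0_def field_simps)
  have P1: "0 < P1" using assms a by (simp add: P1_def)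
  have m: "0 < m" using a P1 by (simp add: m_def)
  have "0 < 8 * q * c" "0 < a * (8 * r * c + 16 * r)" "0 < k * (1 + a)"
    using q pos a assms by (auto intro!: mult_pos_pos add_pos_pos)
  then have K: "0 < K" unfolding K_def by linarith

  have sqrtP: "\<bar>fst p\<bar> * (knorm4 p + e) powr - (1/2) \<le> 1" if "0 < e" for p :: "real \<times> real" and e
  proof -
    have P: "0 < knorm4 p + e" using that by (simp add: add_nonneg_pos)
    have "\<bar>fst p\<bar> \<le> sqrt (knorm4 p + e)"
      using knorm4_bounds(1)[of p] that by (intro real_le_rsqrt) auto
    then show ?thesis using P by (simp add: powr_minus powr_half_sqrt divide_simps)
  qed
  have r_split: "P powr - r = P powr - (1/2) * P powr - q" for P :: real
  proof -
    have "- r = - (1/2) + - q" by (simp add: r_def)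
    then show ?thesis by (simp only: powr_add)
  qed
  have Hle: "H e p \<le> (1 + a) * (knorm4 p + e) powr - q" if "0 < e" for e p
  proof -
    have "fst p * (knorm4 p + e) powr - r \<le> \<bar>fst p\<bar> * (knorm4 p + e) powr - (1/2) * (knorm4 p + e) powr - q"
      unfolding r_split mult.assoc[symmetric] by (intro mult_right_mono) auto
    also have "\<dots> \<le> 1 * (knorm4 p + e) powr - q" by (intro mult_right_mono sqrtP that) auto
    finally show ?thesis using a by (simp add: H_def algebra_simps)
  qed
  have supp: "H e p \<le> m" if "0 < e" "P1 \<le> knorm4 p" for e p
  proof -
    have "(knorm4 p + e) powr - q \<le> P1 powr - q"
      using that P1 q by (intro powr_mono2') auto
    then show ?thesis using Hle[OF that(1), of p] a by (smt (verit) m_def mult_left_mono)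
  qed
  have "\<exists>MF. radial_test N \<mu> (\<lambda>p. ramp (H e p - m)) MF \<and>
     (\<forall>p. 0 \<le> fst p \<longrightarrow> p \<noteq> 0 \<longrightarrow> k * ramp (H e p - m) - MF p \<le> K * e powr - r) \<and>
     (\<forall>p. 0 \<le> fst p \<longrightarrow> p \<noteq> 0 \<longrightarrow> C0 * e \<le> knorm4 p \<longrightarrow> 2 * k * ramp (H e p - m) \<le> MF p)"
    if e: "0 < e" "e \<le> 1" for e
  proof -
    obtain Fs Ft Fss Fst Ftt where C2: "C2_profile (H e) Fs Ft Fss Fst Ftt"
      and M: "\<And>p. p \<noteq> 0 \<Longrightarrow> cyl_op N \<mu> p (Fs p) (Ft p) (Fss p) (Ftt p) =
      8 * q * fst p * (knorm4 p + e) powr (- q - 2) * (\<kappa> * knorm4 p - c * e)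
      + a * ((knorm4 p + e) powr - r * (4 * N - 4 * \<mu> * (fst p)\<^sup>2 / knorm4 p)
           + 8 * r * (fst p)\<^sup>2 * (knorm4 p + e) powr (- r - 2) * ((\<kappa> + 1) * knorm4 p - c * e)
           - 16 * r * (fst p)\<^sup>2 * (knorm4 p + e) powr (- r - 1))"
      by (rule singular_profile[OF e(1), of q a])
         (auto simp: H_def r_def[symmetric] q(2) q(3)[symmetric] c_def[symmetric])
    obtain MF where MF: "radial_test N \<mu> (\<lambda>p. ramp (H e p - m)) MF"
       and MF_ge: "\<And>p. 0 \<le> fst p \<Longrightarrow> ramp' (H e p - m) * cyl_op N \<mu> p (Fs p) (Ft p) (Fss p) (Ftt p) \<le> MF p"
      by (rule truncated_profile[OF C2 less_imp_le[OF m] supp[OF e(1)], of P1 N \<mu>]) (assumption, rule that)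
    have est: "- (8 * q * c + a * (8 * r * c + 16 * r)) * e powr - r \<le> cyl_op N \<mu> p (Fs p) (Ft p) (Fss p) (Ftt p)"
      "C0 * e \<le> knorm4 p \<Longrightarrow> 4 * a * N * (knorm4 p + e) powr - r \<le> cyl_op N \<mu> p (Fs p) (Ft p) (Fss p) (Ftt p)"
      if s: "0 \<le> fst p" and p: "p \<noteq> 0" for p
    proof -
      have g: "0 < knorm4 p" using p by (simp add: knorm4_pos_iff)
      define P where "P = knorm4 p + e"
      define y where "y = fst p * P powr - (1/2)"
      define Y where "Y = P powr - r"
      \<comment> \<open>In the normalised quantities y, \<gamma>, \<epsilon> and Y both estimates become scale invariant.\<close>
      define \<gamma> where "\<gamma> = knorm4 p / P"
      define \<epsilon> where "\<epsilon> = e / P"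
      have P: "0 < P" "e \<le> P" using g e by (auto simp: P_def)
      have \<gamma>: "0 < \<gamma>" "\<gamma> \<le> 1" "0 < \<epsilon>" "\<epsilon> \<le> 1" "\<gamma> + \<epsilon> = 1"
        using P g e by (auto simp: \<gamma>_def \<epsilon>_def P_def add_divide_distrib[symmetric])
      have y: "0 \<le> y" "y \<le> 1" using s sqrtP[OF e(1), of p] by (auto simp: y_def P_def)
      have y2: "y\<^sup>2 \<le> y" "y\<^sup>2 \<le> 1" using y by (auto simp: power2_eq_square mult_left_le mult_le_one)
      have Y: "0 < Y" using P by (simp add: Y_def)
      have Yle: "Y \<le> e powr - r" unfolding Y_def using P e pos by (intro powr_mono2') auto
      have sy: "fst p = y * P powr (1/2)" using P by (simp add: y_def powr_add[symmetric] mult.assoc)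
      have sy2: "(fst p)\<^sup>2 = y\<^sup>2 * P"
        using P by (simp add: sy power_mult_distrib powr_half_sqrt)
      have e1: "fst p * P powr (- q - 2) = y * Y / P"
      proof -
        have "P powr (1/2) * P powr (- q - 2) = P powr - r * P powr (- 1)"
          unfolding powr_add[symmetric] by (simp add: r_def)
        then show ?thesis using P by (simp add: sy Y_def powr_minus_divide mult.assoc)
      qed
      have e2: "P powr (- r - 2) = Y / (P * P)" "P powr (- r - 1) = Y / P"
        using P by (simp_all add: Y_def powr_diff powr_numeral power2_eq_square)
      have eg: "P / knorm4 p = 1 / \<gamma>" by (simp add: \<gamma>_def)
      have M': "cyl_op N \<mu> p (Fs p) (Ft p) (Fss p) (Ftt p) =
        Y * (8 * q * y * (\<kappa> * \<gamma> - c * \<epsilon>) + a * (4 * N - 4 * \<mu> * y\<^sup>2 / \<gamma>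
           + 8 * r * y\<^sup>2 * ((\<kappa> + 1) * \<gamma> - c * \<epsilon>) - 16 * r * y\<^sup>2))"
      proof -
        have t1: "8 * q * fst p * P powr (- q - 2) * (\<kappa> * knorm4 p - c * e) = Y * (8 * q * y * (\<kappa> * \<gamma> - c * \<epsilon>))"
        proof -
          have "8 * q * fst p * P powr (- q - 2) * (\<kappa> * knorm4 p - c * e)
             = 8 * q * (fst p * P powr (- q - 2)) * (\<kappa> * knorm4 p - c * e)" by simp
          also have "\<dots> = Y * (8 * q * y * (\<kappa> * \<gamma> - c * \<epsilon>))"
            unfolding e1 \<gamma>_def \<epsilon>_def using P by (simp add: field_simps)
          finally show ?thesis .
        qed
        have t2: "P powr - r * (4 * N - 4 * \<mu> * (fst p)\<^sup>2 / knorm4 p) = Y * (4 * N - 4 * \<mu> * y\<^sup>2 / \<gamma>)"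
          unfolding sy2 Y_def[symmetric] \<gamma>_def using P g by simp
        have t3: "8 * r * (fst p)\<^sup>2 * P powr (- r - 2) * ((\<kappa> + 1) * knorm4 p - c * e)
           = Y * (8 * r * y\<^sup>2 * ((\<kappa> + 1) * \<gamma> - c * \<epsilon>))"
          unfolding sy2 e2 \<gamma>_def \<epsilon>_def using P by (simp add: field_simps)
        have t4: "16 * r * (fst p)\<^sup>2 * P powr (- r - 1) = Y * (16 * r * y\<^sup>2)"
          unfolding sy2 e2 using P by simp
        show ?thesis
          unfolding M[OF p] P_def[symmetric] t1 t2 t3 t4 by (simp add: algebra_simps)
      qed
      let ?V = "4 * N - 4 * \<mu> * y\<^sup>2 / \<gamma> + 8 * r * y\<^sup>2 * ((\<kappa> + 1) * \<gamma> - c * \<epsilon>) - 16 * r * y\<^sup>2"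
      have sg: "y\<^sup>2 / \<gamma> \<le> 1"
      proof -
        have "(fst p)\<^sup>2 / knorm4 p \<le> 1" using knorm4_bounds(1)[of p] g by simp
        then show ?thesis unfolding sy2 \<gamma>_def by simp
      qed
      show "- (8 * q * c + a * (8 * r * c + 16 * r)) * e powr - r \<le> cyl_op N \<mu> p (Fs p) (Ft p) (Fss p) (Ftt p)"
      proof -
        have "- (q * y * (c * \<epsilon>)) \<ge> - (q * 1 * (c * 1))"
          using q y pos \<gamma> by (intro le_imp_neg_le mult_mono) auto
        moreover have "0 \<le> q * y * (\<kappa> * \<gamma>)" using q y pos \<gamma> by simp
        ultimately have u1: "8 * q * y * (\<kappa> * \<gamma> - c * \<epsilon>) \<ge> - (8 * q * c)" by (simp add: algebra_simps)
        have "\<mu> * (y\<^sup>2 / \<gamma>) \<le> \<mu> * 1" using sg assms by (intro mult_left_mono) auto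
        then have u2: "4 * N - 4 * \<mu> * y\<^sup>2 / \<gamma> \<ge> 0" using assms by simp
        have "r * y\<^sup>2 * (c * \<epsilon>) \<le> r * 1 * (c * 1)"
          using y2 pos \<gamma> by (intro mult_mono) auto
        moreover have "0 \<le> r * y\<^sup>2 * ((\<kappa> + 1) * \<gamma>)" using pos \<gamma> by simp
        ultimately have u3: "8 * r * y\<^sup>2 * ((\<kappa> + 1) * \<gamma> - c * \<epsilon>) \<ge> - (8 * r * c)" by (simp add: algebra_simps)
        have u4: "r * y\<^sup>2 \<le> r" using y2 pos by simp
        have "a * (- (8 * r * c + 16 * r)) \<le> a * ?V"
        proof (intro mult_left_mono)
          show "- (8 * r * c + 16 * r) \<le> ?V"
            using u2 u3 u4 by linarith
        qed (use a in simp)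
        then have "- (8 * q * c + a * (8 * r * c + 16 * r)) \<le> 8 * q * y * (\<kappa> * \<gamma> - c * \<epsilon>) + a * ?V" using u1 unfolding mult_minus_right by linarith
        then have "Y * - (8 * q * c + a * (8 * r * c + 16 * r)) \<le> cyl_op N \<mu> p (Fs p) (Ft p) (Fss p) (Ftt p)"
          unfolding M' using Y by (intro mult_left_mono) auto
        moreover have "Y * (8 * q * c + a * (8 * r * c + 16 * r)) \<le> e powr - r * (8 * q * c + a * (8 * r * c + 16 * r))"
          using Yle q pos a by (intro mult_right_mono) auto
        ultimately show ?thesis unfolding mult_minus_right mult_minus_left mult.commute[of _ "e powr - r"] by linarith
      qed
      assume nc: "C0 * e \<le> knorm4 p"
      have nc': "C0 * \<epsilon> \<le> \<gamma>" using nc P by (simp add: \<gamma>_def \<epsilon>_def divide_right_mono)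
      have "1 * \<epsilon> \<le> C0 * \<epsilon>" using C0 \<gamma> by (intro mult_right_mono) auto
      then have "\<epsilon> \<le> \<gamma>" using nc' by simp
      then have \<gamma>2: "1/2 \<le> \<gamma>" using \<gamma> by simp
      have "2 * c * \<epsilon> \<le> \<kappa> * C0 * \<epsilon>" using C0 \<gamma> by (intro mult_right_mono) auto
      also have "\<dots> \<le> \<kappa> * \<gamma>" using nc' pos by simp
      finally have k1: "\<kappa> * \<gamma> - c * \<epsilon> \<ge> \<kappa> * \<gamma> / 2" by linarith
      have "\<kappa> * (1/2) \<le> \<kappa> * \<gamma>" using \<gamma>2 pos by (intro mult_left_mono) auto
      then have k2: "\<kappa> * \<gamma> - c * \<epsilon> \<ge> \<kappa> / 4" using k1 by linarith
      then have k3: "(\<kappa> + 1) * \<gamma> - c * \<epsilon> \<ge> 0" using pos \<gamma> by (simp add: algebra_simps)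
      have "q * y * (\<kappa> / 4) \<le> q * y * (\<kappa> * \<gamma> - c * \<epsilon>)" using k2 q y by (intro mult_left_mono) auto
      then have u1: "2 * q * \<kappa> * y \<le> 8 * q * y * (\<kappa> * \<gamma> - c * \<epsilon>)" by argo
      have "1 / \<gamma> \<le> 2" using \<gamma>2 by (simp add: divide_simps)
      then have "\<mu> * y\<^sup>2 * (1 / \<gamma>) \<le> \<mu> * y\<^sup>2 * 2" using assms by (intro mult_left_mono) auto
      then have u2: "4 * \<mu> * y\<^sup>2 / \<gamma> \<le> 8 * \<mu> * y\<^sup>2" by simp
      have u3: "0 \<le> 8 * r * y\<^sup>2 * ((\<kappa> + 1) * \<gamma> - c * \<epsilon>)" using k3 pos by simp
      have "4 * a * N - a * (8 * \<mu> + 16 * r) * y\<^sup>2 \<le> a * ?V"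
      proof -
        have "4 * N - (8 * \<mu> + 16 * r) * y\<^sup>2 \<le> ?V"
          using u2 u3 unfolding distrib_right by linarith
        from mult_left_mono[OF this, of a] show ?thesis using a(1) unfolding right_diff_distrib[of a "4 * N"] by (simp add: mult_ac)
      qed
      moreover have "a * (8 * \<mu> + 16 * r) * y\<^sup>2 \<le> 2 * q * \<kappa> * y"
        unfolding a(2) using y2 q pos by (intro mult_left_mono) auto
      ultimately have "4 * a * N \<le> 8 * q * y * (\<kappa> * \<gamma> - c * \<epsilon>) + a * ?V" using u1 by linarith
      from mult_left_mono[OF this, of Y]
      show "4 * a * N * (knorm4 p + e) powr - r \<le> cyl_op N \<mu> p (Fs p) (Ft p) (Fss p) (Ftt p)"
        unfolding M' P_def[symmetric] Y_def[symmetric] using Y by (simp add: mult.commute)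
    qed
    show ?thesis
    proof (intro exI[of _ MF] conjI MF allI impI)
      fix p :: "real \<times> real" assume s: "0 \<le> fst p" and p: "p \<noteq> 0"
      let ?M = "cyl_op N \<mu> p (Fs p) (Ft p) (Fss p) (Ftt p)" and ?K = "8 * q * c + a * (8 * r * c + 16 * r)"
      have P: "0 < knorm4 p + e" "e \<le> knorm4 p + e" using e by (auto simp: add_nonneg_pos)
      have H0: "0 \<le> H e p" using s a by (simp add: H_def)
      show "k * ramp (H e p - m) - MF p \<le> K * e powr - r"
      proof -
        have "H e p \<le> (1 + a) * (knorm4 p + e) powr - q" by (rule Hle[OF e(1)])
        also have "\<dots> \<le> (1 + a) * e powr - q"
          using P e q a by (intro mult_left_mono powr_mono2') auto
        also have "\<dots> \<le> (1 + a) * e powr - r"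
          using e a by (intro mult_left_mono powr_mono') (auto simp: r_def)
        finally have h: "H e p \<le> (1 + a) * e powr - r" .
        have "ramp (H e p - m) \<le> ramp' (H e p - m) * H e p"
          using ramp_le_ramp' m by simp
        also have "\<dots> \<le> 1 * H e p" using H0 ramp'_le_1 by (intro mult_right_mono) auto
        finally have "k * ramp (H e p - m) \<le> k * ((1 + a) * e powr - r)"
          using h assms by (intro mult_left_mono) auto
        moreover have "ramp' (H e p - m) * (?K * e powr - r) \<le> 1 * (?K * e powr - r)"
          using ramp'_le_1 q pos a by (intro mult_right_mono) auto
        moreover have "ramp' (H e p - m) * (- (?K * e powr - r)) \<le> ramp' (H e p - m) * ?M"
          using est(1)[OF s p] ramp_nonneg(2) by (intro mult_left_mono) (auto simp: algebra_simps)
        ultimately show ?thesis using MF_ge[OF s] by (simp add: K_def algebra_simps)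
      qed
      assume nc: "C0 * e \<le> knorm4 p"
      show "2 * k * ramp (H e p - m) \<le> MF p"
      proof (cases "P1 \<le> knorm4 p + e")
        case True
        have "(knorm4 p + e) powr - q \<le> P1 powr - q" using True P1 q by (intro powr_mono2') auto
        then have "H e p \<le> m" using Hle[OF e(1), of p] a by (smt (verit) m_def mult_left_mono)
        then have "ramp (H e p - m) = 0" "ramp' (H e p - m) = 0" by (auto simp: ramp_def ramp'_def)
        then show ?thesis using MF_ge[OF s] by simp
      next
        case False
        let ?P = "knorm4 p + e"
        have "?P powr (1/2) \<le> P1 powr (1/2)" using False P by (intro powr_mono2) auto
        also have "\<dots> = 2 * a * N / ((1 + a) * k)" using a assms P1 by (simp add: powr_half_sqrt P1_def)
        finally have "?P powr (1/2) * ((1 + a) * k) \<le> 2 * a * N"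
          using a assms by (simp add: pos_le_divide_eq)
        then have "2 * k * ((1 + a) * ?P powr (1/2)) \<le> 4 * a * N" by (simp add: mult_ac)
        from mult_right_mono[OF this, of "?P powr - r"]
        have "2 * k * ((1 + a) * (?P powr (1/2) * ?P powr - r)) \<le> 4 * a * N * ?P powr - r" by (simp add: mult_ac)
        moreover have "?P powr (1/2) * ?P powr - r = ?P powr - q"
          unfolding powr_add[symmetric] by (simp add: r_def)
        ultimately have "2 * k * ((1 + a) * ?P powr - q) \<le> ?M" using est(2)[OF s p nc] by (simp only:)
        moreover have "2 * k * H e p \<le> 2 * k * ((1 + a) * ?P powr - q)"
          using Hle[OF e(1)] assms by (intro mult_left_mono) auto
        ultimately have "2 * k * H e p \<le> ?M" by linarith
        then have "ramp' (H e p - m) * (2 * k * H e p) \<le> MF p"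
          using MF_ge[OF s] by (meson mult_left_mono order_trans ramp_nonneg(2))
        moreover have "2 * k * ramp (H e p - m) \<le> 2 * k * (ramp' (H e p - m) * H e p)"
          using ramp_le_ramp'[of m "H e p"] assms m by (intro mult_left_mono) auto
        ultimately show ?thesis by (simp add: mult_ac)
      qed
    qed
  qed
  then obtain MF where MF: "\<And>e. 0 < e \<Longrightarrow> e \<le> 1 \<Longrightarrow> radial_test N \<mu> (\<lambda>p. ramp (H e p - m)) (MF e) \<and>
     (\<forall>p. 0 \<le> fst p \<longrightarrow> p \<noteq> 0 \<longrightarrow> k * ramp (H e p - m) - MF e p \<le> K * e powr - r) \<and>
     (\<forall>p. 0 \<le> fst p \<longrightarrow> p \<noteq> 0 \<longrightarrow> C0 * e \<le> knorm4 p \<longrightarrow> 2 * k * ramp (H e p - m) \<le> MF e p)"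
    by metis
  define G0 where "G0 = m powr (- 1 / q)"
  have G0: "0 < G0" "G0 powr - q = m" using m q by (auto simp: G0_def powr_powr)
  show thesis
  proof (rule that[of r K C0 G0 "\<lambda>e p. ramp (H e p - m)" MF])
    show "r < (2 * N + 2 - \<mu>) / 4" using assms by (simp add: r_def q_def field_simps)
    show "ramp (H e' p - m) \<le> ramp (H e p - m)" if "0 < e" "e \<le> e'" "0 \<le> fst p" for e e' p
    proof (intro ramp_mono diff_right_mono)
      have "0 < knorm4 p + e" using that by (simp add: add_nonneg_pos)
      then show "H e' p \<le> H e p" unfolding H_def
        using that q pos a by (intro add_mono mult_left_mono powr_mono2') auto
    qed
    show "\<exists>e. 0 < e \<and> e \<le> 1 \<and> C0 * e \<le> knorm4 p \<and> 0 < ramp (H e p - m)"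
      if g: "0 < knorm4 p" "knorm4 p < G0" "0 \<le> fst p" for p
    proof -
      define e where "e = min 1 (min ((G0 - knorm4 p) / 2) (knorm4 p / C0))"
      have "0 < e" "e \<le> 1" and e2: "e \<le> (G0 - knorm4 p) / 2" "e \<le> knorm4 p / C0"
        using g C0 unfolding e_def by (auto simp only: min_def split: if_splits) auto
      have "C0 * e \<le> knorm4 p" using e2(2) C0 by (simp add: field_simps)
      have "knorm4 p + e < G0" using e2 g by simp
      then have "m < (knorm4 p + e) powr - q"
        unfolding G0(2)[symmetric] using g \<open>0 < e\<close> q by (intro powr_less_mono2_neg) auto
      also have "\<dots> \<le> H e p" using g a by (simp add: H_def)
      finally have "0 < ramp (H e p - m)" by (intro ramp_pos) simp
      then show ?thesis using \<open>0 < e\<close> \<open>e \<le> 1\<close> \<open>C0 * e \<le> knorm4 p\<close> by blast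
    qed
  qed (use pos K C0 G0 MF in auto)
qed

section \<open>Supersolutions bounded by a multiple of the Koranyi norm to the power \<mu>\<close>

text \<open>The dyadic shell around 0 that contains a given positive number.\<close>

lemma dyadic_scale:
  assumes "0 < g" "g < (r::real)"
  obtains j :: nat where "r / 2 ^ (j + 1) \<le> g" "g < r / 2 ^ j"
proof -
  define P where "P = (\<lambda>j::nat. r / 2 ^ j \<le> g)"
  obtain n :: nat where "r / g < 2 ^ n" using real_arch_pow[of 2 "r / g"] by auto
  then have "P n" using assms by (simp add: P_def field_simps)
  define m where "m = (LEAST j. P j)"
  have Pm: "P m" unfolding m_def using \<open>P n\<close> by (rule LeastI)
  have "\<not> P 0" using assms by (simp add: P_def)
  then have "m \<noteq> 0" using Pm by metis
  then obtain j where j: "m = Suc j" by (cases m) auto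
  have "\<not> P j" using not_less_Least[of j P] j m_def by simp
  then show thesis using that[of j] Pm j by (simp add: P_def)
qed

text \<open>On the dyadic shell of radius 2^(-j) r the integrand is at most a constant times (2^(-j) r)^(-b) and
  the volume at most C (2^(-j) r)^d; the products are summable because b < d.\<close>

lemma nn_integral_negative_power:
  fixes g :: "'b \<Rightarrow> real"
  assumes g [measurable]: "g \<in> borel_measurable M" and pos: "AE z in M. 0 < g z"
    and vol: "\<And>r. 0 < r \<Longrightarrow> emeasure M {z \<in> space M. g z < r} \<le> ennreal (C * r powr d)"
    and "0 \<le> C" "0 < b" "b < d"
  obtains C' where "0 \<le> C'" "\<And>r. 0 < r \<Longrightarrow>
     (\<integral>\<^sup>+z. ennreal (g z powr - b) * indicator {z. g z < r} z \<partial>M) \<le> ennreal (C' * r powr (d - b))"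
proof -
  define \<rho> where "\<rho> = 2 powr (- (d - b))"
  have \<rho>: "0 \<le> \<rho>" "\<rho> < 1" using assms by (auto simp: \<rho>_def powr_less_one)
  define C' where "C' = C * 2 powr b / (1 - \<rho>)"
  show thesis
  proof
    show "0 \<le> C'" using assms \<rho> by (simp add: C'_def)
    fix r :: real assume r: "0 < r"
    define a where "a = (\<lambda>j::nat. (r / 2 ^ (j + 1)) powr - b)"
    have "(\<integral>\<^sup>+z. ennreal (g z powr - b) * indicator {z. g z < r} z \<partial>M)
      \<le> (\<integral>\<^sup>+z. (\<Sum>j. ennreal (a j) * indicator {z \<in> space M. g z < r / 2 ^ j} z) \<partial>M)"
    proof (rule nn_integral_mono_AE, use pos AE_space in eventually_elim, goal_cases)
      case (1 z)
      show ?case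
      proof (cases "g z < r")
        case True
        then obtain j where j: "r / 2 ^ (j + 1) \<le> g z" "g z < r / 2 ^ j"
          using dyadic_scale[OF 1(1)] by metis
        define f where "f = (\<lambda>j. ennreal (a j) * indicator {z \<in> space M. g z < r / 2 ^ j} z)"
        have "g z powr - b \<le> a j"
          unfolding a_def using j r assms by (intro powr_mono2') auto
        then have "ennreal (g z powr - b) * indicator {z. g z < r} z \<le> f j"
          using True 1 j by (auto simp: f_def intro: ennreal_leI)
        also have "f j \<le> suminf f"
          using sum_le_suminf[OF summableI, of "{j}" f] by simp
        finally show ?thesis by (simp add: f_def)
      qed simp
    qed
    also have "\<dots> = (\<Sum>j. \<integral>\<^sup>+z. ennreal (a j) * indicator {z \<in> space M. g z < r / 2 ^ j} z \<partial>M)"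
      by (rule nn_integral_suminf) measurable
    also have "\<dots> = (\<Sum>j. ennreal (a j) * emeasure M {z \<in> space M. g z < r / 2 ^ j})"
      by (intro suminf_cong nn_integral_cmult_indicator) measurable
    also have "\<dots> \<le> (\<Sum>j. ennreal (C * 2 powr b * r powr (d - b) * \<rho> ^ j))"
    proof (rule suminf_le)
      fix j :: nat
      have "ennreal (a j) * emeasure M {z \<in> space M. g z < r / 2 ^ j} \<le> ennreal (a j) * ennreal (C * (r / 2 ^ j) powr d)"
        using r by (intro mult_left_mono vol) auto
      also have "\<dots> = ennreal (a j * (C * (r / 2 ^ j) powr d))" using assms by (simp add: a_def ennreal_mult)
      also have "a j * (C * (r / 2 ^ j) powr d) = C * 2 powr b * r powr (d - b) * \<rho> ^ j"
      proof -
        have "\<rho> ^ j = (2 ^ j) powr (- (d - b))"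
          by (simp add: \<rho>_def powr_powr powr_realpow[symmetric] mult.commute)
        also have "\<dots> = (2 ^ j) powr b * (2 ^ j) powr - d" by (simp add: powr_add[symmetric])
        finally have e: "\<rho> ^ j = (2 ^ j) powr b * (2 ^ j) powr - d" .
        have "r powr (d - b) = r powr d * r powr - b" by (simp add: powr_add[symmetric])
        then show ?thesis unfolding e a_def using r
          by (simp add: powr_divide powr_mult powr_minus_divide)
      qed
      finally show "ennreal (a j) * emeasure M {z \<in> space M. g z < r / 2 ^ j} \<le> ennreal (C * 2 powr b * r powr (d - b) * \<rho> ^ j)" .
    qed auto
    also have "\<dots> = ennreal (\<Sum>j. C * 2 powr b * r powr (d - b) * \<rho> ^ j)"
      using \<rho> assms by (intro suminf_ennreal2 summable_mult summable_geometric) auto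
    also have "(\<Sum>j. C * 2 powr b * r powr (d - b) * \<rho> ^ j) = C * 2 powr b * r powr (d - b) * (1 / (1 - \<rho>))"
      using \<rho> by (simp add: suminf_mult suminf_geometric summable_geometric)
    also have "\<dots> = C' * r powr (d - b)" by (simp add: C'_def)
    finally show "(\<integral>\<^sup>+z. ennreal (g z powr - b) * indicator {z. g z < r} z \<partial>M) \<le> ennreal (C' * r powr (d - b))" .
  qed
qed

lemma AE_zero_of_vanishing_bound:
  fixes J :: "'b \<Rightarrow> real" and b :: "'c \<Rightarrow> real"
  assumes "J \<in> borel_measurable M" "AE z in M. 0 \<le> J z" "F \<noteq> bot" "(b \<longlongrightarrow> 0) F"
    and "\<forall>\<^sub>F e in F. (\<integral>\<^sup>+z. ennreal (J z) \<partial>M) \<le> ennreal (b e)"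
  shows "AE z in M. J z = 0"
proof -
  have "((\<lambda>e. ennreal (b e)) \<longlongrightarrow> ennreal 0) F" using assms(4) by (rule tendsto_ennrealI)
  then have "(\<integral>\<^sup>+z. ennreal (J z) \<partial>M) \<le> ennreal 0"
    using assms(5,3) by (rule tendsto_lowerbound)
  then have "AE z in M. ennreal (J z) = 0"
    using assms(1) by (subst nn_integral_0_iff_AE[symmetric]) auto
  then show ?thesis using assms(2) by eventually_elim simp
qed

text \<open>Tested with the singular barrier, the supersolution inequality bounds the integral of \<rho>^(-2\<mu>) V
  times the barrier outside the core by a multiple of e^(-r) times the integral of \<rho>^(-2\<mu>) V over
  the core. The bound V \<le> C0 \<rho>^\<mu> makes this tend to 0 with e, so V vanishes near the origin. The
  spreading barrier has its only bad region inside the set where V is already known to vanish.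
  The statement is about a map p from an arbitrary measure space into the cylindrical half-plane, so
  that it covers both a function on the group and a solution on space-time, the latter without
  integrating out the time variable first.\<close>

lemma weighted_supersolution_vanishes:
  fixes V :: "'b \<Rightarrow> real" and p :: "'b \<Rightarrow> real \<times> real"
  assumes \<mu>: "0 < \<mu>" "\<mu> < N" and k: "0 < k"
    and p [measurable]: "p \<in> borel_measurable M" and p0: "\<And>z. 0 \<le> fst (p z)" "AE z in M. p z \<noteq> 0"
    and V [measurable]: "V \<in> borel_measurable M" and V0: "AE z in M. 0 \<le> V z"
    and Vb: "AE z in M. V z \<le> C0 * knorm4 (p z) powr (\<mu> / 4)"
    and vol: "\<And>r. 0 < r \<Longrightarrow> emeasure M {z \<in> space M. knorm4 (p z) < r} \<le> ennreal (C1 * r powr ((2 * N + 2) / 4))"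
    and C: "0 \<le> C0" "0 \<le> C1"
    and test: "\<And>F MF. radial_test N \<mu> F MF \<Longrightarrow>
       integrable M (\<lambda>z. V z * knorm4 (p z) powr (- \<mu> / 2) * (k * F (p z) - MF (p z))) \<and>
       0 \<le> (LINT z|M. V z * knorm4 (p z) powr (- \<mu> / 2) * (k * F (p z) - MF (p z)))"
  shows "AE z in M. V z = 0"
proof -
  define \<omega> where "\<omega> = (\<lambda>z. knorm4 (p z) powr (- \<mu> / 2))"
  have kg [measurable]: "knorm4 \<in> borel_measurable borel"
    by (rule borel_measurable_continuous_onI[OF continuous_on_knorm4])
  have \<omega> [measurable]: "\<omega> \<in> borel_measurable M" unfolding \<omega>_def by measurable
  have gpos: "AE z in M. 0 < knorm4 (p z)" using p0(2) by eventually_elim (simp add: knorm4_pos_iff)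
  define d where "d = (2 * N + 2 - \<mu>) / 4"
  obtain C2 where C2: "0 \<le> C2" "\<And>r. 0 < r \<Longrightarrow>
     (\<integral>\<^sup>+z. ennreal (knorm4 (p z) powr - (\<mu> / 4)) * indicator {z. knorm4 (p z) < r} z \<partial>M)
     \<le> ennreal (C2 * r powr ((2 * N + 2) / 4 - \<mu> / 4))"
    by (rule nn_integral_negative_power[OF _ gpos vol C(2), of "\<mu> / 4"]) (use \<mu> in \<open>auto simp: field_simps\<close>)
  have core: "(\<integral>\<^sup>+z. ennreal (V z * \<omega> z * indicator {z. knorm4 (p z) < r} z) \<partial>M) \<le> ennreal (C0 * C2 * r powr d)"
    if "0 < r" for r
  proof -
    have "(\<integral>\<^sup>+z. ennreal (V z * \<omega> z * indicator {z. knorm4 (p z) < r} z) \<partial>M)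
      \<le> (\<integral>\<^sup>+z. ennreal C0 * (ennreal (knorm4 (p z) powr - (\<mu> / 4)) * indicator {z. knorm4 (p z) < r} z) \<partial>M)"
    proof (rule nn_integral_mono_AE, use V0 Vb gpos in eventually_elim, goal_cases)
      case (1 z)
      have "V z * \<omega> z \<le> C0 * knorm4 (p z) powr (\<mu> / 4) * \<omega> z"
        using 1 by (intro mult_right_mono) (auto simp: \<omega>_def)
      also have "\<dots> = C0 * knorm4 (p z) powr - (\<mu> / 4)" by (simp add: \<omega>_def powr_add[symmetric])
      finally have le: "V z * \<omega> z \<le> C0 * knorm4 (p z) powr - (\<mu> / 4)" .
      show ?case
      proof (cases "knorm4 (p z) < r")
        case True
        then show ?thesis using le C by (simp add: ennreal_mult[symmetric] ennreal_leI)
      qed simp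
    qed
    also have "\<dots> = ennreal C0 * (\<integral>\<^sup>+z. ennreal (knorm4 (p z) powr - (\<mu> / 4)) * indicator {z. knorm4 (p z) < r} z \<partial>M)"
      by (rule nn_integral_cmult) measurable
    also have "\<dots> \<le> ennreal C0 * ennreal (C2 * r powr d)"
      using C2(2)[OF that] by (intro mult_left_mono) (simp_all add: d_def diff_divide_distrib)
    finally show ?thesis using C C2 by (simp add: ennreal_mult mult.assoc)
  qed
  have Jint: "integrable M (\<lambda>z. V z * \<omega> z * indicator {z. knorm4 (p z) < r} z)"
    and Jle: "(LINT z|M. V z * \<omega> z * indicator {z. knorm4 (p z) < r} z) \<le> C0 * C2 * r powr d"
    if r: "0 < r" for r
  proof -
    have nn: "AE z in M. 0 \<le> V z * \<omega> z * indicator {z. knorm4 (p z) < r} z"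
      using V0 by eventually_elim (auto simp: \<omega>_def)
    show i: "integrable M (\<lambda>z. V z * \<omega> z * indicator {z. knorm4 (p z) < r} z)"
      by (rule integrableI_nonneg[OF _ nn]) (use core[OF r] in \<open>auto simp: le_less_trans ennreal_less_top\<close>)
    have "ennreal (LINT z|M. V z * \<omega> z * indicator {z. knorm4 (p z) < r} z) \<le> ennreal (C0 * C2 * r powr d)"
      using core[OF r] nn_integral_eq_integral[OF i nn] by simp
    then show "(LINT z|M. V z * \<omega> z * indicator {z. knorm4 (p z) < r} z) \<le> C0 * C2 * r powr d"
      using C C2 by (simp add: ennreal_le_iff)
  qed
  obtain r K c0 G0 B MB where
    par: "0 < r" "r < d" "0 < K" "0 < c0" "0 < G0"
    and rt: "\<And>e. 0 < e \<Longrightarrow> e \<le> 1 \<Longrightarrow> radial_test N \<mu> (B e) (MB e)"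
    and inn: "\<And>e p. 0 < e \<Longrightarrow> e \<le> 1 \<Longrightarrow> 0 \<le> fst p \<Longrightarrow> p \<noteq> 0 \<Longrightarrow> k * B e p - MB e p \<le> K * e powr - r"
    and out: "\<And>e p. 0 < e \<Longrightarrow> e \<le> 1 \<Longrightarrow> 0 \<le> fst p \<Longrightarrow> p \<noteq> 0 \<Longrightarrow> c0 * e \<le> knorm4 p \<Longrightarrow> 2 * k * B e p \<le> MB e p"
    and mono: "\<And>e e' p. 0 < e \<Longrightarrow> e \<le> e' \<Longrightarrow> 0 \<le> fst p \<Longrightarrow> B e' p \<le> B e p"
    and posB: "\<And>p. 0 < knorm4 p \<Longrightarrow> knorm4 p < G0 \<Longrightarrow> 0 \<le> fst p \<Longrightarrow> \<exists>e. 0 < e \<and> e \<le> 1 \<and> c0 * e \<le> knorm4 p \<and> 0 < B e p"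
    by (rule singular_barrier[OF \<mu> k, folded d_def]) (rule that)
  have Bmeas [measurable]: "B e \<in> borel_measurable borel" if "0 < e" "e \<le> 1" for e
    by (rule radial_testD[OF rt[OF that]]) (blast intro: borel_measurable_continuous_onI C2_profile_continuous)
  have Bnn: "0 \<le> B e q" if "0 < e" "e \<le> 1" for e q
    by (rule radial_test_nonneg[OF rt[OF that]])
  \<comment> \<open>The part outside the core of the integral that the barrier controls.\<close>
  define J0 where "J0 = (\<lambda>e z. V z * \<omega> z * (k * B e (p z)) * indicator {z. c0 * e \<le> knorm4 (p z)} z)"
  have J0nn: "AE z in M. 0 \<le> J0 e z" if "0 < e" "e \<le> 1" for e
    using V0 by eventually_elim (use Bnn[OF that] k in \<open>auto simp: J0_def \<omega>_def\<close>)
  have J0meas [measurable]: "J0 e \<in> borel_measurable M" if "0 < e" "e \<le> 1" for e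
  proof -
    note Bmeas[OF that, measurable]
    show ?thesis unfolding J0_def by measurable
  qed
  have J0le: "(\<integral>\<^sup>+z. ennreal (J0 e z) \<partial>M) \<le> ennreal (K * e powr - r * (C0 * C2 * (c0 * e) powr d))"
    if e: "0 < e" "e \<le> 1" for e
  proof -
    define I where "I = (\<lambda>z. V z * \<omega> z * (k * B e (p z) - MB e (p z)))"
    define X where "X = (\<lambda>z. K * e powr - r * (V z * \<omega> z * indicator {z. knorm4 (p z) < c0 * e} z))"
    have I: "integrable M I" "0 \<le> (LINT z|M. I z)"
      using test[OF rt[OF e]] by (auto simp: I_def \<omega>_def)
    have ce: "0 < c0 * e" using par e by simp
    have X: "integrable M X" unfolding X_def by (intro integrable_mult_right Jint ce)
    have le: "AE z in M. J0 e z \<le> X z - I z"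
      using V0 p0(2)
    proof eventually_elim
      case (elim z)
      have w: "0 \<le> V z * \<omega> z" using elim by (simp add: \<omega>_def)
      show ?case
      proof (cases "knorm4 (p z) < c0 * e")
        case True
        have "V z * \<omega> z * (k * B e (p z) - MB e (p z)) \<le> V z * \<omega> z * (K * e powr - r)"
          using inn[OF e p0(1) elim(2)] w by (intro mult_left_mono) auto
        then show ?thesis using True by (simp add: J0_def X_def I_def mult_ac)
      next
        case False
        have "V z * \<omega> z * (k * B e (p z)) \<le> V z * \<omega> z * (MB e (p z) - k * B e (p z))"
          using out[OF e p0(1) elim(2)] False w by (intro mult_left_mono) auto
        then show ?thesis using False by (simp add: J0_def X_def I_def algebra_simps)
      qed
    qed
    have "(\<integral>\<^sup>+z. ennreal (J0 e z) \<partial>M) \<le> (\<integral>\<^sup>+z. ennreal (X z - I z) \<partial>M)"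
      by (rule nn_integral_mono_AE) (use le in eventually_elim, auto intro: ennreal_leI)
    also have "\<dots> = ennreal (LINT z|M. X z - I z)"
    proof (rule nn_integral_eq_integral)
      show "AE z in M. 0 \<le> X z - I z" using le J0nn[OF e] by eventually_elim linarith
    qed (use X I in auto)
    also have "(LINT z|M. X z - I z) \<le> K * e powr - r * (C0 * C2 * (c0 * e) powr d)"
    proof -
      have "(LINT z|M. X z - I z) \<le> (LINT z|M. X z)" using X I by simp
      also have "\<dots> = K * e powr - r * (LINT z|M. V z * \<omega> z * indicator {z. knorm4 (p z) < c0 * e} z)"
        by (simp add: X_def)
      also have "\<dots> \<le> K * e powr - r * (C0 * C2 * (c0 * e) powr d)"
        using par by (intro mult_left_mono Jle ce) auto
      finally show ?thesis .
    qed
    finally show ?thesis by (simp add: ennreal_leI)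
  qed
  \<comment> \<open>The barriers increase as e decreases, so the bound for e' \<le> e also bounds J0 e.\<close>
  have J00: "AE z in M. J0 e z = 0" if e: "0 < e" "e \<le> 1" for e
  proof -
    define A where "A = K * C0 * C2 * c0 powr d"
    have le: "(\<integral>\<^sup>+z. ennreal (J0 e z) \<partial>M) \<le> ennreal (A * e' powr (d - r))" if e': "0 < e'" "e' \<le> e" for e'
    proof -
      have "(\<integral>\<^sup>+z. ennreal (J0 e z) \<partial>M) \<le> (\<integral>\<^sup>+z. ennreal (J0 e' z) \<partial>M)"
      proof (rule nn_integral_mono_AE, use V0 in eventually_elim, rule ennreal_leI)
        fix z assume "0 \<le> V z"
        moreover have "c0 * e' \<le> c0 * e" using e' par by simp
        then have "indicator {z. c0 * e \<le> knorm4 (p z)} z \<le> (indicator {z. c0 * e' \<le> knorm4 (p z)} z :: real)"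
          by (auto simp: indicator_def)
        ultimately show "J0 e z \<le> J0 e' z"
          unfolding J0_def using mono[OF e' p0(1), of z] Bnn[of e' "p z"] Bnn[of e "p z"] e e' k
          by (intro mult_mono mult_nonneg_nonneg) (auto simp: \<omega>_def)
      qed
      also have "\<dots> \<le> ennreal (K * e' powr - r * (C0 * C2 * (c0 * e') powr d))"
        using e e' by (intro J0le) auto
      also have "K * e' powr - r * (C0 * C2 * (c0 * e') powr d) = A * e' powr (d - r)"
        using e' par by (simp add: A_def powr_mult powr_diff powr_minus_divide)
      finally show ?thesis .
    qed
    have "((\<lambda>e'. e' powr (d - r)) \<longlongrightarrow> 0 powr (d - r)) (at_right (0::real))"
      using par by (intro tendsto_powr' tendsto_const tendsto_ident_at) (auto simp: eventually_at_right_field intro!: exI[of _ 1])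
    then have "((\<lambda>e'. A * e' powr (d - r)) \<longlongrightarrow> A * 0) (at_right 0)"
      by (intro tendsto_mult tendsto_const) simp
    then have lim: "((\<lambda>e'. A * e' powr (d - r)) \<longlongrightarrow> 0) (at_right 0)" by simp
    show ?thesis
    proof (rule AE_zero_of_vanishing_bound[OF J0meas[OF e] J0nn[OF e] _ lim])
      show "\<forall>\<^sub>F e' in at_right 0. (\<integral>\<^sup>+z. ennreal (J0 e z) \<partial>M) \<le> ennreal (A * e' powr (d - r))"
        unfolding eventually_at_right_field using e by (intro exI[of _ e]) (auto intro: le)
    qed simp
  qed
  have "AE z in M. \<forall>n::nat. J0 (1 / Suc n) z = 0"
    unfolding AE_all_countable by (intro allI J00) auto
  then have near: "AE z in M. knorm4 (p z) < G0 \<longrightarrow> V z = 0"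
    using gpos
  proof eventually_elim
    case (elim z)
    show ?case
    proof
      assume "knorm4 (p z) < G0"
      then obtain e where e: "0 < e" "e \<le> 1" "c0 * e \<le> knorm4 (p z)" "0 < B e (p z)"
        using posB[OF elim(2) _ p0(1)] by blast
      obtain n where n: "1 / real (Suc n) < e" using nat_approx_posE[OF e(1)] by metis
      have "0 < B (1 / Suc n) (p z)" using mono[of "1 / Suc n" e "p z"] n p0(1)[of z] e by simp
      moreover have "c0 * (1 / Suc n) \<le> knorm4 (p z)"
        using e(3) par n mult_left_mono[of "1 / Suc n" e c0] by linarith
      ultimately have "V z * \<omega> z * (k * B (1 / Suc n) (p z)) = 0"
        using elim(1)[rule_format, of n] by (simp add: J0_def)
      then show "V z = 0" using \<open>0 < B (1 / Suc n) (p z)\<close> k elim(2) by (simp add: \<omega>_def)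
    qed
  qed
  \<comment> \<open>The disc of radius c/2 about (c, 0) lies in the region where V is already known to vanish.\<close>
  define c where "c = sqrt G0 / 2"
  have c: "0 < c" "c\<^sup>2 = G0 / 4" using par by (auto simp: c_def power_divide)
  have "AE z in M. knorm4 (p z) \<le> real n \<longrightarrow> V z = 0" for n :: nat
  proof -
    obtain F MF where F: "radial_test N \<mu> F MF"
      and sub: "\<And>q. 0 \<le> fst q \<Longrightarrow> q \<noteq> 0 \<Longrightarrow> (c / 2)\<^sup>2 \<le> (fst q - c)\<^sup>2 + (snd q)\<^sup>2 \<Longrightarrow> 2 * k * F q \<le> MF q"
      and Fpos: "\<And>q. knorm4 q \<le> real n \<Longrightarrow> 0 < F q"
      using spreading_barrier[OF \<mu> k c(1), of "c / 2" "real n"] c(1) by (metis half_gt_zero)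
    have Fnn: "0 \<le> F q" for q by (rule radial_test_nonneg[OF F])
    define I where "I = (\<lambda>z. V z * \<omega> z * (k * F (p z) - MF (p z)))"
    have I: "integrable M I" "0 \<le> (LINT z|M. I z)"
      using test[OF F] by (auto simp: I_def \<omega>_def)
    have le: "AE z in M. V z * \<omega> z * (k * F (p z)) \<le> - I z \<and> 0 \<le> V z * \<omega> z * (k * F (p z))"
      using V0 p0(2) near
    proof eventually_elim
      case (elim z)
      have w: "0 \<le> V z * \<omega> z" using elim by (simp add: \<omega>_def)
      show ?case
      proof (cases "(c / 2)\<^sup>2 \<le> (fst (p z) - c)\<^sup>2 + (snd (p z))\<^sup>2")
        case True
        have "V z * \<omega> z * (k * F (p z)) \<le> V z * \<omega> z * (MF (p z) - k * F (p z))"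
          using sub[OF p0(1) elim(2) True] w by (intro mult_left_mono) auto
        moreover have "0 \<le> V z * \<omega> z * (k * F (p z))" using w k Fnn[of "p z"] by simp
        ultimately show ?thesis by (simp add: I_def right_diff_distrib)
      next
        case False
        have "0 \<le> (fst (p z) - 2 * c)\<^sup>2 + (snd (p z))\<^sup>2" by simp
        then have "knorm4 (p z) \<le> 2 * ((fst (p z) - c)\<^sup>2 + (snd (p z))\<^sup>2) + 2 * c\<^sup>2"
          by (simp add: knorm4_def power2_eq_square algebra_simps)
        also have "\<dots> < G0" using False c par by (simp add: power_divide)
        finally show ?thesis using elim by (simp add: I_def)
      qed
    qed
    have "(LINT z|M. - I z) = 0 \<longleftrightarrow> (AE z in M. - I z = 0)"
      by (rule integral_nonneg_eq_0_iff_AE) (use I le in \<open>auto elim: eventually_mono\<close>)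
    moreover have "0 \<le> (LINT z|M. - I z)"
      by (rule integral_nonneg_AE) (use le in \<open>auto elim: eventually_mono\<close>)
    ultimately have "AE z in M. I z = 0" using I by simp
    then show ?thesis using le gpos
    proof eventually_elim
      case (elim z)
      then have "V z * \<omega> z * (k * F (p z)) = 0" by linarith
      then show ?case using elim(3) Fpos[of "p z"] k by (auto simp: \<omega>_def)
    qed
  qed
  then have "AE z in M. \<forall>n::nat. knorm4 (p z) \<le> real n \<longrightarrow> V z = 0"
    unfolding AE_all_countable by blast
  then show ?thesis
    by eventually_elim (meson real_arch_simple)
qed

section \<open>Volumes, null sets and product integrals\<close>

lemma emeasure_cube:
  assumes "0 \<le> r"
  shows "emeasure lborel (cbox (\<chi> i. - r) (\<chi> i. r) :: (real ^ 'n::finite) set) = ennreal ((2 * r) ^ CARD('n))"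
proof -
  have b: "((\<chi> i. c) :: real ^ 'n) \<bullet> b = c" if "b \<in> Basis" for b :: "real ^ 'n" and c :: real
    using that by (auto simp: Basis_vec_def inner_axis)
  have "emeasure lborel (cbox (\<chi> i. - r) (\<chi> i. r) :: (real ^ 'n) set)
     = ennreal (\<Prod>b\<in>(Basis :: (real ^ 'n) set). ((\<chi> i. r) - (\<chi> i. - r)) \<bullet> b)"
    using assms by (intro emeasure_lborel_cbox) (simp add: b)
  also have "(\<Prod>b\<in>(Basis :: (real ^ 'n) set). ((\<chi> i. r) - (\<chi> i. - r)) \<bullet> b) = (2 * r) ^ CARD('n)"
    by (simp add: inner_diff_left b)
  finally show ?thesis .
qed

lemma emeasure_lborel_Times:
  fixes A :: "'a::euclidean_space set" and B :: "'b::euclidean_space set"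
  assumes "A \<in> sets borel" "B \<in> sets borel"
  shows "emeasure lborel (A \<times> B) = emeasure lborel A * emeasure lborel B"
  using assms by (subst lborel_prod[symmetric]) (simp add: lborel.emeasure_pair_measure_Times)

text \<open>A box with sides of order r^(1/4) in the horizontal and r^(1/2) in the vertical directions. Its
  volume is of order r^((2N+2)/4) = r^(Q/4), the order of the volume of the ball \<rho>^4 < r inside it.\<close>

definition koranyi_box :: "real \<Rightarrow> 'n::finite heis set" where
  "koranyi_box r = cbox (\<chi> i. - (r powr (1/4))) (\<chi> i. r powr (1/4)) \<times>
     (cbox (\<chi> i. - (r powr (1/4))) (\<chi> i. r powr (1/4)) \<times> {- (r powr (1/2)) .. r powr (1/2)})"

lemma koranyi_box_borel [measurable]: "koranyi_box r \<in> sets borel"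
  unfolding koranyi_box_def by (intro borel_closed closed_Times) auto

lemma emeasure_koranyi_box:
  assumes "0 < r"
  shows "emeasure lborel (koranyi_box r :: 'n::finite heis set)
    = ennreal (2 ^ (2 * CARD('n) + 1) * r powr ((2 * real CARD('n) + 2) / 4))"
proof -
  have P2: "2 ^ (2 * m + 1) = (2 * (2 ^ m * 2 ^ m) :: real)" for m
    by (induction m) auto
  have M: "ennreal a * (ennreal b * ennreal c) = ennreal (a * (b * c))" if "0 \<le> a" "0 \<le> b" "0 \<le> c" for a b c
    by (simp only: ennreal_mult[OF that(1) mult_nonneg_nonneg[OF that(2,3)]] ennreal_mult[OF that(2,3)])
  have A: "cbox (\<chi> i. - (r powr (1/4))) (\<chi> i. r powr (1/4)) \<in> sets (borel :: (real ^ 'n) measure)"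
    and C: "{- (r powr (1/2)) .. r powr (1/2)} \<in> sets (borel :: real measure)" by auto
  have B: "cbox (\<chi> i. - (r powr (1/4))) (\<chi> i. r powr (1/4)) \<times> {- (r powr (1/2)) .. r powr (1/2)}
     \<in> sets (borel :: ((real ^ 'n) \<times> real) measure)"
    by (intro borel_closed closed_Times) auto
  have "emeasure lborel (koranyi_box r :: 'n heis set)
    = ennreal ((2 * r powr (1/4)) ^ CARD('n)) * (ennreal ((2 * r powr (1/4)) ^ CARD('n)) * ennreal (2 * r powr (1/2)))"
    unfolding koranyi_box_def emeasure_lborel_Times[OF A B] emeasure_lborel_Times[OF A C]
      emeasure_cube[OF powr_ge_zero] by simp
  also have "\<dots> = ennreal ((2 * r powr (1/4)) ^ CARD('n) * ((2 * r powr (1/4)) ^ CARD('n) * (2 * r powr (1/2))))"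
    by (rule M) auto
  also have "(2 * r powr (1/4)) ^ CARD('n) * ((2 * r powr (1/4)) ^ CARD('n) * (2 * r powr (1/2)))
      = 2 ^ (2 * CARD('n) + 1) * ((r powr (1/4)) ^ CARD('n) * (r powr (1/4)) ^ CARD('n) * r powr (1/2))"
    unfolding P2 by (simp only: power_mult_distrib mult_ac)
  also have "(r powr (1/4)) ^ CARD('n) = r powr (real CARD('n) / 4)"
    using assms by (simp add: powr_realpow[symmetric] powr_powr)
  also have "r powr (real CARD('n) / 4) * r powr (real CARD('n) / 4) * r powr (1/2)
      = r powr ((2 * real CARD('n) + 2) / 4)"
  proof -
    have "(2 * real CARD('n) + 2) / 4 = real CARD('n) / 4 + real CARD('n) / 4 + 1/2" by simp
    then show ?thesis by (simp only: powr_add)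
  qed
  finally show ?thesis .
qed

lemma koranyi_ball_subset_box:
  assumes "0 < r"
  shows "{\<xi>. knorm4 (cyl \<xi>) < r} \<subseteq> (koranyi_box r :: 'n::finite heis set)"
proof (clarify)
  fix x y :: "real ^ 'n" and w :: real
  let ?q = "cyl (x, y, w)"
  assume g: "knorm4 ?q < r"
  have s: "fst ?q \<le> r powr (1/2)" "\<bar>w\<bar> \<le> r powr (1/2)"
  proof -
    have "(fst ?q)\<^sup>2 \<le> r" "w\<^sup>2 \<le> r" using g knorm4_bounds[of ?q] by (auto simp: cyl_def)
    then show "fst ?q \<le> r powr (1/2)" "\<bar>w\<bar> \<le> r powr (1/2)"
      using assms by (auto simp: powr_half_sqrt intro: real_le_rsqrt)
  qed
  have "\<bar>x $ i\<bar> \<le> r powr (1/4) \<and> \<bar>y $ i\<bar> \<le> r powr (1/4)" for i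
  proof -
    have "(x $ i)\<^sup>2 \<le> fst ?q" "(y $ i)\<^sup>2 \<le> fst ?q"
    proof -
      have "(z $ i)\<^sup>2 \<le> z \<bullet> z" for z :: "real ^ 'n"
        using member_le_sum[of i UNIV "\<lambda>i. z $ i * z $ i"] by (simp add: inner_vec_def power2_eq_square)
      then have "(x $ i)\<^sup>2 \<le> x \<bullet> x" "(y $ i)\<^sup>2 \<le> y \<bullet> y" by auto
      then show "(x $ i)\<^sup>2 \<le> fst ?q" "(y $ i)\<^sup>2 \<le> fst ?q"
        by (simp_all add: cyl_def add_increasing add_increasing2)
    qed
    then have "(x $ i)\<^sup>2 \<le> (r powr (1/4))\<^sup>2" "(y $ i)\<^sup>2 \<le> (r powr (1/4))\<^sup>2"
      using s assms by (auto simp: power2_eq_square powr_add[symmetric])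
    then show ?thesis by (metis abs_le_square_iff abs_of_nonneg powr_ge_zero)
  qed
  then show "(x, y, w) \<in> koranyi_box r"
    using s by (auto simp: koranyi_box_def mem_box_cart abs_le_iff minus_le_iff)
qed

lemma borel_measurable_knorm4_cyl [measurable]: "(\<lambda>\<xi>. knorm4 (cyl \<xi>)) \<in> borel_measurable borel"
  by (intro borel_measurable_continuous_onI continuous_on_compose2[OF continuous_on_knorm4[of UNIV] continuous_on_cyl]) auto

lemma borel_measurable_cyl [measurable]: "cyl \<in> borel_measurable borel"
  by (intro borel_measurable_continuous_onI continuous_on_cyl)

lemma emeasure_koranyi_ball:
  assumes "0 < r"
  shows "emeasure lebesgue {\<xi>::'n::finite heis. knorm4 (cyl \<xi>) < r}
    \<le> ennreal (2 ^ (2 * CARD('n) + 1) * r powr ((2 * real CARD('n) + 2) / 4))"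
proof -
  have "emeasure lebesgue {\<xi>::'n heis. knorm4 (cyl \<xi>) < r} \<le> emeasure lebesgue (koranyi_box r :: 'n heis set)"
    by (intro emeasure_mono koranyi_ball_subset_box assms) simp
  then show ?thesis using emeasure_koranyi_box[OF assms, where 'n='n] by simp
qed

abbreviation slab :: "real \<Rightarrow> (real \<times> 'a::euclidean_space) set" where
  "slab T \<equiv> {0<..<T} \<times> UNIV"

lemma slab_borel [measurable]: "slab T \<in> sets borel"
  by (intro borel_open open_Times) auto

lemma emeasure_slab_koranyi_ball:
  assumes "0 < r" "0 < T"
  shows "emeasure (lebesgue_on (slab T)) {z \<in> slab T. knorm4 (cyl (snd z :: 'n::finite heis)) < r}
    \<le> ennreal (T * 2 ^ (2 * CARD('n) + 1) * r powr ((2 * real CARD('n) + 2) / 4))"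
proof -
  have "emeasure (lebesgue_on (slab T)) {z \<in> slab T. knorm4 (cyl (snd z :: 'n heis)) < r}
    = emeasure lebesgue {z \<in> slab T. knorm4 (cyl (snd z :: 'n heis)) < r}"
    by (intro emeasure_restrict_space) auto
  also have "\<dots> \<le> emeasure lebesgue ({0<..<T} \<times> (koranyi_box r :: 'n heis set))"
    using koranyi_ball_subset_box[OF assms(1)] by (intro emeasure_mono sets_completionI_sets) (auto simp: borel_Times)
  also have "\<dots> = emeasure lborel {0<..<T} * emeasure lborel (koranyi_box r :: 'n heis set)"
    by (simp add: emeasure_lborel_Times borel_Times)
  also have "\<dots> = ennreal (T * 2 ^ (2 * CARD('n) + 1) * r powr ((2 * real CARD('n) + 2) / 4))"
    using assms by (simp add: emeasure_koranyi_box ennreal_mult[symmetric] mult.assoc)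
  finally show ?thesis .
qed

lemma fst_snd_borel [measurable]:
  "(fst :: 'a::euclidean_space \<times> 'b::euclidean_space \<Rightarrow> 'a) \<in> borel_measurable borel"
  "(snd :: 'a \<times> 'b \<Rightarrow> 'b) \<in> borel_measurable borel"
  by (intro borel_measurable_continuous_onI continuous_intros)+

lemma radial_test_measurable:
  assumes F: "radial_test N \<mu> F MF"
  shows "F \<in> borel_measurable borel" "MF \<in> borel_measurable borel"
proof -
  obtain Fs Ft Fss Fst Ftt R where C2: "C2_profile F Fs Ft Fss Fst Ftt"
    and MF: "\<And>q. MF q = cyl_op N \<mu> q (Fs q) (Ft q) (Fss q) (Ftt q)"
    using radial_testD[OF F] by metis
  show "F \<in> borel_measurable borel"
    by (intro borel_measurable_continuous_onI C2_profile_continuous[OF C2])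
  have [measurable]: "Fs \<in> borel_measurable borel" "Ft \<in> borel_measurable borel"
    "Fss \<in> borel_measurable borel" "Ftt \<in> borel_measurable borel" "knorm4 \<in> borel_measurable borel"
    by (intro borel_measurable_continuous_onI C2_profile_continuous[OF C2] C2_profileD[OF C2] continuous_on_knorm4)+
  show "MF \<in> borel_measurable borel" unfolding MF[abs_def] cyl_op_def by measurable
qed

lemma snd_vimage_null_sets:
  fixes A :: "'b::euclidean_space set"
  assumes "A \<in> null_sets lborel"
  shows "(UNIV :: 'a::euclidean_space set) \<times> A \<in> null_sets lborel"
proof -
  have "A \<in> sets borel" "emeasure lborel A = 0" using assms by auto
  then show ?thesis by (auto simp: emeasure_lborel_Times borel_Times intro!: null_setsI)
qed

lemma AE_lebesgue_snd:
  assumes "AE \<xi> in lebesgue. P (\<xi> :: 'b::euclidean_space)"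
  shows "AE z in lebesgue. P (snd (z :: 'a::euclidean_space \<times> 'b))"
proof -
  have "AE \<xi> in lborel. P \<xi>" using assms by (simp add: AE_completion_iff)
  then obtain A where A: "A \<in> null_sets lborel" "{\<xi>. \<not> P \<xi>} \<subseteq> A"
    by (auto simp: eventually_ae_filter)
  have "AE z in lborel. P (snd (z :: 'a \<times> 'b))"
    by (rule AE_I'[OF snd_vimage_null_sets[OF A(1)]]) (use A in auto)
  then show ?thesis by (rule AE_completion)
qed

text \<open>A null set of the slab has null slices at almost every time, hence at some time in (0,T).\<close>

lemma AE_lebesgue_slab_snd:
  fixes P :: "'b::euclidean_space \<Rightarrow> bool"
  assumes "AE z in lebesgue. (z :: real \<times> 'b) \<in> slab T \<longrightarrow> P (snd z)" "0 < T"
  shows "AE \<xi> in lebesgue. P \<xi>"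
proof -
  have "AE z in lborel \<Otimes>\<^sub>M lborel. (z :: real \<times> 'b) \<in> slab T \<longrightarrow> P (snd z)"
    using assms(1) unfolding AE_completion_iff lborel_prod .
  then have "AE t in lborel. AE \<xi> in lborel. (t, \<xi>) \<in> slab T \<longrightarrow> P (snd (t, \<xi>))"
    by (rule lborel_pair.AE_pair)
  then have "AE t in lborel. t \<in> {0<..<T} \<longrightarrow> (AE \<xi> in lborel. P \<xi>)" by simp
  moreover have "\<not> (AE t in lborel. t \<notin> {0<..<T})"
  proof
    assume "AE t in lborel. t \<notin> {0<..<T}"
    then have "emeasure lborel {0<..<T} = 0"
      by (subst (asm) AE_iff_measurable[of "{0<..<T}"]) auto
    then show False using assms(2) by simp
  qed
  ultimately have "AE \<xi> in lborel. P \<xi>"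
    by (cases "AE \<xi> in lborel. P \<xi>") (auto elim: eventually_mono)
  then show ?thesis by (rule AE_completion)
qed

lemma measurable_snd_lebesgue:
  "snd \<in> (lebesgue :: ('a::euclidean_space \<times> 'b::euclidean_space) measure) \<rightarrow>\<^sub>M (lebesgue :: 'b measure)"
proof -
  have m: "snd \<in> (lebesgue :: ('a \<times> 'b) measure) \<rightarrow>\<^sub>M lborel"
    by (intro measurable_completion) (simp add: borel_measurable_continuous_onI continuous_on_snd)
  have "null_sets lborel \<subseteq> null_sets (distr (lebesgue :: ('a \<times> 'b) measure) lborel snd)"
  proof
    fix A :: "'b set" assume A: "A \<in> null_sets lborel"
    have "snd -` A = (UNIV :: 'a set) \<times> A" by auto
    then have "emeasure (distr (lebesgue :: ('a \<times> 'b) measure) lborel snd) A = 0"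
      using null_setsD2[OF A] null_setsD1[OF snd_vimage_null_sets[OF A, where 'a='a]]
        null_setsD2[OF snd_vimage_null_sets[OF A, where 'a='a]] by (simp add: emeasure_distr[OF m])
    then show "A \<in> null_sets (distr (lebesgue :: ('a \<times> 'b) measure) lborel snd)"
      using A by (intro null_setsI) auto
  qed
  then show ?thesis by (rule completion.measurable_completion2[OF m])
qed

text \<open>The product formula is available for Borel functions; a Lebesgue measurable g agrees almost
  everywhere with a Borel function, on the group and therefore also on space-time.\<close>

lemma product_integral_lebesgue:
  fixes g :: "'b::euclidean_space \<Rightarrow> real"
  assumes c: "integrable lborel (c :: real \<Rightarrow> real)" and g: "integrable lebesgue g"
  shows "integrable lebesgue (\<lambda>z. c (fst z) * g (snd z))"
    "(LINT z|lebesgue. c (fst z) * g (snd z)) = (LINT t|lborel. c t) * (LINT \<xi>|lebesgue. g \<xi>)"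
proof -
  obtain g' where g': "g' \<in> borel_measurable lborel" "AE \<xi> in lborel. g \<xi> = g' \<xi>"
    using completion_ex_borel_measurable_real[OF borel_measurable_integrable[OF g]] by blast
  note [measurable] = g'(1) borel_measurable_integrable[OF c]
  have ae: "AE \<xi> in lebesgue. g \<xi> = g' \<xi>" using g'(2) by (rule AE_completion)
  have "integrable lebesgue g'"
    using g ae g'(1) by (subst integrable_cong_AE[of _ _ g]) (auto simp: measurable_completion)
  then have ig': "integrable lborel g'" using g'(1) by (simp add: integrable_completion)
  have Ig: "(LINT \<xi>|lebesgue. g \<xi>) = (LINT \<xi>|lborel. g' \<xi>)"
  proof -
    have "(LINT \<xi>|lebesgue. g \<xi>) = (LINT \<xi>|lebesgue. g' \<xi>)"
      using g ae g'(1) by (intro integral_cong_AE) (auto simp: measurable_completion)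
    then show ?thesis using g'(1) by (simp add: integral_completion)
  qed
  let ?f = "\<lambda>z. c (fst z) * g' (snd z)"
  have f: "integrable (lborel \<Otimes>\<^sub>M lborel) ?f"
    using c ig' by (intro lborel_pair.Fubini_integrable) (auto simp: abs_mult)
  have If: "(LINT z|(lborel \<Otimes>\<^sub>M lborel). ?f z) = (LINT t|lborel. c t) * (LINT \<xi>|lborel. g' \<xi>)"
    using lborel_pair.integral_fst'[OF f] by simp
  have fm: "?f \<in> borel_measurable lborel" by (simp add: lborel_prod[symmetric])
  have f': "integrable lebesgue ?f" "(LINT z|lebesgue. ?f z) = (LINT t|lborel. c t) * (LINT \<xi>|lborel. g' \<xi>)"
    using f If fm by (simp_all add: integrable_completion integral_completion lborel_prod)
  have m: "(\<lambda>z. c (fst z) * g (snd z)) \<in> borel_measurable lebesgue"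
  proof (intro borel_measurable_times)
    have "(\<lambda>z. c (fst z)) \<in> borel_measurable ((lborel :: real measure) \<Otimes>\<^sub>M (lborel :: 'b measure))" by measurable
    then show "(\<lambda>z. c (fst z)) \<in> borel_measurable (lebesgue :: (real \<times> 'b) measure)"
      unfolding lborel_prod by (rule measurable_completion)
    show "(\<lambda>z. g (snd z)) \<in> borel_measurable (lebesgue :: (real \<times> 'b) measure)"
      using measurable_compose[OF measurable_snd_lebesgue borel_measurable_integrable[OF g]] .
  qed
  have ae2: "AE z in lebesgue. c (fst z) * g (snd z) = ?f (z :: real \<times> 'b)"
    using AE_lebesgue_snd[OF ae] by eventually_elim simp
  show "integrable lebesgue (\<lambda>z. c (fst z) * g (snd z))"
    using integrable_cong_AE[OF m _ ae2] f' by auto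
  show "(LINT z|lebesgue. c (fst z) * g (snd z)) = (LINT t|lborel. c t) * (LINT \<xi>|lebesgue. g \<xi>)"
    using integral_cong_AE[OF m _ ae2] f' Ig by auto
qed

lemma translate_lebesgue:
  fixes f :: "'a::euclidean_space \<Rightarrow> real"
  assumes "integrable lebesgue f"
  shows "integrable lebesgue (\<lambda>x. f (a + x))" "(LINT x|lebesgue. f (a + x)) = (LINT x|lebesgue. f x)"
proof -
  have T: "(\<lambda>x. a + (\<Sum>j\<in>Basis. (1 * (x \<bullet> j)) *\<^sub>R j)) = (\<lambda>x::'a. a + x)"
    by (simp add: euclidean_representation)
  have m: "(\<lambda>x. a + x) \<in> lebesgue \<rightarrow>\<^sub>M lebesgue"
    using lebesgue_affine_measurable[of "\<lambda>_::'a. 1" a] unfolding T by simp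
  have "lebesgue = density (distr lebesgue lebesgue (\<lambda>x. a + x)) (\<lambda>_. 1)"
    using lebesgue_affine_euclidean[of "\<lambda>_::'a. 1" a] unfolding T by simp
  then have d: "distr lebesgue lebesgue (\<lambda>x. a + x) = lebesgue" by (simp add: density_1)
  have fm: "f \<in> borel_measurable lebesgue" using assms by simp
  show "integrable lebesgue (\<lambda>x. f (a + x))"
    using integrable_distr_eq[OF m fm] assms unfolding d by simp
  show "(LINT x|lebesgue. f (a + x)) = (LINT x|lebesgue. f x)"
    using integral_distr[OF m fm] unfolding d by simp
qed

section \<open>Cutoffs and the weak identity\<close>

definition pos_pow :: "nat \<Rightarrow> real \<Rightarrow> real" where "pos_pow n x = (max 0 x) ^ n"

lemma pos_pow_nonneg [simp]: "0 \<le> pos_pow n x" by (simp add: pos_pow_def)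
lemma continuous_on_pos_pow [continuous_intros]:
  "continuous_on A f \<Longrightarrow> continuous_on A (\<lambda>x. pos_pow n (f x))"
  unfolding pos_pow_def by (intro continuous_intros)
lemma borel_measurable_pos_pow [measurable]: "pos_pow n \<in> borel_measurable borel"
  unfolding pos_pow_def by measurable
lemma pos_pow_eq_0: "x \<le> 0 \<Longrightarrow> 0 < n \<Longrightarrow> pos_pow n x = 0" by (simp add: pos_pow_def max_def)
lemma pos_pow_ge_half: "1 / 2 \<le> x \<Longrightarrow> (1 / 2) ^ n \<le> pos_pow n x"
  unfolding pos_pow_def by (intro power_mono max.coboundedI2) auto
lemma pos_pow_le_1: "x \<le> 1 \<Longrightarrow> pos_pow n x \<le> 1" by (auto simp: pos_pow_def intro!: power_le_one)

lemma DERIV_pos_pow: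
  assumes "2 \<le> n"
  shows "(pos_pow n has_real_derivative real n * pos_pow (n - 1) x) (at x)"
proof -
  have "((\<lambda>x. if x \<le> 0 then 0 else x ^ n) has_real_derivative (if x \<le> 0 then 0 else real n * x ^ (n - 1))) (at x)"
    by (rule DERIV_pos_part) (use assms in \<open>auto intro!: derivative_eq_intros simp: power_0_left\<close>)
  moreover have "pos_pow n = (\<lambda>x. if x \<le> 0 then 0 else x ^ n)"
    using assms by (auto simp: pos_pow_def fun_eq_iff max_def)
  moreover have "real n * pos_pow (n - 1) x = (if x \<le> 0 then 0 else real n * x ^ (n - 1))"
    using assms by (auto simp: pos_pow_def max_def)
  ultimately show ?thesis by simp
qed

text \<open>The time factor of all test functions. A power is used because its derivative is again a cutoff of
  this form, which can be compared with the cutoff itself.\<close>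

definition tcut :: "nat \<Rightarrow> real \<Rightarrow> real \<Rightarrow> real" where "tcut l \<tau> t = pos_pow l (1 - t / \<tau>)"

lemma tcut_nonneg [simp]: "0 \<le> tcut l \<tau> t" by (simp add: tcut_def)
lemma tcut_measurable [measurable]: "tcut l \<tau> \<in> borel_measurable borel"
  unfolding tcut_def by measurable
lemma tcut_le_1: "0 \<le> t \<Longrightarrow> 0 < \<tau> \<Longrightarrow> tcut l \<tau> t \<le> 1"
  by (simp add: tcut_def pos_pow_le_1)
lemma tcut_eq_0: "\<tau> \<le> t \<Longrightarrow> 0 < \<tau> \<Longrightarrow> 0 < l \<Longrightarrow> tcut l \<tau> t = 0"
  by (simp add: tcut_def pos_pow_eq_0)
lemma tcut_pos: "t < \<tau> \<Longrightarrow> 0 < \<tau> \<Longrightarrow> 0 < tcut l \<tau> t"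
  by (simp add: tcut_def pos_pow_def max_def)
lemma tcut_Suc: "tcut (Suc l) \<tau> t = max 0 (1 - t / \<tau>) * tcut l \<tau> t"
  by (simp add: tcut_def pos_pow_def)
lemma tcut_0 [simp]: "tcut l \<tau> 0 = 1" by (simp add: tcut_def pos_pow_def)

lemma DERIV_tcut:
  assumes "2 \<le> l" "0 < \<tau>"
  shows "(tcut l \<tau> has_real_derivative - (real l / \<tau>) * tcut (l - 1) \<tau> t) (at t)"
proof -
  have d: "((\<lambda>t. 1 - t / \<tau>) has_real_derivative - 1 / \<tau>) (at t)"
    using assms by (auto intro!: derivative_eq_intros)
  show ?thesis
    unfolding tcut_def[abs_def] using DERIV_chain2[OF DERIV_pos_pow[OF assms(1)] d] by simp
qed

lemma continuous_on_tcut [continuous_intros]: "continuous_on A (tcut l \<tau>)"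
  unfolding tcut_def divide_inverse by (intro continuous_intros)

lemma tcut_interval_integral:
  assumes "0 < \<tau>" "t \<le> \<tau>" "0 < l"
  shows "(LINT s|lborel. indicator {t..\<tau>} s *\<^sub>R tcut l \<tau> s) = \<tau> / (real l + 1) * tcut (l + 1) \<tau> t"
proof -
  have "(LINT s|lborel. indicator {t..\<tau>} s *\<^sub>R tcut l \<tau> s)
     = (- \<tau> / (real l + 1) * tcut (l + 1) \<tau> \<tau>) - (- \<tau> / (real l + 1) * tcut (l + 1) \<tau> t)"
  proof (rule integral_FTC_atLeastAtMost)
    fix s assume "t \<le> s" "s \<le> \<tau>"
    define c where "c = real l + 1"
    have c: "c \<noteq> 0" "real (l + 1) = c" by (auto simp: c_def)
    have "((\<lambda>t. - \<tau> / c * tcut (l + 1) \<tau> t) has_real_derivative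
       - \<tau> / c * (- (c / \<tau>) * tcut (l + 1 - 1) \<tau> s)) (at s)"
      unfolding c(2)[symmetric] by (intro DERIV_cmult DERIV_tcut) (use assms in auto)
    also have "- \<tau> / c * (- (c / \<tau>) * tcut (l + 1 - 1) \<tau> s) = tcut l \<tau> s"
      using c assms by simp
    finally show "((\<lambda>t. - \<tau> / (real l + 1) * tcut (l + 1) \<tau> t) has_vector_derivative tcut l \<tau> s) (at s within {t..\<tau>})"
      unfolding c_def by (simp add: has_real_derivative_iff_has_vector_derivative has_vector_derivative_at_within)
  qed (use assms in \<open>auto intro: continuous_intros\<close>)
  then show ?thesis using assms by (simp add: tcut_eq_0)
qed

lemma tcut_integral:
  assumes "0 < \<tau>" "\<tau> < T"
  shows "integrable lborel (\<lambda>t. indicator {0<..<T} t * tcut l \<tau> t)"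
    "0 < l \<Longrightarrow> (LINT t|lborel. indicator {0<..<T} t * tcut l \<tau> t) = \<tau> / (real l + 1)"
proof -
  have si: "set_integrable lborel {0..T} (tcut l \<tau>)"
    by (intro borel_integrable_atLeastAtMost' continuous_intros)
  have "set_integrable lborel {0<..<T} (tcut l \<tau>)"
    by (rule set_integrable_subset[OF si]) auto
  then show "integrable lborel (\<lambda>t. indicator {0<..<T} t * tcut l \<tau> t)"
    by (simp add: set_integrable_def)
  assume l: "0 < l"
  have "(LINT t|lborel. indicator {0<..<T} t * tcut l \<tau> t) = (LINT t|lborel. indicator {0..\<tau>} t *\<^sub>R tcut l \<tau> t)"
  proof (rule integral_cong_AE)
    show "AE t in lborel. indicator {0<..<T} t * tcut l \<tau> t = indicator {0..\<tau>} t *\<^sub>R tcut l \<tau> t"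
      using AE_lborel_singleton[of 0]
      by eventually_elim (use assms l in \<open>auto simp: indicator_def tcut_eq_0\<close>)
  qed auto
  then show "(LINT t|lborel. indicator {0<..<T} t * tcut l \<tau> t) = \<tau> / (real l + 1)"
    using tcut_interval_integral[OF assms(1) _ l, of 0] assms(1) by simp
qed

text \<open>Near the edge of the ball the operator costs R^(-1/2) y^(m-2) where the cutoff itself is y^m. For a
  large power m both are small to high order there, and further inside the first is dominated by a
  fixed multiple of the second once R is large.\<close>

lemma power_cut_profile:
  assumes m: "3 \<le> m" and R: "0 < R" and \<mu>: "0 \<le> \<mu>" "\<mu> < N"
  obtains MY where "radial_test N \<mu> (\<lambda>q. pos_pow m (1 - knorm4 q / R)) MY"
    "\<And>q. 0 \<le> fst q \<Longrightarrow> q \<noteq> 0 \<Longrightarrow> MY q \<le> 16 * (real m)\<^sup>2 * R powr (-1/2) * pos_pow (m - 2) (1 - knorm4 q / R)"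
proof -
  let ?y = "\<lambda>x. 1 - (x::real) / R"
  have d0: "((\<lambda>x. ?y x) has_real_derivative - 1 / R) (at x)" for x
    using R by (auto intro!: derivative_eq_intros)
  have d1: "((\<lambda>x. pos_pow m (?y x)) has_real_derivative - (real m / R) * pos_pow (m - 1) (?y x)) (at x)" for x
    using DERIV_chain2[OF DERIV_pos_pow d0, of m x] m by simp
  have d2: "((\<lambda>x. - (real m / R) * pos_pow (m - 1) (?y x)) has_real_derivative real m * (real m - 1) / R\<^sup>2 * pos_pow (m - 2) (?y x)) (at x)" for x
  proof -
    have "((\<lambda>x. - (real m / R) * pos_pow (m - 1) (?y x)) has_real_derivative
       - (real m / R) * (real (m - 1) * pos_pow (m - 1 - 1) (?y x) * (- 1 / R))) (at x)"
      using m by (intro DERIV_cmult DERIV_chain2[OF DERIV_pos_pow d0]) auto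
    also have "- (real m / R) * (real (m - 1) * pos_pow (m - 1 - 1) (?y x) * (- 1 / R))
       = real m * (real m - 1) / R\<^sup>2 * pos_pow (m - 2) (?y x)"
      using m by (simp add: power2_eq_square of_nat_diff numeral_2_eq_2)
    finally show ?thesis .
  qed
  have c: "continuous_on UNIV (\<lambda>x. real m * (real m - 1) / R\<^sup>2 * pos_pow (m - 2) (?y x))"
    unfolding divide_inverse by (intro continuous_intros)
  note P = C2_profile_comp[OF C2_profile_knorm4[of 0, simplified] UNIV_I d1 d2 c]
  let ?M = "\<lambda>q. - (real m / R) * pos_pow (m - 1) (?y (knorm4 q)) * cyl_op N \<mu> q (2 * fst q) (2 * snd q) 2 2
     + real m * (real m - 1) / R\<^sup>2 * pos_pow (m - 2) (?y (knorm4 q)) * (4 * fst q * ((2 * fst q)\<^sup>2 + (2 * snd q)\<^sup>2))"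
  show thesis
  proof
    show "radial_test N \<mu> (\<lambda>q. pos_pow m (?y (knorm4 q))) ?M"
      unfolding radial_test_def cyl_op_comp[symmetric]
    proof (intro conjI allI)
      show "\<exists>R'. \<forall>q. R' \<le> knorm4 q \<longrightarrow> pos_pow m (?y (knorm4 q)) = 0"
        using R m by (intro exI[of _ R]) (auto intro!: pos_pow_eq_0)
    qed (use P in \<open>blast | simp\<close>)+
    fix q :: "real \<times> real" assume s: "0 \<le> fst q" and q: "q \<noteq> 0"
    have g: "0 < knorm4 q" using q by (simp add: knorm4_pos_iff)
    have e1: "fst q * (2 * fst q) + snd q * (2 * snd q) = 2 * knorm4 q"
      by (simp add: knorm4_def power2_eq_square)
    have M: "cyl_op N \<mu> q (2 * fst q) (2 * snd q) 2 2 = 8 * fst q * (2 + N - \<mu>)"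
      unfolding cyl_op_def e1 using g by (simp add: algebra_simps)
    have e2: "(2 * fst q)\<^sup>2 + (2 * snd q)\<^sup>2 = 4 * knorm4 q" by (simp add: knorm4_def)
    have "0 \<le> real m / R * pos_pow (m - 1) (?y (knorm4 q)) * (8 * fst q * (2 + N - \<mu>))"
      using s \<mu> R by simp
    moreover have "real m * (real m - 1) / R\<^sup>2 * pos_pow (m - 2) (?y (knorm4 q)) * (4 * fst q * (4 * knorm4 q))
      \<le> 16 * (real m)\<^sup>2 * R powr (-1/2) * pos_pow (m - 2) (?y (knorm4 q))"
    proof (cases "knorm4 q < R")
      case True
      have "fst q \<le> sqrt R"
        using knorm4_bounds(1)[of q] True by (intro real_le_rsqrt) auto
      then have "fst q * knorm4 q \<le> sqrt R * R" using True g s R by (intro mult_mono) auto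
      then have "(real m * (real m - 1)) * (fst q * knorm4 q) \<le> (real m)\<^sup>2 * (sqrt R * R)"
        using s g m R by (intro mult_mono[of "real m * (real m - 1)"]) (auto simp: power2_eq_square)
      moreover have "sqrt R * R / R\<^sup>2 = R powr (-1/2)"
        using R by (simp add: powr_minus_divide powr_half_sqrt power2_eq_square real_div_sqrt field_simps)
      ultimately have "(real m * (real m - 1)) * (fst q * knorm4 q) / R\<^sup>2 \<le> (real m)\<^sup>2 * R powr (-1/2)"
        using R divide_right_mono[of "(real m * (real m - 1)) * (fst q * knorm4 q)" "(real m)\<^sup>2 * (sqrt R * R)" "R\<^sup>2"]
        by (metis times_divide_eq_right zero_le_power2)
      from mult_right_mono[OF this, of "16 * pos_pow (m - 2) (?y (knorm4 q))"] show ?thesis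
        by (simp add: mult_ac)
    next
      case False
      then have "pos_pow (m - 2) (?y (knorm4 q)) = 0" using R m by (intro pos_pow_eq_0) auto
      then show ?thesis by simp
    qed
    ultimately show "?M q \<le> 16 * (real m)\<^sup>2 * R powr (-1/2) * pos_pow (m - 2) (?y (knorm4 q))"
      unfolding M e2 by simp
  qed
qed

lemma AE_lebesgue_on_slab:
  "(AE z in lebesgue_on (slab T). P z) \<longleftrightarrow> (AE z in lebesgue. z \<in> slab T \<longrightarrow> P z)"
  by (subst AE_restrict_space_iff) auto

lemma AE_slab_snd:
  assumes "AE \<xi> in lebesgue. P (\<xi> :: 'a::euclidean_space)"
  shows "AE z in lebesgue_on (slab T). P (snd z)"
  using AE_lebesgue_snd[OF assms, where 'a=real] unfolding AE_lebesgue_on_slab by eventually_elim simp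

lemma AE_slab_nonzero: "AE z in lebesgue_on (slab T). snd z \<noteq> (0::'a::euclidean_space)"
  by (rule AE_slab_snd) (rule AE_completion[OF AE_lborel_singleton])

lemma integrable_slab_iff:
  "integrable (lebesgue_on (slab T)) g \<longleftrightarrow> integrable lebesgue (\<lambda>z. indicator (slab T) z * (g z :: real))"
  by (subst integrable_restrict_space) auto

lemma integral_slab:
  "(LINT z|lebesgue_on (slab T). g z) = (LINT z|lebesgue. indicator (slab T) z * (g z :: real))"
  by (subst integral_restrict_space) auto

lemma borel_measurable_slab: "g \<in> borel_measurable borel \<Longrightarrow> g \<in> borel_measurable (lebesgue_on (slab T))"
  by (intro measurable_restrict_space1 measurable_completion) simp

lemma frac_int_cmult: "frac_int T \<gamma> (\<lambda>\<tau>. g \<tau> * c) t = frac_int T \<gamma> g t * c"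
  by (simp add: frac_int_def mult.assoc[symmetric])

lemma frac_int_nonneg: "0 < \<gamma> \<Longrightarrow> (\<And>t. 0 \<le> g t) \<Longrightarrow> 0 \<le> frac_int T \<gamma> g t"
  unfolding frac_int_def set_lebesgue_integral_def
  by (intro mult_nonneg_nonneg integral_nonneg_AE) (auto intro!: Gamma_real_pos less_imp_le)

text \<open>This is \<rho>^(-2\<mu>), the weight w.\<close>

definition wt :: "real \<Rightarrow> 'n::finite heis \<Rightarrow> real" where
  "wt \<mu> \<xi> = knorm4 (cyl \<xi>) powr (- \<mu> / 2)"

lemma wt_nonneg [simp]: "0 \<le> wt \<mu> \<xi>" by (simp add: wt_def)
lemma wt_pos: "\<xi> \<noteq> 0 \<Longrightarrow> 0 < wt \<mu> \<xi>"
  using knorm4_cyl_pos[of \<xi>] by (simp add: wt_def)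
lemma knorm_wt: "knorm \<xi> powr (- 2 * \<mu>) = wt \<mu> \<xi>"
  by (simp add: knorm_powr wt_def)
lemma borel_measurable_wt [measurable]: "wt \<mu> \<in> borel_measurable borel"
  unfolding wt_def by measurable

text \<open>The weak formulation for v = \<rho>^\<mu> u and v0 = \<rho>^\<mu> u0, common to the nonnegative and the
  decreasing case.\<close>

locale weak_evolution =
  fixes N \<mu> p \<gamma> \<alpha> T :: real and f v0 :: "'n::finite heis \<Rightarrow> real" and v :: "real \<Rightarrow> 'n heis \<Rightarrow> real"
  assumes N: "N = real CARD('n)" and \<mu>: "0 < \<mu>" "\<mu> < N" and \<gamma>: "0 < \<gamma>" "\<gamma> < 1" and p: "1 < p" and T: "0 < T"
    and v_meas: "(\<lambda>z. v (fst z) (snd z)) \<in> borel_measurable (lebesgue_on (slab T))"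
    and f_nonneg: "AE \<xi> in lebesgue. 0 \<le> f \<xi>" and v0_nonneg: "AE \<xi> in lebesgue. 0 \<le> v0 \<xi>"
    and weak: "\<And>\<phi>. test_function T \<phi> \<Longrightarrow> (\<forall>t\<in>{0..<T}. \<forall>\<xi>. 0 \<le> \<phi> t \<xi>) \<Longrightarrow> weak_identity \<mu> p \<gamma> \<alpha> T f v0 v \<phi>"
begin

abbreviation S :: "(real \<times> 'n heis) measure" where "S \<equiv> lebesgue_on (slab T)"

text \<open>The three space-time integrands of the weak identity for the test function
  tcut l \<tau> t * F (cyl \<xi>), in terms of profiles. This one agrees with the integrand of the weak
  identity off \<xi> = 0 only.\<close>

definition Aint where "Aint l \<tau> F MF z = v (fst z) (snd z) * wt \<mu> (snd z) *
   (tcut l \<tau> (fst z) * MF (cyl (snd z)) - real l / \<tau> * (tcut (l - 1) \<tau> (fst z) * F (cyl (snd z))))"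

definition Bint where "Bint l \<tau> F z = knorm (snd z) powr (- (p + 1) * \<mu>) * \<bar>v (fst z) (snd z)\<bar> powr p
   * (frac_int T \<gamma> (tcut l \<tau>) (fst z) * F (cyl (snd z)))"

definition Fint where "Fint l \<tau> F z = knorm (snd z) powr (- \<mu>) * fst z powr \<alpha> * f (snd z) * (tcut l \<tau> (fst z) * F (cyl (snd z)))"

lemma weak_identity_cut:
  assumes l: "2 \<le> l" and \<tau>: "0 < \<tau>" "\<tau> < T" and F: "radial_test N \<mu> F MF"
  shows "integrable S (Aint l \<tau> F MF)" "integrable S (Bint l \<tau> F)" "integrable S (Fint l \<tau> F)"
    "integrable lebesgue (\<lambda>\<xi>. wt \<mu> \<xi> * v0 \<xi> * F (cyl \<xi>))"
    "- (LINT z|S. Aint l \<tau> F MF z) = (LINT z|S. Bint l \<tau> F z)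
       + (LINT \<xi>|lebesgue. wt \<mu> \<xi> * v0 \<xi> * F (cyl \<xi>)) + (LINT z|S. Fint l \<tau> F z)"
    "AE z in S. 0 \<le> Bint l \<tau> F z" "AE z in S. 0 \<le> Fint l \<tau> F z"
    "AE \<xi> in lebesgue. 0 \<le> wt \<mu> \<xi> * v0 \<xi> * F (cyl \<xi>)"
proof -
  obtain Fs Ft Fss Fst Ftt R where C2: "C2_profile F Fs Ft Fss Fst Ftt"
    and MF: "\<And>q. MF q = cyl_op N \<mu> q (Fs q) (Ft q) (Fss q) (Ftt q)"
    and supp: "\<And>q. R \<le> knorm4 q \<Longrightarrow> F q = 0"
    using radial_testD[OF F] by metis
  have Fnn: "0 \<le> F q" for q by (rule radial_test_nonneg[OF F])
  let ?\<phi> = "\<lambda>t (\<xi>::'n heis). tcut l \<tau> t * F (cyl \<xi>)"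
  note d = DERIV_tcut[OF l \<tau>(1)]
  have test: "test_function T ?\<phi>"
  proof (rule test_function_product[OF d _ _ \<tau>(2) Ck_2_profile[OF C2] compact_koranyi_ball[of R]])
    show "continuous_on UNIV (\<lambda>t. - (real l / \<tau>) * tcut (l - 1) \<tau> t)" by (intro continuous_intros)
  qed (use \<tau> l supp in \<open>auto simp: tcut_eq_0\<close>)
  have wi: "weak_identity \<mu> p \<gamma> \<alpha> T f v0 v ?\<phi>"
    by (rule weak[OF test]) (use Fnn in auto)
  define A where "A = (\<lambda>(t, \<xi>). v t \<xi> * (knorm \<xi> powr (- 2 * \<mu>) * time_deriv T ?\<phi> t \<xi> - heis_L \<mu> (?\<phi> t) \<xi>))"
  define B where "B = (\<lambda>(t, \<xi>). knorm \<xi> powr (- (p + 1) * \<mu>) * \<bar>v t \<xi>\<bar> powr p * frac_int T \<gamma> (\<lambda>\<tau>. ?\<phi> \<tau> \<xi>) t)"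
  define C where "C = (\<lambda>\<xi>. knorm \<xi> powr (- 2 * \<mu>) * v0 \<xi> * ?\<phi> 0 \<xi>)"
  define Fo where "Fo = (\<lambda>(t, \<xi>). knorm \<xi> powr (- \<mu>) * t powr \<alpha> * f \<xi> * ?\<phi> t \<xi>)"
  have W: "set_integrable lebesgue (slab T) A" "set_integrable lebesgue (slab T) B"
    "set_integrable lebesgue UNIV C" "set_integrable lebesgue (slab T) Fo"
    "- (LINT z:slab T|lebesgue. A z) = (LINT z:slab T|lebesgue. B z) + (LINT \<xi>|lebesgue. C \<xi>) + (LINT z:slab T|lebesgue. Fo z)"
    using wi unfolding weak_identity_def Let_def A_def B_def C_def Fo_def by blast+
  have iS: "integrable S A" "integrable S B" "integrable lebesgue C" "integrable S Fo"
    using W(1-4) by (simp_all add: set_integrable_def integrable_slab_iff)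
  have eqS: "- (LINT z|S. A z) = (LINT z|S. B z) + (LINT \<xi>|lebesgue. C \<xi>) + (LINT z|S. Fo z)"
    using W(5) by (simp add: set_lebesgue_integral_def integral_slab)
  have Beq: "B = Bint l \<tau> F" by (simp add: B_def Bint_def fun_eq_iff frac_int_cmult)
  have Feq: "Fo = Fint l \<tau> F" by (simp add: Fo_def Fint_def fun_eq_iff)
  have Ceq: "C = (\<lambda>\<xi>. wt \<mu> \<xi> * v0 \<xi> * F (cyl \<xi>))" unfolding C_def knorm_wt by simp
  have Aeq: "A z = Aint l \<tau> F MF z" if z: "z \<in> slab T" "snd z \<noteq> 0" for z
  proof -
    obtain t \<xi> where tz: "z = (t, \<xi>)" by (cases z)
    have t: "t \<in> {0..<T}" and \<xi>: "\<xi> \<noteq> 0" using z tz by auto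
    have "heis_L \<mu> (?\<phi> t) \<xi> = - wt \<mu> \<xi> * (tcut l \<tau> t * MF (cyl \<xi>))"
      using heis_L_C2_profile[OF C2_profile_cmult[OF C2, of "tcut l \<tau> t"] \<xi>, of \<mu>]
      unfolding cyl_op_cmult MF knorm_wt N .
    then show ?thesis
      unfolding A_def Aint_def tz prod.case fst_conv snd_conv time_deriv_product[OF d t] knorm_wt
      by (simp add: algebra_simps)
  qed
  have "AE z in S. z \<in> slab T"
    using AE_space[of S] by (auto simp: space_restrict_space)
  then have ae: "AE z in S. A z = Aint l \<tau> F MF z"
    using AE_slab_nonzero[where 'a="'n heis" and T=T] by eventually_elim (use Aeq in blast)
  have Am: "Aint l \<tau> F MF \<in> borel_measurable S"
  proof -
    note [measurable] = radial_test_measurable[OF F]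
    have "(\<lambda>z::real \<times> 'n heis. wt \<mu> (snd z) *
       (tcut l \<tau> (fst z) * MF (cyl (snd z)) - real l / \<tau> * (tcut (l - 1) \<tau> (fst z) * F (cyl (snd z)))))
       \<in> borel_measurable S"
      by (rule borel_measurable_slab) measurable
    from borel_measurable_times[OF v_meas this] show ?thesis
      unfolding Aint_def[abs_def] by (simp add: mult.assoc)
  qed
  show "integrable S (Aint l \<tau> F MF)"
    using iS(1) integrable_cong_AE[OF borel_measurable_integrable[OF iS(1)] Am ae] by simp
  show "integrable S (Bint l \<tau> F)" "integrable S (Fint l \<tau> F)"
    "integrable lebesgue (\<lambda>\<xi>. wt \<mu> \<xi> * v0 \<xi> * F (cyl \<xi>))"
    using iS by (simp_all add: Beq Feq Ceq)
  show "- (LINT z|S. Aint l \<tau> F MF z) = (LINT z|S. Bint l \<tau> F z)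
       + (LINT \<xi>|lebesgue. wt \<mu> \<xi> * v0 \<xi> * F (cyl \<xi>)) + (LINT z|S. Fint l \<tau> F z)"
    using eqS integral_cong_AE[OF borel_measurable_integrable[OF iS(1)] Am ae] by (simp add: Beq Feq Ceq)
  show "AE z in S. 0 \<le> Bint l \<tau> F z"
    using Fnn frac_int_nonneg[OF \<gamma>(1), of "tcut l \<tau>" T] by (simp add: Bint_def)
  show "AE z in S. 0 \<le> Fint l \<tau> F z"
    using AE_slab_snd[OF f_nonneg, of T] by eventually_elim (use Fnn in \<open>simp add: Fint_def\<close>)
  show "AE \<xi> in lebesgue. 0 \<le> wt \<mu> \<xi> * v0 \<xi> * F (cyl \<xi>)"
    using v0_nonneg by eventually_elim (use Fnn in simp)
qed

abbreviation vint where "vint l \<tau> F z \<equiv> v (fst z) (snd z) * wt \<mu> (snd z) * tcut l \<tau> (fst z) * F (cyl (snd z))"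

lemma AE_slab_mem: "AE z in S. 0 < fst z \<and> fst z < T"
  using AE_space[of S] by (auto simp: space_restrict_space)

text \<open>Cutoffs end before time T, so statements are first proved up to a time \<tau> < T.\<close>

lemma AE_slab_exhaust:
  assumes "\<And>\<tau>. 0 < \<tau> \<Longrightarrow> \<tau> < T \<Longrightarrow> AE z in S. fst z < \<tau> \<longrightarrow> P z"
  shows "AE z in S. P z"
proof -
  have "AE z in S. \<forall>n::nat. fst z < T * (1 - 1 / (real n + 2)) \<longrightarrow> P z"
    unfolding AE_all_countable
  proof
    fix n :: nat
    have "0 < 1 - 1 / (real n + 2)" "1 - 1 / (real n + 2) < 1" by (auto simp: field_simps)
    then show "AE z in S. fst z < T * (1 - 1 / (real n + 2)) \<longrightarrow> P z"
      using T by (intro assms) auto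
  qed
  then show ?thesis using AE_slab_mem
  proof eventually_elim
    case (elim z)
    have "0 < 1 - fst z / T" using elim T by simp
    then obtain n where n: "1 / real (Suc n) < 1 - fst z / T" using nat_approx_posE by metis
    have "1 / (real n + 2) \<le> 1 / real (Suc n)" by (simp add: field_simps)
    then have "fst z / T < 1 - 1 / (real n + 2)" using n by linarith
    then have "fst z < T * (1 - 1 / (real n + 2))" using T by (simp add: field_simps)
    then show ?case using elim by blast
  qed
qed

end

section \<open>Nonnegative solutions\<close>

lemma integrable_bounded_mult:
  fixes g b :: "'a \<Rightarrow> real"
  assumes "integrable M g" "b \<in> borel_measurable M" "AE z in M. \<bar>b z\<bar> \<le> C"
  shows "integrable M (\<lambda>z. b z * g z)"
proof (rule Bochner_Integration.integrable_bound[of M "\<lambda>z. C * g z"])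
  show "AE z in M. norm (b z * g z) \<le> norm (C * g z)"
    using assms(3)
  proof eventually_elim
    case (elim z)
    have "\<bar>b z\<bar> * \<bar>g z\<bar> \<le> \<bar>C\<bar> * \<bar>g z\<bar>" using elim by (intro mult_right_mono) auto
    then show ?case by (simp add: abs_mult)
  qed
qed (use assms in auto)

context weak_evolution begin

text \<open>The weak formulation only makes the sum of the time-derivative term and the L term integrable. The
  identities for the exponents l and l - 1 contain them in different proportions: (1 - t/\<tau>) times the
  second integrand minus the first is the time-derivative term alone.\<close>

lemma integrable_pieces:
  assumes l: "3 \<le> l" and \<tau>: "0 < \<tau>" "\<tau> < T" and F: "radial_test N \<mu> F MF"
  shows "integrable S (\<lambda>z. vint (l - 1) \<tau> F z)"
    "integrable S (\<lambda>z. vint l \<tau> F z)"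
    "integrable S (\<lambda>z. vint l \<tau> MF z)"
    "(LINT z|S. Aint l \<tau> F MF z) = (LINT z|S. vint l \<tau> MF z)
       - real l / \<tau> * (LINT z|S. vint (l - 1) \<tau> F z)"
proof -
  obtain k where k: "l = Suc (Suc k)" "1 \<le> k"
    by (rule that[of "l - 2"]) (use l in auto)
  have A1: "integrable S (Aint (l - 1) \<tau> F MF)" and A2: "integrable S (Aint l \<tau> F MF)"
    using l by (intro weak_identity_cut(1)[OF _ \<tau> F]; simp)+
  define X where "X = (\<lambda>t. max 0 (1 - t / \<tau>))"
  have X: "tcut (Suc n) \<tau> t = X t * tcut n \<tau> t" for n t by (simp add: X_def tcut_Suc)
  have b: "(\<lambda>z. X (fst z)) \<in> borel_measurable S"
    unfolding X_def by (rule borel_measurable_slab) measurable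
  have bb: "AE z in S. \<bar>X (fst z)\<bar> \<le> 1"
    using AE_slab_mem by eventually_elim (use \<tau> in \<open>auto simp: X_def\<close>)
  note mult = integrable_bounded_mult[OF _ b bb]
  have "integrable S (\<lambda>z. \<tau> * (X (fst z) * Aint (l - 1) \<tau> F MF z - Aint l \<tau> F MF z))"
    by (intro integrable_mult_right Bochner_Integration.integrable_diff mult A1 A2)
  also have "(\<lambda>z. \<tau> * (X (fst z) * Aint (l - 1) \<tau> F MF z - Aint l \<tau> F MF z))
    = (\<lambda>z. vint (l - 1) \<tau> F z)"
    using \<tau> by (simp add: Aint_def k X fun_eq_iff field_simps)
  finally show 1: "integrable S (\<lambda>z. vint (l - 1) \<tau> F z)" .
  show "integrable S (\<lambda>z. vint l \<tau> F z)"
    using mult[OF 1] by (simp add: k X mult_ac)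
  have "integrable S (\<lambda>z. Aint l \<tau> F MF z
      + real l / \<tau> * (vint (l - 1) \<tau> F z))"
    by (intro Bochner_Integration.integrable_add A2 integrable_mult_right 1)
  also have "(\<lambda>z. Aint l \<tau> F MF z
      + real l / \<tau> * (vint (l - 1) \<tau> F z))
    = (\<lambda>z. vint l \<tau> MF z)"
    by (simp add: Aint_def fun_eq_iff algebra_simps)
  finally show 2: "integrable S (\<lambda>z. vint l \<tau> MF z)" .
  have "(LINT z|S. Aint l \<tau> F MF z) = (LINT z|S. vint l \<tau> MF z
     - real l / \<tau> * (vint (l - 1) \<tau> F z))"
    by (simp add: Aint_def algebra_simps)
  also have "\<dots> = (LINT z|S. vint l \<tau> MF z)
       - real l / \<tau> * (LINT z|S. vint (l - 1) \<tau> F z)"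
    using 1 2 by simp
  finally show "(LINT z|S. Aint l \<tau> F MF z) = (LINT z|S. vint l \<tau> MF z)
       - real l / \<tau> * (LINT z|S. vint (l - 1) \<tau> F z)" .
qed

text \<open>Up to time \<tau>/2 the two cutoffs are comparable. At a later time t the value v(t) is at most 1/\<Theta>
  times v(t - \<tau>/2), where the cutoff is at least 1/8; shifting the integral by \<tau>/2 finishes the
  comparison.\<close>

lemma time_shift_estimate:
  assumes vnn: "\<And>t \<xi>. 0 < t \<Longrightarrow> t < T \<Longrightarrow> 0 \<le> v t \<xi>"
    and \<Theta>: "0 < \<Theta>" "\<And>s t \<xi>. 0 < s \<Longrightarrow> s \<le> t \<Longrightarrow> t < T \<Longrightarrow> \<Theta> * v t \<xi> \<le> v s \<xi>"
    and \<tau>: "0 < \<tau>" "\<tau> < T" and F: "radial_test N \<mu> F MF"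
  shows "(LINT z|S. vint 2 \<tau> F z)
    \<le> (2 + 8 / \<Theta>) * (LINT z|S. vint 3 \<tau> F z)"
proof -
  have Fnn: "0 \<le> F q" for q by (rule radial_test_nonneg[OF F])
  let ?h = "\<lambda>l z. vint l \<tau> F z"
  have i: "integrable S (?h 2)" "integrable S (?h 3)"
    using integrable_pieces[of 3, OF _ \<tau> F] by simp_all
  define J where "J = (\<lambda>l z. indicator (slab T) z * ?h l z)"
  have iJ: "integrable lebesgue (J 2)" "integrable lebesgue (J 3)"
    using i unfolding J_def by (simp_all add: integrable_slab_iff)
  define G where "G = (\<lambda>z. indicator (slab (\<tau> / 2)) z * J 3 z)"
  have iG: "integrable lebesgue G"
    unfolding G_def
  proof (rule integrable_bounded_mult[OF iJ(2), of _ 1])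
    show "(indicator (slab (\<tau> / 2)) :: real \<times> 'n heis \<Rightarrow> real) \<in> borel_measurable lebesgue"
      by (intro borel_measurable_indicator) simp
  qed (simp add: indicator_def)
  note tr = translate_lebesgue[OF iG, of "(- (\<tau> / 2), 0)"]
  have hnn: "0 \<le> J l z" for l z
    using vnn Fnn by (cases z) (auto simp: J_def indicator_def intro!: mult_nonneg_nonneg)
  have Gle: "G z \<le> J 3 z" for z
    using hnn[of 3 z] by (auto simp: G_def indicator_def)
  have Gnn: "0 \<le> G z" for z
    using hnn[of 3 z] by (auto simp: G_def indicator_def)
  have "J 2 z \<le> 2 * J 3 z + 8 / \<Theta> * G ((- (\<tau> / 2), 0) + z)" for z
  proof -
    obtain t \<xi> where z: "z = (t, \<xi>)" by (cases z)
    show ?thesis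
    proof (cases "0 < t \<and> t < \<tau>")
      case False
      have "J 2 z = 0"
      proof (cases "0 < t")
        case True
        then show ?thesis using False \<tau> by (simp add: J_def z tcut_eq_0)
      qed (simp add: J_def z)
      then show ?thesis using hnn[of 3 z] Gnn \<Theta> by simp
    next
      case True
      have c: "0 \<le> v t \<xi> * wt \<mu> \<xi> * F (cyl \<xi>)" using True \<tau> vnn Fnn by simp
      show ?thesis
      proof (cases "t \<le> \<tau> / 2")
        case early: True
        have "tcut 2 \<tau> t \<le> 2 * tcut 3 \<tau> t"
        proof -
          have "1 / 2 \<le> 1 - t / \<tau>" using early \<tau> by (simp add: field_simps)
          then have "1 / 2 \<le> max 0 (1 - t / \<tau>)" by (rule max.coboundedI2)
          then have "1 / 2 * tcut 2 \<tau> t \<le> max 0 (1 - t / \<tau>) * tcut 2 \<tau> t" by (rule mult_right_mono) simp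
          then show ?thesis using tcut_Suc[of 2 \<tau> t] by (simp add: eval_nat_numeral)
        qed
        from mult_left_mono[OF this c] have "J 2 z \<le> 2 * J 3 z"
          using True \<tau> by (simp add: J_def z mult_ac)
        then show ?thesis using Gnn[of "(- (\<tau> / 2), 0) + z"] \<Theta>
          by (smt (verit, best) divide_nonneg_pos mult_nonneg_nonneg)
      next
        case late: False
        define s where "s = t - \<tau> / 2"
        have s: "0 < s" "s < \<tau> / 2" "s \<le> t" using late True by (auto simp: s_def)
        have "1 / 2 \<le> 1 - s / \<tau>" using s \<tau> by (simp add: field_simps)
        then have "(1 / 2) ^ 3 \<le> tcut 3 \<tau> s" unfolding tcut_def by (rule pos_pow_ge_half)
        then have s8: "1 / 8 \<le> tcut 3 \<tau> s" by (simp add: power_divide)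
        have t1: "tcut 2 \<tau> t \<le> 1" using True \<tau> by (intro tcut_le_1) auto
        have "J 2 z = tcut 2 \<tau> t * (v t \<xi> * wt \<mu> \<xi> * F (cyl \<xi>))"
          using True \<tau> by (simp add: J_def z)
        also have "\<dots> \<le> 1 * (v t \<xi> * wt \<mu> \<xi> * F (cyl \<xi>))" using t1 c by (intro mult_right_mono) auto
        also have "\<dots> = 1 / \<Theta> * (\<Theta> * v t \<xi> * (wt \<mu> \<xi> * F (cyl \<xi>)))" using \<Theta> by simp
        also have "\<dots> \<le> 1 / \<Theta> * (v s \<xi> * (wt \<mu> \<xi> * F (cyl \<xi>)))"
          using \<Theta>(2)[OF s(1,3), of \<xi>] True \<tau> \<Theta>(1) Fnn by (intro mult_left_mono mult_right_mono) auto
        also have "\<dots> \<le> 1 / \<Theta> * (8 * tcut 3 \<tau> s * (v s \<xi> * (wt \<mu> \<xi> * F (cyl \<xi>))))"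
        proof -
          have "1 * (v s \<xi> * (wt \<mu> \<xi> * F (cyl \<xi>))) \<le> 8 * tcut 3 \<tau> s * (v s \<xi> * (wt \<mu> \<xi> * F (cyl \<xi>)))"
            using s8 s \<tau> vnn Fnn by (intro mult_right_mono) auto
          then show ?thesis using \<Theta>(1) by (intro mult_left_mono) auto
        qed
        also have "\<dots> = 8 / \<Theta> * G ((- (\<tau> / 2), 0) + z)"
          using s \<tau> by (simp add: G_def J_def z s_def)
        finally show ?thesis using hnn[of 3 z] by linarith
      qed
    qed
  qed
  then have "(LINT z|lebesgue. J 2 z) \<le> (LINT z|lebesgue. 2 * J 3 z + 8 / \<Theta> * G ((- (\<tau> / 2), 0) + z))"
    using iJ tr(1) by (intro integral_mono) auto
  also have "\<dots> = 2 * (LINT z|lebesgue. J 3 z) + 8 / \<Theta> * (LINT z|lebesgue. G z)"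
    using iJ tr by simp
  also have "\<dots> \<le> 2 * (LINT z|lebesgue. J 3 z) + 8 / \<Theta> * (LINT z|lebesgue. J 3 z)"
    using \<Theta>(1) iG iJ Gle by (intro add_left_mono mult_left_mono integral_mono) auto
  finally show ?thesis by (simp add: integral_slab J_def algebra_simps)
qed

text \<open>All terms on the right of the weak identity are nonnegative, so the L term is bounded by the
  time-derivative term, and this by k times the zero-order term. Hence v times the cutoff satisfies the
  hypothesis of the vanishing lemma on space-time.\<close>

lemma nonneg_solution_vanishes:
  assumes vnn: "\<And>t \<xi>. 0 < t \<Longrightarrow> t < T \<Longrightarrow> 0 \<le> v t \<xi>"
    and \<Theta>: "0 < \<Theta>" "\<And>s t \<xi>. 0 < s \<Longrightarrow> s \<le> t \<Longrightarrow> t < T \<Longrightarrow> \<Theta> * v t \<xi> \<le> v s \<xi>"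
    and bound: "AE z in S. v (fst z) (snd z) \<le> C0 * knorm4 (cyl (snd z)) powr (\<mu> / 4)" "0 \<le> C0"
  shows "AE z in S. v (fst z) (snd z) = 0"
proof -
  have step: "AE z in S. fst z < \<tau> \<longrightarrow> v (fst z) (snd z) = 0" if \<tau>: "0 < \<tau>" "\<tau> < T" for \<tau>
  proof -
    define k where "k = 3 / \<tau> * (2 + 8 / \<Theta>)"
    have k: "0 < k" using \<tau> \<Theta> by (simp add: k_def add_pos_pos)
    have "AE z in S. v (fst z) (snd z) * tcut 3 \<tau> (fst z) = 0"
    proof (rule weighted_supersolution_vanishes[OF \<mu> k, where p="\<lambda>z. cyl (snd z)" and ?C0.0=C0
          and ?C1.0="T * 2 ^ (2 * CARD('n) + 1)"])
      show "(\<lambda>z. cyl (snd z)) \<in> borel_measurable S" by (rule borel_measurable_slab) measurable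
      show "AE z in S. cyl (snd z) \<noteq> 0"
        using AE_slab_nonzero by eventually_elim (simp add: cyl_eq_0_iff)
      show "(\<lambda>z. v (fst z) (snd z) * tcut 3 \<tau> (fst z)) \<in> borel_measurable S"
        by (intro borel_measurable_times v_meas borel_measurable_slab) measurable
      show "AE z in S. 0 \<le> v (fst z) (snd z) * tcut 3 \<tau> (fst z)"
        using AE_slab_mem by eventually_elim (use vnn in auto)
      show "AE z in S. v (fst z) (snd z) * tcut 3 \<tau> (fst z) \<le> C0 * knorm4 (cyl (snd z)) powr (\<mu> / 4)"
        using AE_slab_mem bound(1)
      proof eventually_elim
        case (elim z)
        have "v (fst z) (snd z) * tcut 3 \<tau> (fst z) \<le> v (fst z) (snd z) * 1"
          using elim \<tau> vnn by (intro mult_left_mono tcut_le_1) auto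
        then show ?case using elim by simp
      qed
      show "emeasure S {z \<in> space S. knorm4 (cyl (snd z)) < r} \<le> ennreal (T * 2 ^ (2 * CARD('n) + 1) * r powr ((2 * N + 2) / 4))"
        if "0 < r" for r
        using emeasure_slab_koranyi_ball[OF that T, where 'n='n] by (simp add: N space_restrict_space)
      fix F MF assume F: "radial_test N \<mu> F MF"
      note i = integrable_pieces[of 3, OF _ \<tau> F, simplified]
      note w = weak_identity_cut[of 3, OF _ \<tau> F, simplified]
      have eq: "(\<lambda>z. v (fst z) (snd z) * tcut 3 \<tau> (fst z) * knorm4 (cyl (snd z)) powr (- \<mu> / 2) * (k * F (cyl (snd z)) - MF (cyl (snd z))))
        = (\<lambda>z. k * (vint 3 \<tau> F z)
             - v (fst z) (snd z) * wt \<mu> (snd z) * tcut 3 \<tau> (fst z) * MF (cyl (snd z)))"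
        by (simp add: wt_def fun_eq_iff algebra_simps)
      have "0 \<le> - (LINT z|S. Aint 3 \<tau> F MF z)"
        unfolding w(5) by (intro add_nonneg_nonneg integral_nonneg_AE w)
      then have "(LINT z|S. vint 3 \<tau> MF z)
        \<le> 3 / \<tau> * (LINT z|S. vint 2 \<tau> F z)"
        unfolding i(4) by simp
      also have "\<dots> \<le> 3 / \<tau> * ((2 + 8 / \<Theta>) * (LINT z|S. vint 3 \<tau> F z))"
        using time_shift_estimate[OF vnn \<Theta> \<tau> F] \<tau> by (intro mult_left_mono) auto
      also have "\<dots> = k * (LINT z|S. vint 3 \<tau> F z)"
        by (simp add: k_def)
      finally show "integrable S (\<lambda>z. v (fst z) (snd z) * tcut 3 \<tau> (fst z) * knorm4 (cyl (snd z)) powr (- \<mu> / 2) * (k * F (cyl (snd z)) - MF (cyl (snd z)))) \<and>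
        0 \<le> (LINT z|S. v (fst z) (snd z) * tcut 3 \<tau> (fst z) * knorm4 (cyl (snd z)) powr (- \<mu> / 2) * (k * F (cyl (snd z)) - MF (cyl (snd z))))"
        unfolding eq using i(1-3) by simp
    qed (use bound T in auto)
    then show ?thesis
      by eventually_elim (use tcut_pos[OF _ \<tau>(1), of _ 3] in force)
  qed
  then show ?thesis by (rule AE_slab_exhaust)
qed

end

section \<open>The initial datum of a solution decreasing in time\<close>

lemma indicator_slab: "indicator (slab T) z = indicator {0<..<T} (fst z)"
  by (cases z) (simp add: indicator_def)

lemma slab_product_integral:
  fixes g :: "'b::euclidean_space \<Rightarrow> real"
  assumes "integrable lebesgue g" "0 < \<tau>" "\<tau> < T" "0 < l"
  shows "integrable (lebesgue_on (slab T)) (\<lambda>z. tcut l \<tau> (fst z) * g (snd z))"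
    "(LINT z|lebesgue_on (slab T). tcut l \<tau> (fst z) * g (snd z)) = \<tau> / (real l + 1) * (LINT \<xi>|lebesgue. g \<xi>)"
proof -
  note c = tcut_integral[OF assms(2,3), of l]
  note p = product_integral_lebesgue[OF c(1) assms(1)]
  have eq: "(\<lambda>z. indicator (slab T) z * (tcut l \<tau> (fst z) * g (snd z)))
     = (\<lambda>z. indicator {0<..<T} (fst z) * tcut l \<tau> (fst z) * g (snd z))"
    by (simp add: indicator_slab mult.assoc)
  show "integrable (lebesgue_on (slab T)) (\<lambda>z. tcut l \<tau> (fst z) * g (snd z))"
    unfolding integrable_slab_iff eq using p(1) .
  show "(LINT z|lebesgue_on (slab T). tcut l \<tau> (fst z) * g (snd z)) = \<tau> / (real l + 1) * (LINT \<xi>|lebesgue. g \<xi>)"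
    unfolding integral_slab eq using p(2) c(2)[OF assms(4)] by simp
qed

context weak_evolution begin

text \<open>Since v \<le> v0, the time-derivative term falls short of the initial term by the nonnegative gap below,
  and the weak identity bounds the gap by the L term.\<close>

lemma initial_gap:
  assumes le0: "AE \<xi> in lebesgue. \<forall>t\<in>{0<..<T}. v t \<xi> \<le> v0 \<xi>"
    and \<tau>: "0 < \<tau>" "\<tau> < T" and F: "radial_test N \<mu> F MF"
  defines "gap \<equiv> 3 / \<tau> * (LINT z|S. (v0 (snd z) - v (fst z) (snd z)) * wt \<mu> (snd z) * tcut 2 \<tau> (fst z) * F (cyl (snd z)))"
  shows "integrable S (\<lambda>z. (v0 (snd z) - v (fst z) (snd z)) * wt \<mu> (snd z) * tcut 2 \<tau> (fst z) * F (cyl (snd z)))"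
    "0 \<le> gap" "gap \<le> - (LINT z|S. vint 3 \<tau> MF z)"
proof -
  have Fnn: "0 \<le> F q" for q by (rule radial_test_nonneg[OF F])
  note i = integrable_pieces[of 3, OF _ \<tau> F, simplified]
  note w = weak_identity_cut[of 3, OF _ \<tau> F, simplified]
  let ?h = "\<lambda>z. vint 2 \<tau> F z"
  let ?init = "\<lambda>z. tcut 2 \<tau> (fst z) * (wt \<mu> (snd z) * v0 (snd z) * F (cyl (snd z)))"
  note pr = slab_product_integral[OF w(4) \<tau>, of 2, simplified]
  have eq: "(\<lambda>z. (v0 (snd z) - v (fst z) (snd z)) * wt \<mu> (snd z) * tcut 2 \<tau> (fst z) * F (cyl (snd z))) = (\<lambda>z. ?init z - ?h z)"
    by (rule ext) algebra
  show "integrable S (\<lambda>z. (v0 (snd z) - v (fst z) (snd z)) * wt \<mu> (snd z) * tcut 2 \<tau> (fst z) * F (cyl (snd z)))"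
    unfolding eq using pr(1) i(1) by (rule Bochner_Integration.integrable_diff)
  have "0 \<le> (LINT z|S. (v0 (snd z) - v (fst z) (snd z)) * wt \<mu> (snd z) * tcut 2 \<tau> (fst z) * F (cyl (snd z)))"
    by (rule integral_nonneg_AE, use AE_slab_snd[OF le0, of T] AE_slab_mem in eventually_elim)
       (use Fnn in \<open>auto intro!: mult_nonneg_nonneg\<close>)
  then show "0 \<le> gap" using \<tau> by (simp add: gap_def)
  have "gap = 3 / \<tau> * ((LINT z|S. ?init z) - (LINT z|S. ?h z))"
    unfolding gap_def eq using pr(1) i(1) by simp
  also have "\<dots> = (LINT \<xi>|lebesgue. wt \<mu> \<xi> * v0 \<xi> * F (cyl \<xi>)) - 3 / \<tau> * (LINT z|S. ?h z)"
    using pr(2) \<tau> by (simp add: right_diff_distrib field_simps)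
  also have "\<dots> \<le> - (LINT z|S. Aint 3 \<tau> F MF z) - 3 / \<tau> * (LINT z|S. ?h z)"
  proof -
    have "0 \<le> (LINT z|S. Bint 3 \<tau> F z) + (LINT z|S. Fint 3 \<tau> F z)"
      by (intro add_nonneg_nonneg integral_nonneg_AE w)
    then show ?thesis unfolding w(5) by simp
  qed
  also have "\<dots> = - (LINT z|S. vint 3 \<tau> MF z)"
    unfolding i(4) by simp
  finally show "gap \<le> - (LINT z|S. vint 3 \<tau> MF z)" .
qed

text \<open>For small \<tau> the integrand is dominated by a multiple of the one for \<tau> = T/2, and its support in
  time shrinks to the empty set.\<close>

lemma short_time_limit:
  assumes F: "radial_test N \<mu> F MF"
  shows "(\<lambda>n. LINT z|S. vint 3 (T / (4 * real (Suc n))) MF z)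
     \<longlonglongrightarrow> 0"
proof -
  define \<tau> where "\<tau> = (\<lambda>n::nat. T / (4 * real (Suc n)))"
  have \<tau>: "0 < \<tau> n" "\<tau> n \<le> T / 4" "\<tau> n < T" for n
  proof -
    show "0 < \<tau> n" using T by (simp add: \<tau>_def)
    show le: "\<tau> n \<le> T / 4" unfolding \<tau>_def using T by (intro divide_left_mono) auto
    show "\<tau> n < T" using le T by linarith
  qed
  have half: "0 < T / 2" "T / 2 < T" using T by auto
  let ?g = "\<lambda>z. vint 3 (T / 2) MF z"
  let ?s = "\<lambda>n z. vint 3 (\<tau> n) MF z"
  have "(\<lambda>n. LINT z|S. ?s n z) \<longlonglongrightarrow> (LINT z|S. 0)"
  proof (rule integral_dominated_convergence[where w="\<lambda>z. 8 * \<bar>?g z\<bar>"])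
    show "integrable S (\<lambda>z. 8 * \<bar>?g z\<bar>)"
      using integrable_pieces(3)[of 3, OF _ half F] by (intro integrable_mult_right integrable_abs) simp
    show "?s n \<in> borel_measurable S" for n
      using integrable_pieces(3)[of 3, OF _ \<tau>(1,3) F] by (intro borel_measurable_integrable) simp
    show "AE z in S. (\<lambda>n. ?s n z) \<longlonglongrightarrow> 0"
      using AE_slab_mem
    proof eventually_elim
      case (elim z)
      obtain m where m: "T / (4 * fst z) < real m" using reals_Archimedean2 by blast
      have "?s n z = 0" if "m \<le> n" for n
      proof -
        have "T / (4 * fst z) < real (Suc n)" using m that by simp
        then have "\<tau> n \<le> fst z" unfolding \<tau>_def using elim by (simp add: field_simps)
        then show ?thesis using \<tau>(1)[of n] by (simp add: tcut_eq_0)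
      qed
      then show ?case by (intro tendsto_eventually) (auto simp: eventually_sequentially)
    qed
    show "AE z in S. norm (?s n z) \<le> 8 * \<bar>?g z\<bar>" for n
      using AE_slab_mem
    proof eventually_elim
      case (elim z)
      have "tcut 3 (\<tau> n) (fst z) \<le> 8 * tcut 3 (T / 2) (fst z)"
      proof (cases "\<tau> n \<le> fst z")
        case True then show ?thesis using \<tau>(1)[of n] by (simp add: tcut_eq_0)
      next
        case False
        have "1 / 2 \<le> 1 - fst z / (T / 2)" using False \<tau>(2)[of n] T by (simp add: field_simps)
        then have "(1 / 2) ^ 3 \<le> tcut 3 (T / 2) (fst z)" unfolding tcut_def by (rule pos_pow_ge_half)
        moreover have "tcut 3 (\<tau> n) (fst z) \<le> 1" using elim \<tau> by (intro tcut_le_1) auto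
        ultimately show ?thesis by (simp add: power_divide)
      qed
      from mult_right_mono[OF this, of "\<bar>v (fst z) (snd z) * wt \<mu> (snd z) * MF (cyl (snd z))\<bar>"]
      show ?case by (simp add: abs_mult mult_ac)
    qed
  qed simp
  then show ?thesis by (simp add: \<tau>_def)
qed

text \<open>For every \<tau> the gap inequality contains the supersolution inequality for a time mean of v over
  (0, \<tau>). These means tend to v0: tested with the operator on F, their difference from v0 is
  controlled by the gap for a profile F1 that dominates this operator, and that gap tends to 0.\<close>

lemma initial_datum_superharmonic:
  assumes le0: "AE \<xi> in lebesgue. \<forall>t\<in>{0<..<T}. v t \<xi> \<le> v0 \<xi>"
    and v0m: "v0 \<in> borel_measurable lebesgue"
    and F: "radial_test N \<mu> F MF"
  shows "integrable lebesgue (\<lambda>\<xi>. v0 \<xi> * wt \<mu> \<xi> * MF (cyl \<xi>))"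
    "(LINT \<xi>|lebesgue. v0 \<xi> * wt \<mu> \<xi> * MF (cyl \<xi>)) \<le> 0"
proof -
  obtain Fs Ft Fss Fst Ftt R where C2: "C2_profile F Fs Ft Fss Fst Ftt"
    and MF: "\<And>q. MF q = cyl_op N \<mu> q (Fs q) (Ft q) (Fss q) (Ftt q)"
    and supp: "\<And>q. R \<le> knorm4 q \<Longrightarrow> F q = 0"
    using radial_testD[OF F] by metis
  have supp': "R < knorm4 q \<Longrightarrow> F q = 0" for q using supp by simp
  obtain C where C: "0 \<le> C" "\<And>q. \<bar>MF q\<bar> \<le> C"
    by (rule cyl_op_bounded[OF C2 supp', of R N \<mu>, folded MF]) (use \<mu> that in auto)
  \<comment> \<open>On the support of F the profile F1 is at least (1/2)^3.\<close>
  define R1 where "R1 = 2 * max R 1"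
  have R1: "0 < R1" "2 * R \<le> R1" by (auto simp: R1_def)
  define F1 where "F1 = (\<lambda>q. pos_pow 3 (1 - knorm4 q / R1))"
  obtain MF1 where F1: "radial_test N \<mu> F1 MF1"
    by (rule power_cut_profile[of 3 R1 \<mu> N, folded F1_def]) (use R1 \<mu> that in auto)
  have dom: "\<bar>MF q\<bar> \<le> 8 * C * F1 q" for q
  proof (cases "knorm4 q \<le> R")
    case True
    have "1 / 2 \<le> 1 - knorm4 q / R1" using True R1 by (simp add: field_simps)
    then have "(1 / 2) ^ 3 \<le> F1 q" unfolding F1_def by (rule pos_pow_ge_half)
    then have "C * (1 / 8) \<le> C * F1 q" using C by (intro mult_left_mono) (auto simp: power_divide)
    then show ?thesis using C(2)[of q] by simp
  next
    case False
    then have "MF q = 0" using C2_profile_vanish[OF C2 supp', where q=q] by (simp add: MF cyl_op_def)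
    then show ?thesis using C radial_test_nonneg[OF F1, of q] by simp
  qed
  note half = half_gt_zero[OF T]
  have iF1: "integrable lebesgue (\<lambda>\<xi>. wt \<mu> \<xi> * v0 \<xi> * F1 (cyl \<xi>))"
    by (rule weak_identity_cut(4)[of 3, OF _ half _ F1]) (use T in auto)
  have [measurable]: "MF \<in> borel_measurable borel" by (rule radial_test_measurable(2)[OF F])
  show iMF: "integrable lebesgue (\<lambda>\<xi>. v0 \<xi> * wt \<mu> \<xi> * MF (cyl \<xi>))"
  proof (rule Bochner_Integration.integrable_bound[OF integrable_mult_right[OF iF1, of "8 * C"]])
    have "(\<lambda>\<xi>. wt \<mu> \<xi> * MF (cyl \<xi>)) \<in> borel_measurable lebesgue"
      by (rule measurable_completion) measurable
    from borel_measurable_times[OF v0m this]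
    show "(\<lambda>\<xi>. v0 \<xi> * wt \<mu> \<xi> * MF (cyl \<xi>)) \<in> borel_measurable lebesgue" by (simp add: mult.assoc)
    have "norm (v0 \<xi> * wt \<mu> \<xi> * MF (cyl \<xi>)) \<le> norm (8 * C * (wt \<mu> \<xi> * v0 \<xi> * F1 (cyl \<xi>)))" for \<xi>
    proof -
      have "\<bar>v0 \<xi> * wt \<mu> \<xi>\<bar> * \<bar>MF (cyl \<xi>)\<bar> \<le> \<bar>v0 \<xi> * wt \<mu> \<xi>\<bar> * (8 * C * F1 (cyl \<xi>))"
        by (intro mult_left_mono dom) simp
      then show ?thesis using C radial_test_nonneg[OF F1, of "cyl \<xi>"] by (simp add: abs_mult mult_ac)
    qed
    then show "AE \<xi> in lebesgue. norm (v0 \<xi> * wt \<mu> \<xi> * MF (cyl \<xi>)) \<le> norm (8 * C * (wt \<mu> \<xi> * v0 \<xi> * F1 (cyl \<xi>)))" by simp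
  qed
  define K where "K = (LINT \<xi>|lebesgue. v0 \<xi> * wt \<mu> \<xi> * MF (cyl \<xi>))"
  define E where "E = (\<lambda>\<tau>. LINT z|S. vint 3 \<tau> MF1 z)"
  have KE: "K \<le> 32 / 3 * C * - E \<tau>" if \<tau>: "0 < \<tau>" "\<tau> < T" for \<tau>
  proof -
    note pr = slab_product_integral[OF iMF \<tau>, of 3, simplified]
    note i2 = integrable_pieces(3)[of 3, OF _ \<tau> F, simplified]
    let ?d = "\<lambda>z. (v0 (snd z) - v (fst z) (snd z)) * wt \<mu> (snd z) * tcut 2 \<tau> (fst z) * F1 (cyl (snd z))"
    note g1 = initial_gap[OF le0 \<tau> F1]
    note g2 = initial_gap(2,3)[OF le0 \<tau> F]
    have e2: "(LINT z|S. vint 3 \<tau> MF z) \<le> 0"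
      using g2 by linarith
    have "\<tau> / 4 * K - (LINT z|S. vint 3 \<tau> MF z)
      = (LINT z|S. tcut 3 \<tau> (fst z) * (v0 (snd z) * wt \<mu> (snd z) * MF (cyl (snd z)))
           - v (fst z) (snd z) * wt \<mu> (snd z) * tcut 3 \<tau> (fst z) * MF (cyl (snd z)))"
      using pr i2 by (simp add: K_def)
    also have "\<dots> \<le> (LINT z|S. 8 * C * ?d z)"
    proof (rule integral_mono_AE)
      show "integrable S (\<lambda>z. tcut 3 \<tau> (fst z) * (v0 (snd z) * wt \<mu> (snd z) * MF (cyl (snd z)))
           - v (fst z) (snd z) * wt \<mu> (snd z) * tcut 3 \<tau> (fst z) * MF (cyl (snd z)))"
        using pr(1) i2 by (rule Bochner_Integration.integrable_diff)
      show "integrable S (\<lambda>z. 8 * C * ?d z)" using g1(1) by (rule integrable_mult_right)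
      show "AE z in S. tcut 3 \<tau> (fst z) * (v0 (snd z) * wt \<mu> (snd z) * MF (cyl (snd z)))
           - v (fst z) (snd z) * wt \<mu> (snd z) * tcut 3 \<tau> (fst z) * MF (cyl (snd z)) \<le> 8 * C * ?d z"
        using AE_slab_mem AE_slab_snd[OF le0, of T]
      proof eventually_elim
        case (elim z)
        define D where "D = (v0 (snd z) - v (fst z) (snd z)) * wt \<mu> (snd z)"
        have D: "0 \<le> D" using elim by (simp add: D_def)
        have "max 0 (1 - fst z / \<tau>) \<le> 1" using elim \<tau> by simp
        then have "tcut 3 \<tau> (fst z) \<le> tcut 2 \<tau> (fst z)"
          using mult_right_mono[of "max 0 (1 - fst z / \<tau>)" 1 "tcut 2 \<tau> (fst z)"] tcut_Suc[of 2 \<tau> "fst z"]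
          by (simp add: eval_nat_numeral)
        then have "D * tcut 3 \<tau> (fst z) * \<bar>MF (cyl (snd z))\<bar> \<le> D * tcut 2 \<tau> (fst z) * (8 * C * F1 (cyl (snd z)))"
          using D dom by (intro mult_mono mult_left_mono) auto
        moreover have "D * tcut 3 \<tau> (fst z) * MF (cyl (snd z)) \<le> D * tcut 3 \<tau> (fst z) * \<bar>MF (cyl (snd z))\<bar>"
          using D by (intro mult_left_mono) auto
        ultimately show ?case by (simp add: D_def algebra_simps)
      qed
    qed
    also have "\<dots> = 8 * C * (LINT z|S. ?d z)" by simp
    finally have "\<tau> / 4 * K \<le> 8 * C * (LINT z|S. ?d z)" using e2 by linarith
    also have "\<dots> = 8 * C * (\<tau> / 3) * (3 / \<tau> * (LINT z|S. ?d z))" using \<tau> by simp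
    also have "\<dots> \<le> 8 * C * (\<tau> / 3) * - E \<tau>"
      using g1(3) C \<tau> unfolding E_def by (intro mult_left_mono) auto
    finally have "\<tau> * (K / 4) \<le> \<tau> * (8 / 3 * C * - E \<tau>)" by (simp add: mult_ac)
    then have "K / 4 \<le> 8 / 3 * C * - E \<tau>" using \<tau> by (simp only: mult_le_cancel_left_pos)
    then show ?thesis by linarith
  qed
  have "(\<lambda>n. 32 / 3 * C * - E (T / (4 * real (Suc n)))) \<longlonglongrightarrow> 32 / 3 * C * - 0"
    unfolding E_def by (intro tendsto_intros short_time_limit[OF F1])
  then have lim: "(\<lambda>n. 32 / 3 * C * - E (T / (4 * real (Suc n)))) \<longlonglongrightarrow> 0" by simp
  have "K \<le> 0"
  proof (rule LIMSEQ_le_const[OF lim], intro exI[of _ 0] allI impI KE)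
    fix n
    show "0 < T / (4 * real (Suc n))" using T by simp
    have "T / (4 * real (Suc n)) \<le> T / 4" using T by (intro divide_left_mono) auto
    then show "T / (4 * real (Suc n)) < T" using T by linarith
  qed
  then show "(LINT \<xi>|lebesgue. v0 \<xi> * wt \<mu> \<xi> * MF (cyl \<xi>)) \<le> 0" by (simp add: K_def)
qed

text \<open>The datum is a nonnegative supersolution of L, hence of L + w, and bounded by C0 \<rho>^\<mu>.\<close>

lemma initial_datum_vanishes:
  assumes le0: "AE \<xi> in lebesgue. \<forall>t\<in>{0<..<T}. v t \<xi> \<le> v0 \<xi>"
    and v0m: "v0 \<in> borel_measurable lebesgue"
    and bound: "AE \<xi> in lebesgue. v0 \<xi> \<le> C0 * knorm4 (cyl \<xi>) powr (\<mu> / 4)" "0 \<le> C0"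
  shows "AE \<xi> in lebesgue. v0 \<xi> = 0"
proof (rule weighted_supersolution_vanishes[OF \<mu> zero_less_one, where p=cyl and ?C0.0=C0
          and ?C1.0="2 ^ (2 * CARD('n) + 1)"])
  show "cyl \<in> borel_measurable (lebesgue :: 'n heis measure)" by (rule measurable_completion) measurable
  have "AE \<xi> in lebesgue. \<xi> \<noteq> (0 :: 'n heis)" by (rule AE_completion[OF AE_lborel_singleton])
  then show "AE \<xi> in lebesgue. cyl (\<xi> :: 'n heis) \<noteq> 0" by eventually_elim (simp add: cyl_eq_0_iff)
  show "emeasure lebesgue {\<xi> \<in> space lebesgue. knorm4 (cyl (\<xi> :: 'n heis)) < r} \<le> ennreal (2 ^ (2 * CARD('n) + 1) * r powr ((2 * N + 2) / 4))"
    if "0 < r" for r using emeasure_koranyi_ball[OF that, where 'n='n] by (simp add: N)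
  fix F MF assume F: "radial_test N \<mu> F MF"
  note s = initial_datum_superharmonic[OF le0 v0m F]
  have iF: "integrable lebesgue (\<lambda>\<xi>. wt \<mu> \<xi> * v0 \<xi> * F (cyl \<xi>))"
    by (rule weak_identity_cut(4)[of 3, OF _ half_gt_zero[OF T] _ F]) (use T in auto)
  have nn: "0 \<le> (LINT \<xi>|lebesgue. wt \<mu> \<xi> * v0 \<xi> * F (cyl \<xi>))"
    by (rule integral_nonneg_AE, use v0_nonneg in eventually_elim) (use radial_test_nonneg[OF F] in simp)
  have eq: "(\<lambda>\<xi>. v0 \<xi> * knorm4 (cyl \<xi>) powr (- \<mu> / 2) * (1 * F (cyl \<xi>) - MF (cyl \<xi>)))
    = (\<lambda>\<xi>. wt \<mu> \<xi> * v0 \<xi> * F (cyl \<xi>) - v0 \<xi> * wt \<mu> \<xi> * MF (cyl \<xi>))"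
    by (simp add: wt_def fun_eq_iff algebra_simps)
  show "integrable lebesgue (\<lambda>\<xi>. v0 \<xi> * knorm4 (cyl \<xi>) powr (- \<mu> / 2) * (1 * F (cyl \<xi>) - MF (cyl \<xi>))) \<and>
     0 \<le> (LINT \<xi>|lebesgue. v0 \<xi> * knorm4 (cyl \<xi>) powr (- \<mu> / 2) * (1 * F (cyl \<xi>) - MF (cyl \<xi>)))"
    unfolding eq using s iF nn by simp
qed (use v0m v0_nonneg bound in auto)

end

section \<open>Nonpositive solutions\<close>

lemma integrable_shifted_powr:
  fixes c t T :: real
  assumes "-1 < c" "0 < T"
  shows "integrable lebesgue (\<lambda>s. indicator {0..T} (- t + s) * (- t + s) powr c)"
proof -
  have "(\<lambda>s. s powr c) integrable_on {0..T}"
    using has_integral_powr_from_0[of c T] assms by (auto simp: integrable_on_def)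
  then have "(\<lambda>s. s powr c) absolutely_integrable_on {0..T}"
    by (intro nonnegative_absolutely_integrable_1) auto
  then have "integrable lebesgue (\<lambda>s. indicator {0..T} s * s powr c)"
    by (simp add: set_integrable_def)
  from translate_lebesgue(1)[OF this, of "- t"] show ?thesis .
qed

text \<open>On (t, \<tau>) the kernel is at least \<tau>^(\<gamma>-1), and the cutoff has an explicit primitive.\<close>

lemma frac_int_tcut_lower:
  assumes \<gamma>: "0 < \<gamma>" "\<gamma> < 1" and t: "0 < t" "t < \<tau>" "\<tau> < T" and l: "0 < l"
  shows "\<tau> powr \<gamma> / (Gamma \<gamma> * (real l + 1)) * tcut (l + 1) \<tau> t \<le> frac_int T \<gamma> (tcut l \<tau>) t"
proof -
  have \<tau>: "0 < \<tau>" using t by simp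
  define g where "g = (\<lambda>s. indicator {t<..<T} s *\<^sub>R ((s - t) powr (\<gamma> - 1) * tcut l \<tau> s))"
  have ig: "integrable lebesgue g"
  proof -
    have "integrable lebesgue (\<lambda>s. indicator {t<..<T} s * tcut l \<tau> s * (indicator {0..T} (- t + s) * (- t + s) powr (\<gamma> - 1)))"
    proof (rule integrable_bounded_mult[OF integrable_shifted_powr, where C=1])
      show "(\<lambda>s. indicator {t<..<T} s * tcut l \<tau> s) \<in> borel_measurable lebesgue"
        by (rule measurable_completion) measurable
      show "AE s in lebesgue. \<bar>indicator {t<..<T} s * tcut l \<tau> s\<bar> \<le> 1"
        using t \<tau> by (intro AE_I2) (auto simp: indicator_def intro!: tcut_le_1)
    qed (use \<gamma> t in auto)
    also have "(\<lambda>s. indicator {t<..<T} s * tcut l \<tau> s * (indicator {0..T} (- t + s) * (- t + s) powr (\<gamma> - 1))) = g"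
      using t by (auto simp: g_def indicator_def fun_eq_iff)
    finally show ?thesis .
  qed
  define h where "h = (\<lambda>s. \<tau> powr (\<gamma> - 1) * (indicator {t..\<tau>} s *\<^sub>R tcut l \<tau> s))"
  have si: "set_integrable lborel {t..\<tau>} (tcut l \<tau>)"
    by (intro borel_integrable_atLeastAtMost' continuous_intros)
  then have ih: "integrable lborel h" unfolding h_def set_integrable_def by (rule integrable_mult_right)
  then have hm: "h \<in> borel_measurable lborel" by (rule borel_measurable_integrable)
  have "(LINT s|lebesgue. h s) = \<tau> powr (\<gamma> - 1) * (\<tau> / (real l + 1) * tcut (l + 1) \<tau> t)"
    unfolding integral_completion[OF hm] unfolding h_def integral_mult_right_zero
      tcut_interval_integral[OF \<tau> less_imp_le[OF t(2)] l] ..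
  also have "\<dots> = \<tau> powr \<gamma> / (real l + 1) * tcut (l + 1) \<tau> t"
    using \<tau> by (simp add: powr_diff)
  finally have Ih: "(LINT s|lebesgue. h s) = \<tau> powr \<gamma> / (real l + 1) * tcut (l + 1) \<tau> t" .
  have "(LINT s|lebesgue. h s) \<le> (LINT s|lebesgue. g s)"
  proof (rule integral_mono_AE)
    show "integrable lebesgue h" using ih hm by (simp add: integrable_completion)
    show "AE s in lebesgue. h s \<le> g s"
      using AE_completion[OF AE_lborel_singleton[of t]]
    proof eventually_elim
      case (elim s)
      show ?case
      proof (cases "t < s \<and> s \<le> \<tau>")
        case True
        have "\<tau> powr (\<gamma> - 1) \<le> (s - t) powr (\<gamma> - 1)"
          using True t \<gamma> by (intro powr_mono2') auto
        then have "\<tau> powr (\<gamma> - 1) * tcut l \<tau> s \<le> (s - t) powr (\<gamma> - 1) * tcut l \<tau> s" by (rule mult_right_mono) simp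
        then show ?thesis using True t by (simp add: h_def g_def)
      qed (use elim in \<open>auto simp: h_def g_def indicator_def\<close>)
    qed
  qed (rule ig)
  then have le: "\<tau> powr \<gamma> / (real l + 1) * tcut (l + 1) \<tau> t \<le> (LINT s|lebesgue. g s)" unfolding Ih .
  have "1 / Gamma \<gamma> * (\<tau> powr \<gamma> / (real l + 1) * tcut (l + 1) \<tau> t) \<le> 1 / Gamma \<gamma> * (LINT s|lebesgue. g s)"
    using \<gamma> le by (intro mult_left_mono) (auto intro!: Gamma_real_pos less_imp_le)
  then show ?thesis
    by (simp add: frac_int_def set_lebesgue_integral_def g_def)
qed

text \<open>Either the linear term is bounded by the absorption term, or X is smaller than an explicit power
  of the ratio of the two coefficients. In the second case all powers of G, R and x that remain have
  the right sign, and the power of y is controlled by \<epsilon>.\<close>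

lemma absorption:
  fixes X G x y \<epsilon> K c0 R I \<mu> p :: real and l m :: nat
  assumes p: "1 < p" and \<mu>: "0 < \<mu>" and X: "0 \<le> X" and x: "0 < x" "x \<le> 1" and y: "0 < y" "y \<le> \<epsilon>"
    and G: "1 \<le> G" and R: "1 \<le> R" and K: "0 < K" and c0: "0 < c0" and I: "c0 * x ^ (l + 1) \<le> I"
    and l: "1 / (p - 1) \<le> real l" and m: "2 \<le> m" "2 * (1 / (p - 1)) \<le> real m - 2"
  shows "X * G powr (- \<mu> / 2) * (x ^ l * (K * R powr (-1/2) * y ^ (m - 2)))
     \<le> G powr (- (p + 1) * \<mu> / 4) * X powr p * (I * y ^ m)
       + K * (K / c0) powr (1 / (p - 1)) * \<epsilon> powr (real m - 2 - 2 * (1 / (p - 1)))"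
proof -
  define \<sigma> where "\<sigma> = 1 / (p - 1)"
  have \<sigma>: "0 < \<sigma>" "(p - 1) * \<sigma> = 1" using p by (auto simp: \<sigma>_def)
  define A where "A = G powr (- \<mu> / 2) * (x ^ l * (K * R powr (-1/2) * y ^ (m - 2)))"
  define B where "B = G powr (- (p + 1) * \<mu> / 4) * (I * y ^ m)"
  define E where "E = K * (K / c0) powr \<sigma> * \<epsilon> powr (real m - 2 - 2 * \<sigma>)"
  have I0: "0 < c0 * x ^ (l + 1)" using c0 x by simp
  then have Ipos: "0 < I" using I by linarith
  have pos: "0 < A" "0 < B" "0 \<le> E" using x y G R K c0 Ipos by (auto simp: A_def B_def E_def)
  have "X * A \<le> B * X powr p + E"
  proof (cases "X * A \<le> B * X powr p")
    case True then show ?thesis using pos by simp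
  next
    case False
    then have X0: "0 < X" using X by (cases "X = 0") auto
    have "X powr p = X * X powr (p - 1)" using X0 by (simp add: powr_diff)
    then have "X * (B * X powr (p - 1)) < X * A" using False by (simp add: mult_ac)
    then have "B * X powr (p - 1) < A" using X0 by (simp only: mult_less_cancel_left_pos)
    define Z where "Z = (K / c0) * (1 / (x * y\<^sup>2))"
    have Z: "0 < Z" using K c0 x y by (simp add: Z_def)
    have AB: "A \<le> B * (Z * G powr ((p - 1) * \<mu> / 4))"
    proof -
      have g: "G powr (- (p + 1) * \<mu> / 4) * G powr ((p - 1) * \<mu> / 4) = G powr (- \<mu> / 2)"
      proof -
        have "- (p + 1) * \<mu> / 4 + (p - 1) * \<mu> / 4 = - \<mu> / 2" by (simp add: field_simps)
        then show ?thesis by (simp add: powr_add[symmetric])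
      qed
      have yy: "y ^ m = y ^ (m - 2) * y\<^sup>2" using m le_add_diff_inverse2[of 2 m] by (metis power_add)
      have "R powr (-1/2) \<le> 1" using R powr_mono[of "-1/2" 0 R] by simp
      then have "x ^ l * (K * R powr (-1/2) * y ^ (m - 2)) \<le> x ^ l * (K * 1 * y ^ (m - 2))"
        using x y K by (intro mult_left_mono mult_right_mono) auto
      also have "\<dots> = c0 * x ^ (l + 1) * (y ^ m * Z)"
        using c0 x y by (simp add: Z_def yy field_simps)
      also have "\<dots> \<le> I * (y ^ m * Z)" using I y Z by (intro mult_right_mono) auto
      finally have "A \<le> G powr (- \<mu> / 2) * (I * (y ^ m * Z))"
        unfolding A_def by (rule mult_left_mono) simp
      then show ?thesis unfolding B_def g[symmetric] by (simp add: mult_ac)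
    qed
    then have "B * X powr (p - 1) < B * (Z * G powr ((p - 1) * \<mu> / 4))" using \<open>B * X powr (p - 1) < A\<close> by linarith
    then have "X powr (p - 1) < Z * G powr ((p - 1) * \<mu> / 4)" using pos by (simp only: mult_less_cancel_left_pos)
    then have "(X powr (p - 1)) powr \<sigma> \<le> (Z * G powr ((p - 1) * \<mu> / 4)) powr \<sigma>"
      using \<sigma> by (intro powr_mono2) auto
    also have "(X powr (p - 1)) powr \<sigma> = X" using X0 \<sigma> by (simp add: powr_powr)
    also have "(Z * G powr ((p - 1) * \<mu> / 4)) powr \<sigma> = Z powr \<sigma> * G powr (\<mu> / 4)"
    proof -
      have "(p - 1) * \<mu> / 4 * \<sigma> = (p - 1) * \<sigma> * (\<mu> / 4)" by simp
      then have e: "(p - 1) * \<mu> / 4 * \<sigma> = \<mu> / 4" unfolding \<sigma>(2) by simp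
      have "(Z * G powr ((p - 1) * \<mu> / 4)) powr \<sigma> = Z powr \<sigma> * (G powr ((p - 1) * \<mu> / 4)) powr \<sigma>"
        by (rule powr_mult)
      then show ?thesis unfolding powr_powr e .
    qed
    finally have Xle: "X \<le> Z powr \<sigma> * G powr (\<mu> / 4)" .
    have "X * A \<le> Z powr \<sigma> * G powr (\<mu> / 4) * A" using Xle pos by (intro mult_right_mono) auto
    also have "\<dots> \<le> E"
    proof -
      have r1: "R powr (-1/2) \<le> 1" using R powr_mono[of "-1/2" 0 R] by simp
      have g1: "G powr (\<mu> / 4) * G powr (- \<mu> / 2) \<le> 1"
      proof -
        have "G powr (\<mu> / 4) * G powr (- \<mu> / 2) = G powr (- \<mu> / 4)" by (simp add: powr_add[symmetric])
        also have "\<dots> \<le> G powr 0" using G \<mu> by (intro powr_mono) auto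
        finally show ?thesis using G by simp
      qed
      have Zs: "Z powr \<sigma> = (K / c0) powr \<sigma> * (x powr - \<sigma> * y powr (- 2 * \<sigma>))"
      proof -
        have "1 / (x * y\<^sup>2) = x powr - 1 * y powr - 2" using x y by (simp add: powr_minus_divide)
        then have "Z = K / c0 * (x powr - 1 * y powr - 2)" by (simp only: Z_def)
        then have "Z powr \<sigma> = (K / c0) powr \<sigma> * (x powr (- 1 * \<sigma>) * y powr (- 2 * \<sigma>))"
          by (simp only: powr_mult powr_powr)
        then show ?thesis by simp
      qed
      have "Z powr \<sigma> * G powr (\<mu> / 4) * A = (K / c0) powr \<sigma> * K * (x powr - \<sigma> * x ^ l) * (y powr (- 2 * \<sigma>) * y ^ (m - 2))
         * ((G powr (\<mu> / 4) * G powr (- \<mu> / 2)) * R powr (-1/2))"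
        unfolding Zs A_def by (simp add: mult_ac)
      also have "\<dots> \<le> (K / c0) powr \<sigma> * K * (x powr - \<sigma> * x ^ l) * (y powr (- 2 * \<sigma>) * y ^ (m - 2)) * (1 * 1)"
        using g1 r1 K x y by (intro mult_left_mono mult_mono) auto
      also have "x powr - \<sigma> * x ^ l = x powr (real l - \<sigma>)"
        using x by (simp add: powr_realpow[symmetric] powr_add[symmetric])
      also have "y powr (- 2 * \<sigma>) * y ^ (m - 2) = y powr (real m - 2 - 2 * \<sigma>)"
      proof -
        have "real (m - 2) = real m - 2" using m by simp
        then have "- 2 * \<sigma> + real (m - 2) = real m - 2 - 2 * \<sigma>" by simp
        moreover have "y ^ (m - 2) = y powr real (m - 2)" using y by (simp add: powr_realpow)
        ultimately show ?thesis by (metis powr_add)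
      qed
      also have "(K / c0) powr \<sigma> * K * x powr (real l - \<sigma>) * y powr (real m - 2 - 2 * \<sigma>) * (1 * 1)
         \<le> (K / c0) powr \<sigma> * K * 1 * \<epsilon> powr (real m - 2 - 2 * \<sigma>) * (1 * 1)"
      proof -
        have "x powr (real l - \<sigma>) \<le> 1" using x l by (intro powr_le1) (auto simp: \<sigma>_def)
        moreover have "y powr (real m - 2 - 2 * \<sigma>) \<le> \<epsilon> powr (real m - 2 - 2 * \<sigma>)"
          using y m by (intro powr_mono2) (auto simp: \<sigma>_def)
        ultimately show ?thesis using K by (intro mult_right_mono mult_mono mult_left_mono) auto
      qed
      finally show ?thesis by (simp add: E_def mult_ac)
    qed
    finally show ?thesis using pos by (smt (verit) mult_nonneg_nonneg powr_ge_zero)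
  qed
  then show ?thesis unfolding A_def B_def E_def \<sigma>_def by (simp add: mult_ac)
qed

context weak_evolution begin

text \<open>With g = -v the time derivative of the cutoff contributes a good term, a multiple of the integral
  of w g against the test function. Half of it absorbs the L term except in a boundary layer of
  relative width R^(-1/4); there the nonlinear term absorbs it up to an error that beats the volume
  R^((2N+2)/4) because m is large.\<close>

lemma nonpos_decay:
  assumes v0z: "AE \<xi> in lebesgue. v0 \<xi> = 0" and vle: "AE z in S. v (fst z) (snd z) \<le> 0"
    and \<tau>: "0 < \<tau>" "\<tau> < T" and l: "3 \<le> l" "1 / (p - 1) \<le> real l"
    and m: "3 \<le> m" "2 * N + 2 + 2 * (1 / (p - 1)) < real m - 2"
  obtains C R0 \<delta> where "0 \<le> C" "0 < \<delta>" "\<And>R. R0 \<le> R \<Longrightarrow> 0 < R \<and>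
     integrable S (\<lambda>z. - v (fst z) (snd z) * wt \<mu> (snd z) * tcut l \<tau> (fst z) * pos_pow m (1 - knorm4 (cyl (snd z)) / R)) \<and>
     (LINT z|S. - v (fst z) (snd z) * wt \<mu> (snd z) * tcut l \<tau> (fst z) * pos_pow m (1 - knorm4 (cyl (snd z)) / R)) \<le> C * R powr - \<delta>"
proof -
  define \<sigma> where "\<sigma> = 1 / (p - 1)"
  define a where "a = real l / \<tau>"
  define K where "K = 16 * (real m)\<^sup>2"
  define \<kappa> where "\<kappa> = 2 * K / a"
  define c0 where "c0 = \<tau> powr \<gamma> / (Gamma \<gamma> * (real l + 1))"
  define e where "e = real m - 2 - 2 * \<sigma>"
  define C1 where "C1 = T * 2 ^ (2 * CARD('n) + 1)"
  define B where "B = K * (K / c0) powr \<sigma>"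
  define \<delta> where "\<delta> = e / 4 - (2 * N + 2) / 4"
  define C where "C = 2 / a * (B * \<kappa> powr (e / 2) * C1)"
  have \<sigma>: "0 < \<sigma>" using p by (simp add: \<sigma>_def)
  have pos: "0 < a" "0 < K" "0 < \<kappa>" "0 < c0" "0 < C1" "0 \<le> B" "0 < \<delta>"
    using \<tau> l m \<gamma> T p by (auto simp: a_def K_def \<kappa>_def c0_def C1_def B_def \<delta>_def e_def \<sigma>_def intro!: Gamma_real_pos)
  define R0 where "R0 = max 2 (16 * \<kappa>\<^sup>2)"
  have main: "0 < R \<and>
     integrable S (\<lambda>z. - v (fst z) (snd z) * wt \<mu> (snd z) * tcut l \<tau> (fst z) * pos_pow m (1 - knorm4 (cyl (snd z)) / R)) \<and>
     (LINT z|S. - v (fst z) (snd z) * wt \<mu> (snd z) * tcut l \<tau> (fst z) * pos_pow m (1 - knorm4 (cyl (snd z)) / R)) \<le> C * R powr - \<delta>"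
    if R0: "R0 \<le> R" for R
  proof -
    have R: "2 \<le> R" "16 * \<kappa>\<^sup>2 \<le> R" using R0 by (auto simp: R0_def)
    define F where "F = (\<lambda>q. pos_pow m (1 - knorm4 q / R))"
    obtain MF where F: "radial_test N \<mu> F MF"
      and MFle: "\<And>q. 0 \<le> fst q \<Longrightarrow> q \<noteq> 0 \<Longrightarrow> MF q \<le> K * R powr (-1/2) * pos_pow (m - 2) (1 - knorm4 q / R)"
      by (rule power_cut_profile[of m R \<mu> N, folded F_def K_def]) (use m R \<mu> that in auto)
    have l2: "2 \<le> l" using l by simp
    note w = weak_identity_cut[OF l2 \<tau> F]
    note i = integrable_pieces[OF l(1) \<tau> F]
    let ?h = "\<lambda>z. - v (fst z) (snd z) * wt \<mu> (snd z) * tcut l \<tau> (fst z) * F (cyl (snd z))"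
    have ih: "integrable S ?h"
      using integrable_minus[OF i(2)] by simp
    \<comment> \<open>For y \<ge> \<epsilon> the L term is at most half of the good term.\<close>
    define \<epsilon> where "\<epsilon> = sqrt (\<kappa> * R powr (-1/2))"
    have \<epsilon>half: "\<epsilon> \<le> 1 / 2"
    proof -
      have "4 * \<kappa> \<le> sqrt R" using R by (intro real_le_rsqrt) (simp add: power_mult_distrib)
      then have "\<kappa> * R powr (-1/2) \<le> (1/2)\<^sup>2"
        using R by (simp add: powr_minus_divide powr_half_sqrt power_divide divide_simps)
      then have "\<epsilon> \<le> sqrt ((1/2)\<^sup>2)" unfolding \<epsilon>_def by (rule real_sqrt_le_mono)
      then show ?thesis by simp
    qed
    define E where "E = B * \<epsilon> powr e"
    have E: "0 \<le> E" using pos by (simp add: E_def)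
    define D where "D = {z \<in> slab T. knorm4 (cyl (snd z :: 'n heis)) < R}"
    have Dm: "emeasure S D \<le> ennreal (C1 * R powr ((2 * N + 2) / 4))"
      using emeasure_slab_koranyi_ball[of R T, where 'n='n] R T by (simp add: D_def C1_def N)
    have Ds: "D \<in> sets S"
    proof -
      have "D = slab T \<inter> {z. knorm4 (cyl (snd z :: 'n heis)) < R}" by (auto simp: D_def)
      moreover have "{z :: real \<times> 'n heis. knorm4 (cyl (snd z)) < R} \<in> sets borel" by measurable
      ultimately show ?thesis by (auto simp: sets_restrict_space)
    qed
    have Dfin: "emeasure S D < \<infinity>" using Dm by (simp add: le_less_trans)
    have iD: "integrable S (\<lambda>z. E * indicator D z)"
      using Ds Dfin by (intro integrable_mult_right integrable_real_indicator)
    have pw: "AE z in S. - Aint l \<tau> F MF z - Bint l \<tau> F z \<le> - (a / 2) * ?h z + E * indicator D z"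
      using AE_slab_mem vle AE_slab_nonzero w(6)
    proof eventually_elim
      case (elim z)
      define t where "t = fst z"
      define q where "q = cyl (snd z)"
      define X where "X = - v t (snd z)"
      define W where "W = wt \<mu> (snd z)"
      define y where "y = 1 - knorm4 q / R"
      have X: "0 \<le> X" and W: "0 \<le> W" using elim by (auto simp: X_def W_def t_def)
      have q: "q \<noteq> 0" "0 \<le> fst q" "0 < knorm4 q" using elim
        by (auto simp: q_def cyl_eq_0_iff knorm4_pos_iff)
      have y1: "y < 1" using q R by (simp add: y_def)
      have A: "- Aint l \<tau> F MF z = X * W * (tcut l \<tau> t * MF q - a * (tcut (l - 1) \<tau> t * F q))"
        by (simp add: Aint_def X_def W_def t_def q_def a_def)
      have h: "?h z = X * W * (tcut l \<tau> t * F q)" by (simp add: X_def W_def t_def q_def)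
      show ?case
      proof (cases "\<tau> \<le> t \<or> y \<le> 0")
        case True
        have AH: "- Aint l \<tau> F MF z \<le> 0 \<and> ?h z = 0"
        proof (cases "\<tau> \<le> t")
          case True
          then show ?thesis unfolding A h using l \<tau> by (simp add: tcut_eq_0)
        next
          case False
          then have y0: "y \<le> 0" using True by simp
          then have "F q = 0" "pos_pow (m - 2) y = 0" using m by (auto simp: F_def y_def intro!: pos_pow_eq_0)
          then have "MF q \<le> 0" "F q = 0" using MFle[OF q(2,1)] by (auto simp: y_def)
          then show ?thesis unfolding A h using X W by (auto intro!: mult_nonneg_nonpos)
        qed
        have "0 \<le> E * indicator D z" using E by simp
        then show ?thesis unfolding conjunct2[OF AH] using conjunct1[OF AH] elim(4) by simp
      next
        case False
        then have t: "t < \<tau>" and y: "0 < y" by auto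
        define x where "x = 1 - t / \<tau>"
        have x: "0 < x" "x \<le> 1" using t \<tau> elim by (auto simp: x_def t_def)
        have tx: "tcut k \<tau> t = x ^ k" for k using x by (simp add: tcut_def pos_pow_def x_def[symmetric])
        have py: "pos_pow k y = y ^ k" for k using y by (simp add: pos_pow_def)
        have Fq: "F q = y ^ m" using py by (simp add: F_def y_def)
        have MFq: "MF q \<le> K * R powr (-1/2) * y ^ (m - 2)" using MFle[OF q(2,1)] py[of "m - 2"] by (simp add: y_def)
        have "knorm4 q < R" using y R by (simp add: y_def)
        then have D: "indicator D z = (1::real)" using elim by (simp add: D_def q_def mem_Times_iff)
        have xl: "x ^ l \<le> x ^ (l - 1)" using x by (intro power_decreasing) auto
        have "tcut l \<tau> t * MF q - a * (tcut (l - 1) \<tau> t * F q) \<le> x ^ l * (K * R powr (-1/2) * y ^ (m - 2)) - a * (x ^ l * y ^ m)"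
          unfolding tx Fq using x y xl MFq pos
          by (intro diff_mono mult_left_mono mult_right_mono) auto
        from mult_left_mono[OF this, of "X * W"] X W
        have A1: "- Aint l \<tau> F MF z \<le> X * W * (x ^ l * (K * R powr (-1/2) * y ^ (m - 2))) - a * (X * W * (x ^ l * y ^ m))"
          unfolding A by (simp add: algebra_simps)
        have h1: "?h z = X * W * (x ^ l * y ^ m)" unfolding h tx Fq ..
        have h0: "0 \<le> X * W * (x ^ l * y ^ m)" using X W x y by simp
        show ?thesis
        proof (cases "\<kappa> * R powr (-1/2) \<le> y\<^sup>2")
          case True
          have "K * R powr (-1/2) = a / 2 * (\<kappa> * R powr (-1/2))" using pos by (simp add: \<kappa>_def)
          also have "\<dots> \<le> a / 2 * y\<^sup>2" using True pos by (intro mult_left_mono) auto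
          finally have "K * R powr (-1/2) * y ^ (m - 2) \<le> a / 2 * y\<^sup>2 * y ^ (m - 2)"
            using y by (intro mult_right_mono) auto
          also have "\<dots> = a / 2 * y ^ m"
          proof -
            have "2 + (m - 2) = m" using m by simp
            then have "y ^ m = y\<^sup>2 * y ^ (m - 2)" by (metis power_add)
            then show ?thesis by simp
          qed
          finally have "X * W * (x ^ l * (K * R powr (-1/2) * y ^ (m - 2))) \<le> X * W * (x ^ l * (a / 2 * y ^ m))"
            using X W x by (intro mult_left_mono) auto
          then have "- Aint l \<tau> F MF z \<le> - (a / 2) * (X * W * (x ^ l * y ^ m))" using A1 by (simp add: algebra_simps)
          then show ?thesis unfolding h1 D using E elim(4) by simp
        next
          case False
          have "y \<le> \<epsilon>" unfolding \<epsilon>_def using False y by (intro real_le_rsqrt) auto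
          then have "knorm4 q / R \<ge> 1 / 2" using \<epsilon>half by (simp add: y_def)
          then have G: "1 \<le> knorm4 q" using R by (simp add: field_simps)
          have I: "c0 * x ^ (l + 1) \<le> frac_int T \<gamma> (tcut l \<tau>) t"
            using frac_int_tcut_lower[OF \<gamma> _ t \<tau>(2), of l] elim l unfolding tx c0_def by (simp add: t_def)
          have "X * knorm4 q powr (- \<mu> / 2) * (x ^ l * (K * R powr (-1/2) * y ^ (m - 2)))
           \<le> knorm4 q powr (- (p + 1) * \<mu> / 4) * X powr p * (frac_int T \<gamma> (tcut l \<tau>) t * y ^ m) + E"
            using absorption[OF p \<mu>(1) X x y \<open>y \<le> \<epsilon>\<close> G _ pos(2) pos(4) I l(2), of R m] m R N
            unfolding E_def B_def e_def \<sigma>_def by auto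
          moreover have "Bint l \<tau> F z = knorm4 q powr (- (p + 1) * \<mu> / 4) * X powr p * (frac_int T \<gamma> (tcut l \<tau>) t * y ^ m)"
            using elim by (simp add: Bint_def knorm_powr q_def[symmetric] t_def[symmetric] X_def Fq)
          ultimately have "X * W * (x ^ l * (K * R powr (-1/2) * y ^ (m - 2))) \<le> Bint l \<tau> F z + E"
            by (simp add: W_def wt_def q_def)
          moreover have "a / 2 * (X * W * (x ^ l * y ^ m)) \<le> a * (X * W * (x ^ l * y ^ m))"
            using h0 pos by (intro mult_right_mono) auto
          ultimately show ?thesis unfolding h1 D using A1 by linarith
        qed
      qed
    qed
    have "0 \<le> (LINT z|S. Fint l \<tau> F z)" by (rule integral_nonneg_AE[OF w(7)])
    moreover have "(LINT \<xi>|lebesgue. wt \<mu> \<xi> * v0 \<xi> * F (cyl \<xi>)) = 0"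
      by (rule integral_eq_zero_AE) (use v0z in \<open>auto elim: eventually_mono\<close>)
    ultimately have "0 \<le> (LINT z|S. - Aint l \<tau> F MF z - Bint l \<tau> F z)"
      using w(5) w(1,2) by simp
    also have "\<dots> \<le> (LINT z|S. - (a / 2) * ?h z + E * indicator D z)"
      by (rule integral_mono_AE[OF _ _ pw])
         (use w(1,2) ih iD in \<open>auto intro!: Bochner_Integration.integrable_add Bochner_Integration.integrable_diff integrable_mult_right integrable_minus simp del: mult_minus_left\<close>)
    also have "\<dots> = - (a / 2) * (LINT z|S. ?h z) + E * measure S D"
    proof -
      have "(LINT z|S. - (a / 2) * ?h z + E * indicator D z) = (LINT z|S. - (a / 2) * ?h z) + (LINT z|S. E * indicator D z)"
        by (rule Bochner_Integration.integral_add[OF integrable_mult_right[OF ih] iD])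
      moreover have "D \<inter> space S = D" by (auto simp: D_def space_restrict_space)
      ultimately show ?thesis by (simp only: integral_mult_right_zero Bochner_Integration.integral_indicator)
    qed
    finally have "a / 2 * (LINT z|S. ?h z) \<le> E * measure S D" by simp
    also have "\<dots> \<le> E * (C1 * R powr ((2 * N + 2) / 4))"
      using Dm pos E by (intro mult_left_mono) (auto simp: measure_def intro!: enn2real_leI)
    also have "E = B * (\<kappa> powr (e / 2) * R powr (- e / 4))"
    proof -
      have "\<epsilon> = (\<kappa> * R powr (-1/2)) powr (1/2)" using pos by (simp add: \<epsilon>_def powr_half_sqrt)
      then show ?thesis using pos by (simp add: E_def powr_powr powr_mult)
    qed
    also have "B * (\<kappa> powr (e / 2) * R powr (- e / 4)) * (C1 * R powr ((2 * N + 2) / 4))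
       = B * \<kappa> powr (e / 2) * C1 * R powr - \<delta>"
    proof -
      have "- \<delta> = - e / 4 + (2 * N + 2) / 4" by (simp add: \<delta>_def)
      then have "R powr - \<delta> = R powr (- e / 4) * R powr ((2 * N + 2) / 4)" by (simp only: powr_add)
      then show ?thesis by simp
    qed
    finally have "(LINT z|S. ?h z) \<le> C * R powr - \<delta>"
      using pos by (simp add: C_def field_simps)
    then show ?thesis using R ih by (simp add: F_def)
  qed
  show thesis
    by (rule that[of C \<delta> R0, OF _ pos(7) main]) (use pos in \<open>auto simp: C_def\<close>)
qed

lemma nonpos_solution_vanishes:
  assumes v0z: "AE \<xi> in lebesgue. v0 \<xi> = 0" and vle: "AE z in S. v (fst z) (snd z) \<le> 0"
  shows "AE z in S. v (fst z) (snd z) = 0"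
proof -
  define l where "l = 3 + nat \<lceil>1 / (p - 1)\<rceil>"
  define m where "m = 6 + nat \<lceil>2 * N + 2 + 2 * (1 / (p - 1))\<rceil>"
  have l: "3 \<le> l" "1 / (p - 1) \<le> real l" unfolding l_def by linarith+
  have m: "3 \<le> m" "2 * N + 2 + 2 * (1 / (p - 1)) < real m - 2" unfolding m_def by linarith+
  have step: "AE z in S. fst z < \<tau> \<and> knorm4 (cyl (snd z)) < real n \<longrightarrow> v (fst z) (snd z) = 0"
    if \<tau>: "0 < \<tau>" "\<tau> < T" for \<tau> and n :: nat
  proof -
    obtain C R0 \<delta> where C: "0 \<le> C" "0 < \<delta>" and main: "\<And>R. R0 \<le> R \<Longrightarrow> 0 < R \<and>
     integrable S (\<lambda>z. - v (fst z) (snd z) * wt \<mu> (snd z) * tcut l \<tau> (fst z) * pos_pow m (1 - knorm4 (cyl (snd z)) / R)) \<and>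
     (LINT z|S. - v (fst z) (snd z) * wt \<mu> (snd z) * tcut l \<tau> (fst z) * pos_pow m (1 - knorm4 (cyl (snd z)) / R)) \<le> C * R powr - \<delta>"
      by (rule nonpos_decay[OF v0z vle \<tau> l m]) (rule that)
    define J where "J = (\<lambda>z. - v (fst z) (snd z) * (wt \<mu> (snd z) * tcut l \<tau> (fst z) * indicator {z. knorm4 (cyl (snd z)) < real n} z))"
    have Jm: "J \<in> borel_measurable S"
    proof -
      have "(\<lambda>z::real \<times> 'n heis. wt \<mu> (snd z) * tcut l \<tau> (fst z) * indicator {z. knorm4 (cyl (snd z)) < real n} z) \<in> borel_measurable S"
        by (rule borel_measurable_slab) measurable
      from borel_measurable_times[OF borel_measurable_uminus[OF v_meas] this] show ?thesis unfolding J_def .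
    qed
    have Jnn: "AE z in S. 0 \<le> J z"
      using vle unfolding J_def by eventually_elim (intro mult_nonneg_nonneg, auto)
    have le: "(\<integral>\<^sup>+z. ennreal (J z) \<partial>S) \<le> ennreal (2 ^ m * (C * R powr - \<delta>))" if R: "max R0 (2 * real n) \<le> R" for R
    proof -
      have R': "R0 \<le> R" "2 * real n \<le> R" using R by auto
      note M = main[OF R'(1)]
      let ?h = "\<lambda>z. - v (fst z) (snd z) * wt \<mu> (snd z) * tcut l \<tau> (fst z) * pos_pow m (1 - knorm4 (cyl (snd z)) / R)"
      have "(\<integral>\<^sup>+z. ennreal (J z) \<partial>S) \<le> (\<integral>\<^sup>+z. ennreal (2 ^ m * ?h z) \<partial>S)"
      proof (rule nn_integral_mono_AE, use vle in eventually_elim, rule ennreal_leI)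
        fix z :: "real \<times> 'n heis" assume v: "v (fst z) (snd z) \<le> 0"
        have c: "0 \<le> - v (fst z) (snd z) * wt \<mu> (snd z) * tcut l \<tau> (fst z)" using v by (intro mult_nonneg_nonneg) auto
        show "J z \<le> 2 ^ m * ?h z"
        proof (cases "knorm4 (cyl (snd z)) < real n")
          case True
          have "1 / 2 \<le> 1 - knorm4 (cyl (snd z)) / R" using True R' M by (simp add: field_simps)
          then have "(1 / 2) ^ m \<le> pos_pow m (1 - knorm4 (cyl (snd z)) / R)" by (rule pos_pow_ge_half)
          then have "1 \<le> 2 ^ m * pos_pow m (1 - knorm4 (cyl (snd z)) / R)" by (simp add: power_divide field_simps)
          from mult_left_mono[OF this c] show ?thesis using True by (simp add: J_def mult_ac)
        next
          case False
          then have "J z = 0" by (simp add: J_def)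
          moreover have "0 \<le> 2 ^ m * ?h z" using c by (intro mult_nonneg_nonneg[OF _ mult_nonneg_nonneg]) auto
          ultimately show ?thesis by linarith
        qed
      qed
      also have "\<dots> = ennreal (LINT z|S. 2 ^ m * ?h z)"
      proof (rule nn_integral_eq_integral)
        show "integrable S (\<lambda>z. 2 ^ m * ?h z)" using M by (intro integrable_mult_right) simp
        show "AE z in S. 0 \<le> 2 ^ m * ?h z"
          using vle
        proof eventually_elim
          case (elim z)
          then show ?case by (intro mult_nonneg_nonneg) auto
        qed
      qed
      also have "(LINT z|S. 2 ^ m * ?h z) = 2 ^ m * (LINT z|S. ?h z)" by (rule integral_mult_right_zero)
      also have "ennreal (2 ^ m * (LINT z|S. ?h z)) \<le> ennreal (2 ^ m * (C * R powr - \<delta>))"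
        using M by (intro ennreal_leI mult_left_mono) auto
      finally show ?thesis .
    qed
    have "((\<lambda>R. R powr - \<delta>) \<longlongrightarrow> 0) at_top"
      using C by (intro tendsto_neg_powr filterlim_ident) auto
    then have "((\<lambda>R. 2 ^ m * (C * R powr - \<delta>)) \<longlongrightarrow> 2 ^ m * (C * 0)) at_top"
      by (intro tendsto_intros)
    then have lim: "((\<lambda>R. 2 ^ m * (C * R powr - \<delta>)) \<longlongrightarrow> 0) at_top" by simp
    have "AE z in S. J z = 0"
    proof (rule AE_zero_of_vanishing_bound[OF Jm Jnn _ lim])
      show "\<forall>\<^sub>F R in at_top. (\<integral>\<^sup>+z. ennreal (J z) \<partial>S) \<le> ennreal (2 ^ m * (C * R powr - \<delta>))"
        using eventually_ge_at_top[of "max R0 (2 * real n)"] by eventually_elim (rule le)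
    qed simp
    then show ?thesis using AE_slab_nonzero
    proof eventually_elim
      case (elim z)
      then show ?case
        using wt_pos[OF elim(2), of \<mu>] tcut_pos[of "fst z" \<tau> l] \<tau> by (auto simp: J_def)
    qed
  qed
  show ?thesis
  proof (rule AE_slab_exhaust)
    fix \<tau> assume "0 < \<tau>" "\<tau> < T"
    then have "AE z in S. \<forall>n::nat. fst z < \<tau> \<and> knorm4 (cyl (snd z)) < real n \<longrightarrow> v (fst z) (snd z) = 0"
      unfolding AE_all_countable using step by blast
    then show "AE z in S. fst z < \<tau> \<longrightarrow> v (fst z) (snd z) = 0"
      by eventually_elim (meson reals_Archimedean2)
  qed
qed

text \<open>For v = 0 the weak identity says that two nonnegative integrals, containing v0 and f, add up to 0.\<close>

lemma zero_solution_zero_data: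
  assumes vz: "AE z in S. v (fst z) (snd z) = 0"
  shows "AE \<xi> in lebesgue. v0 \<xi> = 0" "AE \<xi> in lebesgue. f \<xi> = 0"
proof -
  define \<tau> where "\<tau> = T / 2"
  have \<tau>: "0 < \<tau>" "\<tau> < T" using T by (auto simp: \<tau>_def)
  have step: "(AE \<xi> in lebesgue. knorm4 (cyl \<xi>) < real n + 1 \<longrightarrow> v0 \<xi> = 0) \<and>
     (AE z in S. fst z < \<tau> \<and> knorm4 (cyl (snd z)) < real n + 1 \<longrightarrow> f (snd z) = 0)" for n :: nat
  proof -
    define F where "F = (\<lambda>q. pos_pow 3 (1 - knorm4 q / (real n + 1)))"
    obtain MF where F: "radial_test N \<mu> F MF"
      by (rule power_cut_profile[of 3 "real n + 1" \<mu> N, folded F_def]) (use \<mu> that in auto)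
    have Fpos: "0 < F q" if "knorm4 q < real n + 1" for q
      using that by (simp add: F_def pos_pow_def max_def)
    note w = weak_identity_cut[of 3, OF _ \<tau> F, simplified]
    have "(LINT z|S. Aint 3 \<tau> F MF z) = 0"
      by (rule integral_eq_zero_AE) (use vz in eventually_elim, simp add: Aint_def)
    moreover have "(LINT z|S. Bint 3 \<tau> F z) = 0"
      by (rule integral_eq_zero_AE) (use vz in eventually_elim, simp add: Bint_def)
    ultimately have "(LINT \<xi>|lebesgue. wt \<mu> \<xi> * v0 \<xi> * F (cyl \<xi>)) + (LINT z|S. Fint 3 \<tau> F z) = 0"
      using w(5) by simp
    moreover have "0 \<le> (LINT \<xi>|lebesgue. wt \<mu> \<xi> * v0 \<xi> * F (cyl \<xi>))" by (rule integral_nonneg_AE[OF w(8)])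
    moreover have "0 \<le> (LINT z|S. Fint 3 \<tau> F z)" by (rule integral_nonneg_AE[OF w(7)])
    ultimately have "(LINT \<xi>|lebesgue. wt \<mu> \<xi> * v0 \<xi> * F (cyl \<xi>)) = 0" "(LINT z|S. Fint 3 \<tau> F z) = 0"
      by linarith+
    then have z: "AE \<xi> in lebesgue. wt \<mu> \<xi> * v0 \<xi> * F (cyl \<xi>) = 0" "AE z in S. Fint 3 \<tau> F z = 0"
      using integral_nonneg_eq_0_iff_AE[OF w(4,8)] integral_nonneg_eq_0_iff_AE[OF w(3,7)] by auto
    have "AE \<xi> in lebesgue. \<xi> \<noteq> (0 :: 'n heis)" by (rule AE_completion[OF AE_lborel_singleton])
    with z(1) have "AE \<xi> in lebesgue. knorm4 (cyl \<xi>) < real n + 1 \<longrightarrow> v0 \<xi> = 0"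
    proof eventually_elim
      case (elim \<xi>)
      then show ?case using wt_pos[of \<xi> \<mu>] Fpos[of "cyl \<xi>"] by auto
    qed
    moreover have "AE z in S. fst z < \<tau> \<and> knorm4 (cyl (snd z)) < real n + 1 \<longrightarrow> f (snd z) = 0"
      using z(2) AE_slab_mem AE_slab_nonzero
    proof eventually_elim
      case (elim z)
      have "0 < knorm (snd z) powr - \<mu>"
        using knorm4_cyl_pos[OF elim(3)] by (simp add: knorm_powr)
      then show ?case using elim Fpos[of "cyl (snd z)"] tcut_pos[of "fst z" \<tau> 3] \<tau>
        by (auto simp: Fint_def)
    qed
    ultimately show ?thesis by blast
  qed
  have "AE \<xi> in lebesgue. \<forall>n::nat. knorm4 (cyl \<xi>) < real n + 1 \<longrightarrow> v0 \<xi> = 0"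
    unfolding AE_all_countable using step by blast
  then show "AE \<xi> in lebesgue. v0 \<xi> = 0"
    by eventually_elim (meson less_add_one less_trans reals_Archimedean2)
  have "AE z in S. \<forall>n::nat. fst z < \<tau> \<and> knorm4 (cyl (snd z)) < real n + 1 \<longrightarrow> f (snd z) = 0"
    unfolding AE_all_countable using step by blast
  then have "AE z in S. fst z < \<tau> \<longrightarrow> f (snd z) = 0"
    by eventually_elim (meson less_add_one less_trans reals_Archimedean2)
  then have "AE z in lebesgue. (z :: real \<times> 'n heis) \<in> slab \<tau> \<longrightarrow> f (snd z) = 0"
    unfolding AE_lebesgue_on_slab by eventually_elim (use \<tau> in auto)
  then show "AE \<xi> in lebesgue. f \<xi> = 0" using \<tau>(1) by (rule AE_lebesgue_slab_snd)
qed

end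

section \<open>Nonexistence\<close>

text \<open>For \<theta> < 1 the inequality with s = t gives u \<ge> 0 at positive times, so a further factor \<theta> does no
  harm; for \<theta> = 1 no factor is lost.\<close>

lemma almost_monotone_chain:
  fixes u :: "real \<Rightarrow> 'a \<Rightarrow> real"
  assumes "0 < \<delta>" "0 < \<theta>" "\<theta> \<le> 1"
    and mono: "\<And>t s \<xi>. 0 < t \<Longrightarrow> t < T \<Longrightarrow> t - \<delta> \<le> s \<Longrightarrow> s \<le> t \<Longrightarrow> 0 \<le> s \<Longrightarrow> \<theta> * u t \<xi> \<le> u s \<xi>"
  obtains \<Theta> where "0 < \<Theta>" "\<And>s t \<xi>. 0 \<le> s \<Longrightarrow> s \<le> t \<Longrightarrow> 0 < t \<Longrightarrow> t < T \<Longrightarrow> \<Theta> * u t \<xi> \<le> u s \<xi>" "\<theta> = 1 \<Longrightarrow> \<Theta> = 1"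
proof -
  have nn: "0 \<le> u t \<xi>" if "\<theta> < 1" "0 < t" "t < T" for t \<xi>
  proof -
    have "\<theta> * u t \<xi> \<le> u t \<xi>" using mono[of t t \<xi>] that assms by simp
    then have "0 \<le> (1 - \<theta>) * u t \<xi>" by (simp add: left_diff_distrib)
    then show ?thesis using that by (simp add: zero_le_mult_iff)
  qed
  have dec: "\<theta> ^ Suc n * u t \<xi> \<le> \<theta> ^ n * u t \<xi>" if "0 < t" "t < T" for n t \<xi>
  proof (cases "\<theta> = 1")
    case False
    then have "0 \<le> u t \<xi>" using nn that assms by simp
    then have "\<theta> ^ Suc n * u t \<xi> \<le> 1 * \<theta> ^ n * u t \<xi>"
      unfolding power_Suc using assms by (intro mult_right_mono) auto
    then show ?thesis by simp
  qed simp
  have chain: "\<theta> ^ n * u t \<xi> \<le> u s \<xi>"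
    if "0 \<le> s" "s \<le> t" "0 < t" "t < T" "t - real n * \<delta> \<le> s" for n s t \<xi>
    using that
  proof (induction n arbitrary: s)
    case 0
    then show ?case by simp
  next
    case (Suc n)
    show ?case
    proof (cases "t - real n * \<delta> \<le> s")
      case True
      then show ?thesis using Suc.IH[of s] Suc.prems dec[of t n \<xi>] by linarith
    next
      case False
      define r where "r = t - real n * \<delta>"
      have r: "0 < r" "r \<le> t" "s \<le> r" "r - \<delta> \<le> s"
        using False Suc.prems assms(1) by (auto simp: r_def algebra_simps)
      have "\<theta> ^ n * u t \<xi> \<le> u r \<xi>" using Suc.IH[of r] r Suc.prems by (simp add: r_def)
      then have "\<theta> * (\<theta> ^ n * u t \<xi>) \<le> \<theta> * u r \<xi>" using assms by (intro mult_left_mono) auto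
      also have "\<dots> \<le> u s \<xi>" using r Suc.prems by (intro mono) auto
      finally show ?thesis by simp
    qed
  qed
  obtain n :: nat where n: "T / \<delta> \<le> real n" using real_arch_simple by blast
  show thesis
  proof
    show "0 < \<theta> ^ n" using assms by simp
    fix s t \<xi> assume st: "0 \<le> s" "s \<le> t" "0 < t" "t < T"
    have "T \<le> real n * \<delta>" using n assms by (simp add: field_simps)
    then show "\<theta> ^ n * u t \<xi> \<le> u s \<xi>" using st by (intro chain) auto
  qed simp
qed

theorem theorem3p2:
  fixes u0 f :: "'n::finite heis \<Rightarrow> real"
    and lam \<gamma> \<alpha> p T :: real
  assumes "0 < lam" and "lam < ((hom_dim TYPE('n) - 2) / 2)\<^sup>2"
    and "0 < \<gamma>" and "\<gamma> < 1"
    and "- 1 < \<alpha>"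
    and "Linf u0" and "AE \<xi> in lebesgue. 0 \<le> u0 \<xi>"
    and "Linf f" and "AE \<xi> in lebesgue. 0 \<le> f \<xi>"
    and "(hardy_mu TYPE('n) lam + 2) / hardy_mu TYPE('n) lam < p"
    and "0 < T"
  shows "\<not> (\<exists>u. weak_solution lam p \<gamma> \<alpha> T u0 f u \<and>
               (\<exists>\<delta>>0. \<exists>\<theta>. 0 < \<theta> \<and> \<theta> \<le> 1 \<and>
                  (\<forall>t\<in>{0<..<T}. \<forall>s\<in>{t - \<delta>..t}. 0 \<le> s \<longrightarrow> (\<forall>\<xi>. \<theta> * u t \<xi> \<le> u s \<xi>))) \<and>
               \<not> trivial_case T u0 f u)"
proof (rule notI, elim exE conjE)
  fix u \<delta> \<theta>
  assume sol: "weak_solution lam p \<gamma> \<alpha> T u0 f u" and nontriv: "\<not> trivial_case T u0 f u"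
    and \<delta>: "0 < \<delta>" and \<theta>: "0 < \<theta>" "\<theta> \<le> 1"
    and mono: "\<forall>t\<in>{0<..<T}. \<forall>s\<in>{t - \<delta>..t}. 0 \<le> s \<longrightarrow> (\<forall>\<xi>. \<theta> * u t \<xi> \<le> u s \<xi>)"
  define N where "N = real CARD('n)"
  define \<mu> where "\<mu> = hardy_mu TYPE('n) lam"
  define v where "v = (\<lambda>t \<xi>. knorm \<xi> powr \<mu> * u t \<xi>)"
  define v0 where "v0 = (\<lambda>\<xi>. knorm \<xi> powr \<mu> * u0 \<xi>)"
  have hd: "(hom_dim TYPE('n) - 2) / 2 = N" by (simp add: hom_dim_def N_def)
  have \<mu>_eq: "\<mu> = N - sqrt (N\<^sup>2 - lam)" by (simp add: \<mu>_def hardy_mu_def hd)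
  have N0: "0 < N" by (simp add: N_def)
  have \<mu>: "0 < \<mu>" "\<mu> < N"
  proof -
    have "sqrt (N\<^sup>2 - lam) < sqrt (N\<^sup>2)" using assms(1) by (intro real_sqrt_less_mono) simp
    then show "0 < \<mu>" using N0 by (simp add: \<mu>_eq)
    have "0 < sqrt (N\<^sup>2 - lam)" using assms(2) by (simp add: hd)
    then show "\<mu> < N" by (simp add: \<mu>_eq)
  qed
  have p: "1 < p"
  proof -
    have "1 < (\<mu> + 2) / \<mu>" using \<mu> by (simp add: field_simps)
    then show ?thesis using assms(10) by (simp add: \<mu>_def)
  qed
  have init: "AE \<xi> in lebesgue. u 0 \<xi> = u0 \<xi>"
    and v0m: "v0 \<in> borel_measurable lebesgue"
    and vm: "(\<lambda>(t, \<xi>). v t \<xi>) \<in> borel_measurable (lebesgue_on (slab T))"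
    and weak: "\<And>\<phi>. test_function T \<phi> \<Longrightarrow> (\<forall>t\<in>{0..<T}. \<forall>\<xi>. 0 \<le> \<phi> t \<xi>) \<Longrightarrow> weak_identity \<mu> p \<gamma> \<alpha> T f v0 v \<phi>"
    using sol unfolding weak_solution_def Let_def L1_loc_def Lp_loc_def v_def v0_def \<mu>_def by blast+
  interpret weak_evolution N \<mu> p \<gamma> \<alpha> T f v0 v
  proof
    show "AE \<xi> in lebesgue. 0 \<le> v0 \<xi>" using assms(7) by eventually_elim (simp add: v0_def)
    show "(\<lambda>z. v (fst z) (snd z)) \<in> borel_measurable (lebesgue_on (slab T))"
      using vm by (simp add: case_prod_beta')
  qed (use N_def \<mu> assms p weak in auto)
  obtain \<Theta> where \<Theta>: "0 < \<Theta>" "\<And>s t \<xi>. 0 \<le> s \<Longrightarrow> s \<le> t \<Longrightarrow> 0 < t \<Longrightarrow> t < T \<Longrightarrow> \<Theta> * u t \<xi> \<le> u s \<xi>"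
    and \<Theta>1: "\<theta> = 1 \<Longrightarrow> \<Theta> = 1"
    by (rule almost_monotone_chain[of \<delta> \<theta> T u, OF \<delta> \<theta>], rule mono[rule_format]) (auto intro: that)
  obtain C where C: "AE \<xi> in lebesgue. \<bar>u0 \<xi>\<bar> \<le> C" using assms(6) unfolding Linf_def by blast
  have kn: "knorm \<xi> powr \<mu> = knorm4 (cyl \<xi>) powr (\<mu> / 4)" for \<xi> :: "'n heis" by (rule knorm_powr)
  have vz: "AE z in S. v (fst z) (snd z) = 0"
  proof (cases "\<theta> = 1")
    case False
    have unn: "0 \<le> u t \<xi>" if "0 < t" "t < T" for t \<xi>
    proof -
      have "\<theta> * u t \<xi> \<le> u t \<xi>" using that \<delta> by (intro mono[rule_format]) auto
      then have "0 \<le> (1 - \<theta>) * u t \<xi>" by (simp add: left_diff_distrib)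
      then show ?thesis using False \<theta> by (simp add: zero_le_mult_iff)
    qed
    show ?thesis
    proof (rule nonneg_solution_vanishes[OF _ \<Theta>(1), of "\<bar>C\<bar> / \<Theta>"])
      show "0 \<le> v t \<xi>" if "0 < t" "t < T" for t \<xi> using unn that by (simp add: v_def)
      show "\<Theta> * v t \<xi> \<le> v s \<xi>" if "0 < s" "s \<le> t" "t < T" for s t \<xi>
        using mult_left_mono[OF \<Theta>(2)[of s t \<xi>], of "knorm \<xi> powr \<mu>"] that by (simp add: v_def mult_ac)
      have "AE \<xi> in lebesgue. u 0 \<xi> \<le> \<bar>C\<bar>"
        using C init by eventually_elim linarith
      from AE_slab_snd[OF this, of T] AE_slab_mem
      show "AE z in S. v (fst z) (snd z) \<le> \<bar>C\<bar> / \<Theta> * knorm4 (cyl (snd z)) powr (\<mu> / 4)"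
      proof eventually_elim
        case (elim z)
        have "\<Theta> * u (fst z) (snd z) \<le> \<bar>C\<bar>" using \<Theta>(2)[of 0 "fst z" "snd z"] elim by linarith
        then have "u (fst z) (snd z) \<le> \<bar>C\<bar> / \<Theta>" using \<Theta>(1) by (simp add: field_simps)
        from mult_left_mono[OF this, of "knorm (snd z) powr \<mu>"]
        show ?case unfolding v_def kn[symmetric] by (simp add: mult.commute)
      qed
    qed (use \<Theta> in auto)
  next
    case True
    have le0: "AE \<xi> in lebesgue. \<forall>t\<in>{0<..<T}. v t \<xi> \<le> v0 \<xi>"
      using init
    proof eventually_elim
      case (elim \<xi>)
      show ?case
      proof
        fix t assume "t \<in> {0<..<T}"
        then have "u t \<xi> \<le> u0 \<xi>" using \<Theta>(2)[of 0 t \<xi>] \<Theta>1[OF True] elim by simp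
        then show "v t \<xi> \<le> v0 \<xi>" by (simp add: v_def v0_def mult_left_mono)
      qed
    qed
    have v0z: "AE \<xi> in lebesgue. v0 \<xi> = 0"
    proof (rule initial_datum_vanishes[OF le0 v0m, of "\<bar>C\<bar>"])
      show "AE \<xi> in lebesgue. v0 \<xi> \<le> \<bar>C\<bar> * knorm4 (cyl \<xi>) powr (\<mu> / 4)"
        using C
      proof eventually_elim
        case (elim \<xi>)
        then have "u0 \<xi> \<le> \<bar>C\<bar>" by linarith
        then show ?case unfolding v0_def kn[symmetric] by (simp add: mult.commute mult_right_mono)
      qed
    qed simp
    show ?thesis
    proof (rule nonpos_solution_vanishes[OF v0z])
      show "AE z in S. v (fst z) (snd z) \<le> 0"
        using AE_slab_snd[OF le0, of T] AE_slab_snd[OF v0z, of T] AE_slab_mem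
        by eventually_elim auto
    qed
  qed
  have knpos: "0 < knorm \<xi> powr \<mu>" if "\<xi> \<noteq> 0" for \<xi> :: "'n heis"
    using knorm4_cyl_pos[OF that] by (simp add: kn)
  have nz: "AE \<xi> in lebesgue. \<xi> \<noteq> (0 :: 'n heis)" by (rule AE_completion[OF AE_lborel_singleton])
  have "AE \<xi> in lebesgue. u0 \<xi> = 0"
    using zero_solution_zero_data(1)[OF vz] nz
    by eventually_elim (use knpos in \<open>force simp: v0_def\<close>)
  moreover have "AE z in S. u (fst z) (snd z) = 0"
    using vz AE_slab_nonzero by eventually_elim (use knpos in \<open>force simp: v_def\<close>)
  ultimately have "trivial_case T u0 f u"
    using zero_solution_zero_data(2)[OF vz] by (simp add: trivial_case_def case_prod_beta')
  with nontriv show False by contradiction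
qed

end
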